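(* Let $\Gamma=(V,E,\ell,\mathcal{H}_\Gamma)$ be a compact connected quantum graph with $\delta$-type vertex conditions, where the Dirichlet condition ($\alpha_\upsilon=\infty$) is allowed only at vertices of degree $1$, with at least one cycle and with the standard Schrödinger operator $\mathcal{H}_\Gamma=-d^2/dx^2$, and let $\mathcal{T}$ be its universal cover with covering map $\Xi:\mathcal{T}\to\Gamma$. Then for a residual set of edge lengths $\ell$ in $\mathbb{R}_+^{|E|}$ (the combinatorial graph $(V,E)$ and the constants $\alpha_\upsilon$ being fixed), $\sigma_{\mathfrak p}(\mathcal{H}_{\mathcal{T}})=\emptyset$.
   Context: A metric graph $\Gamma=(V,E,\ell)$ is a simple (no loops, no multiple edges), locally finite graph with edge lengths $\ell_e>0$ bounded below by a positive constant; each edge $e$ is identified with the interval $[0,\ell_e]$, with endpoints glued at the vertices. It is compact if $V,E$ are finite. $\mathbb{R}_+=(0,\infty)$. A residual set is a set containing a countable intersection of open dense sets. A quantum graph $\Gamma=(V,E,\ell,\mathcal{H}_\Gamma)$ with the standard Schrödinger operator and $\delta$-type vertex conditions is given by a metric graph and constants $\alpha_\upsilon\in\mathbb{R}\cup\{\infty\}$, $\upsilon\in V$. $\mathcal{H}_\Gamma$ acts in $\bigoplus_{e\in E}L^2(e)$ by $f\mapsto -f''$ on each edge, with domain the set of $f\in\bigoplus_{e}H^2(e)$ (Hilbert direct sum) such that at every vertex $\upsilon$: $f$ is continuous, and if $\alpha_\upsilon<\infty$ the sum over edges incident to $\upsilon$ of the derivatives of $f$ at $\upsilon$, taken outgoing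 from $\upsilon$, equals $\alpha_\upsilon f(\upsilon)$, while if $\alpha_\upsilon=\infty$ then $f(\upsilon)=0$ (Dirichlet). The universal cover $\mathcal{T}$ of $\Gamma$ is the tree which is the universal cover of the connected graph $\Gamma$, with covering map $\Xi$, where lengths and vertex constants are lifted through $\Xi$. $\sigma_{\mathfrak p}$ denotes the set of eigenvalues. *)

theory Defs
  imports "HOL-Analysis.Analysis" "Graph_Theory.Graph_Theory"
begin

text \<open>
  A simple undirected graph is represented, following the entry Graph_Theory, by the symmetric
  loop-free digraph that contains both arcs \<open>(u,v)\<close> and \<open>(v,u)\<close> for every edge \<open>{u,v}\<close>.
  Thus \<^locale>\<open>pair_graph\<close> is a finite simple graph, \<^locale>\<open>pair_bidirected_digraph\<close> a possibly
  infinite one, and the degree of a vertex is its \<^const>\<open>out_degree\<close>.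
\<close>

definition arc_edge :: "'v \<times> 'v \<Rightarrow> 'v set" where
  "arc_edge a = {fst a, snd a}"

definition edges :: "'v pair_pre_digraph \<Rightarrow> 'v set set" where
  "edges G = arc_edge ` parcs G"

text \<open>
  \<^const>\<open>pre_digraph.cycle\<close> also counts the closed walk \<open>u, v, u\<close> along a single edge, which is
  not a cycle of the undirected graph; hence the lower bound on the length. For the same reason
  the predicates \<^const>\<open>forest\<close> and \<^const>\<open>tree\<close> cannot be used for symmetric digraphs.
\<close>

definition has_undirected_cycle :: "'v pair_pre_digraph \<Rightarrow> bool" where
  "has_undirected_cycle G \<longleftrightarrow> (\<exists>p. pre_digraph.cycle (with_proj G) p \<and> length p \<ge> 3)"

definition undirected_tree :: "'v pair_pre_digraph \<Rightarrow> bool" where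
  "undirected_tree T \<longleftrightarrow>
     pair_bidirected_digraph T \<and> Digraph_Component.connected (with_proj T) \<and>
     \<not> has_undirected_cycle T"

definition neighbours :: "'v pair_pre_digraph \<Rightarrow> 'v \<Rightarrow> 'v set" where
  "neighbours G v = {w. (v, w) \<in> parcs G}"

definition graph_covering :: "'t pair_pre_digraph \<Rightarrow> 'v pair_pre_digraph \<Rightarrow> ('t \<Rightarrow> 'v) \<Rightarrow> bool" where
  "graph_covering T G \<Xi> \<longleftrightarrow>
     \<Xi> ` pverts T = pverts G \<and>
     (\<forall>t\<in>pverts T. bij_betw \<Xi> (neighbours T t) (neighbours G (\<Xi> t)))"

definition universal_cover :: "'t pair_pre_digraph \<Rightarrow> 'v pair_pre_digraph \<Rightarrow> ('t \<Rightarrow> 'v) \<Rightarrow> bool" where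
  "universal_cover T G \<Xi> \<longleftrightarrow> undirected_tree T \<and> graph_covering T G \<Xi>"

definition lift_lengths :: "('t \<Rightarrow> 'v) \<Rightarrow> ('v set \<Rightarrow> real) \<Rightarrow> 't set \<Rightarrow> real" where
  "lift_lengths \<Xi> len = (\<lambda>e. len (\<Xi> ` e))"

text \<open>
  A function on a metric graph is a family \<open>f\<close> indexed by the arcs: \<open>f (u,v) x\<close> is the value at
  the point of the edge \<open>{u,v}\<close> at distance \<open>x \<in> [0, len {u,v}]\<close> from \<open>u\<close>. The two identifications
  of the edge with the interval, starting at \<open>u\<close> or at \<open>v\<close>, have to give the same function. With
  this convention the derivative of \<open>f\<close> along the edge, outgoing from \<open>u\<close>, is the derivative of
  \<open>f (u,v)\<close> at \<open>0\<close>.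
\<close>

type_synonym 'v graph_fun = "'v \<times> 'v \<Rightarrow> real \<Rightarrow> complex"

definition consistent :: "'v pair_pre_digraph \<Rightarrow> ('v set \<Rightarrow> real) \<Rightarrow> 'v graph_fun \<Rightarrow> bool" where
  "consistent G len f \<longleftrightarrow>
     (\<forall>(u, v)\<in>parcs G. \<forall>x\<in>{0..len {u, v}}. f (v, u) (len {u, v} - x) = f (u, v) x)"

definition L2_on :: "real \<Rightarrow> (real \<Rightarrow> complex) \<Rightarrow> bool" where
  "L2_on L f \<longleftrightarrow>
     set_borel_measurable lborel {0..L} f \<and> set_integrable lborel {0..L} (\<lambda>x. (cmod (f x))\<^sup>2)"

definition L2_norm_sq :: "real \<Rightarrow> (real \<Rightarrow> complex) \<Rightarrow> real" where
  "L2_norm_sq L f = set_lebesgue_integral lborel {0..L} (\<lambda>x. (cmod (f x))\<^sup>2)"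

text \<open>
  \<open>H2_on L f f' f''\<close> states that \<open>f\<close> is the continuously differentiable representative of an
  element of the Sobolev space \<open>H\<^sup>2(0,L)\<close>, that \<open>f'\<close> is its derivative (one-sided at the end
  points), and that \<open>f''\<close> is a representative of its weak second derivative: \<open>f'\<close> is absolutely
  continuous with derivative \<open>f'' \<in> L\<^sup>2\<close>.
\<close>

definition H2_on ::
  "real \<Rightarrow> (real \<Rightarrow> complex) \<Rightarrow> (real \<Rightarrow> complex) \<Rightarrow> (real \<Rightarrow> complex) \<Rightarrow> bool" where
  "H2_on L f f' f'' \<longleftrightarrow>
     (\<forall>x\<in>{0..L}. (f has_vector_derivative f' x) (at x within {0..L})) \<and>
     L2_on L f'' \<and>
     (\<forall>x\<in>{0..L}. f' x = f' 0 + set_lebesgue_integral lborel {0..x} f'')"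

text \<open>
  Membership in the Hilbert direct sum of the spaces \<open>H\<^sup>2(e)\<close>. Summing over arcs counts every edge
  twice, which does not affect summability.
\<close>

definition H2_graph ::
  "'v pair_pre_digraph \<Rightarrow> ('v set \<Rightarrow> real) \<Rightarrow> 'v graph_fun \<Rightarrow> 'v graph_fun \<Rightarrow> 'v graph_fun \<Rightarrow> bool" where
  "H2_graph G len f f' f'' \<longleftrightarrow>
     consistent G len f \<and>
     (\<forall>a\<in>parcs G. H2_on (len (arc_edge a)) (f a) (f' a) (f'' a)) \<and>
     (\<lambda>a. L2_norm_sq (len (arc_edge a)) (f a) + L2_norm_sq (len (arc_edge a)) (f' a)
        + L2_norm_sq (len (arc_edge a)) (f'' a)) summable_on parcs G"

text \<open>
  In the following definition \<open>c\<close> is the common value at the vertex \<open>v\<close> of the functions on the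
  incident edges. The constants \<open>\<alpha> v\<close> lie in \<open>\<real> \<union> {\<infinity>}\<close>; the value \<open>-\<infinity>\<close> of
  \<^typ>\<open>ereal\<close> has to be excluded separately.
\<close>

definition delta_condition ::
  "'v pair_pre_digraph \<Rightarrow> ('v \<Rightarrow> ereal) \<Rightarrow> 'v graph_fun \<Rightarrow> 'v graph_fun \<Rightarrow> 'v \<Rightarrow> bool" where
  "delta_condition G \<alpha> f f' v \<longleftrightarrow>
     (\<exists>c. (\<forall>a\<in>out_arcs (with_proj G) v. f a 0 = c) \<and>
        (if \<alpha> v = \<infinity> then c = 0
         else (\<Sum>a\<in>out_arcs (with_proj G) v. f' a 0) = complex_of_real (real_of_ereal (\<alpha> v)) * c))"

text \<open>
  The standard Schroedinger operator, as its operator graph: the set of all \<open>(f, g)\<close> with \<open>f\<close> in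
  the domain and \<open>g = -f''\<close> in \<open>L\<^sup>2\<close>. Functions \<open>g\<close> that agree almost everywhere are identified.
\<close>

definition schroedinger ::
  "'v pair_pre_digraph \<Rightarrow> ('v set \<Rightarrow> real) \<Rightarrow> ('v \<Rightarrow> ereal) \<Rightarrow> ('v graph_fun \<times> 'v graph_fun) set" where
  "schroedinger G len \<alpha> =
     {(f, g). \<exists>f' f''. H2_graph G len f f' f'' \<and> (\<forall>v\<in>pverts G. delta_condition G \<alpha> f f' v) \<and>
        (\<forall>a\<in>parcs G. AE x\<in>{0..len (arc_edge a)} in lborel. g a x = - f'' a x)}"

definition point_spectrum ::
  "'v pair_pre_digraph \<Rightarrow> ('v set \<Rightarrow> real) \<Rightarrow> ('v \<Rightarrow> ereal) \<Rightarrow> complex set" where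
  "point_spectrum G len \<alpha> =
     {z. \<exists>f. (f, \<lambda>a x. z * f a x) \<in> schroedinger G len \<alpha> \<and>
        \<not> (\<forall>a\<in>parcs G. AE x\<in>{0..len (arc_edge a)} in lborel. f a x = 0)}"

text \<open>The space of edge lengths, one coordinate in \<open>(0,\<infinity>)\<close> for every undirected edge.\<close>

definition edge_length_space :: "'v pair_pre_digraph \<Rightarrow> ('v set \<Rightarrow> real) topology" where
  "edge_length_space G = product_topology (\<lambda>_. top_of_set {0<..}) (edges G)"

definition residual_in :: "'a topology \<Rightarrow> 'a set \<Rightarrow> bool" where
  "residual_in X S \<longleftrightarrow> S \<subseteq> topspace X \<and>
     (\<exists>\<U>. countable \<U> \<and> (\<forall>U\<in>\<U>. openin X U \<and> X closure_of U = topspace X) \<and>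
        topspace X \<inter> \<Inter>\<U> \<subseteq> S)"

end

theory Submission
  imports Defs
begin

text \<open>
  A square summable solution on the tree is determined up to a factor on every branch, because the
  Wronskian of two solutions on branches of the same type is conserved and summable. Hence an
  eigenfunction decomposes into components, separated by its zeros at the vertices, and each
  component projects to a solution on the base graph that satisfies Dirichlet or Kirchhoff
  conditions. An energy estimate shows that the components cannot all contain lifts of one fixed
  edge at a zero. So an eigenvalue on the tree yields two solutions on the base graph with the same
  spectral parameter, one of which vanishes on an edge along which the other one does not. Changing
  the length of this edge moves the spectral parameter of one solution but not that of the other,
  hence this coincidence is confined to countably many closed sets of lengths without interior.
\<close>

text \<open>The tree leaves its trace on the base graph in finite data: two vertex sets, two sets of
  twisted arcs, one arc and a bound \<open>n\<close>. This yields countability, and closedness comes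
  from projecting along a compact set of normalized solutions. A zero inside the support exists
  because otherwise a single component would fill the tree. Transporting that component onto itself
  shows that its energy depends only on the base arc, so it stays above a positive constant, which
  is not summable over infinitely many arcs. The cycle makes the tree infinite; Dirichlet zeros sit
  at leaves and therefore cut no component. The delicate point is that copies of one component may
  occur with different, possibly decaying amplitudes, so summability alone does not exclude a single
  type of component. The Kirchhoff condition at a zero relates the amplitudes on its two sides, and
  this is played against the energies of whole branches.\<close>

definition flip :: "'a \<times> 'a \<Rightarrow> 'a \<times> 'a" where
  "flip a = (snd a, fst a)"

lemma flip_simps [simp]: "fst (flip a) = snd a" "snd (flip a) = fst a" "flip (flip a) = a" "flip (x, y) = (y, x)"
  by (simp_all add: flip_def)

section \<open>Non-backtracking walks in trees\<close>

fun nb_walk :: "('t \<times> 't) set \<Rightarrow> 't list \<Rightarrow> bool" where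
  "nb_walk A [] = True"
| "nb_walk A [x] = True"
| "nb_walk A [x, y] = ((x, y) \<in> A)"
| "nb_walk A (x # y # z # xs) = ((x, y) \<in> A \<and> x \<noteq> z \<and> nb_walk A (y # z # xs))"

lemma nb_walk_tl: "nb_walk A (x # xs) \<Longrightarrow> nb_walk A xs"
  by (cases "(A, x # xs)" rule: nb_walk.cases) auto

lemma nb_walk_Cons_hd: "nb_walk A (x # xs) \<Longrightarrow> xs \<noteq> [] \<Longrightarrow> (x, hd xs) \<in> A"
  by (cases "(A, x # xs)" rule: nb_walk.cases) auto

lemma nb_walk_prefix: "nb_walk A (xs @ ys) \<Longrightarrow> nb_walk A xs"
  by (induction A xs rule: nb_walk.induct) (auto dest: nb_walk_Cons_hd)

lemma nb_walk_append:
  assumes "nb_walk A (xs @ [h])" "nb_walk A (h # ys)" "xs \<noteq> [] \<Longrightarrow> ys \<noteq> [] \<Longrightarrow> last xs \<noteq> hd ys"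
  shows "nb_walk A (xs @ h # ys)"
  using assms
proof (induction A xs rule: nb_walk.induct)
  case (2 A x)
  then show ?case by (cases ys) auto
next
  case (3 A x y)
  then show ?case by (cases ys) auto
qed auto

lemma nb_walk_rev:
  assumes "sym A" "nb_walk A xs"
  shows "nb_walk A (rev xs)"
  using assms
proof (induction A xs rule: nb_walk.induct)
  case (3 A x y)
  then show ?case by (auto dest: symD)
next
  case (4 A x y z xs)
  have "nb_walk A ((rev xs @ [z]) @ y # [x])"
    by (rule nb_walk_append) (use 4 in \<open>auto dest: symD\<close>)
  then show ?case by simp
qed auto

lemma vwalk_arcs_verts:
  "pre_digraph.awalk_verts (with_proj G) u (vwalk_arcs (x # xs)) = (if xs = [] then [u] else x # xs)"
proof (induction xs arbitrary: x u)
  case (Cons y ys)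
  then show ?case by (simp add: pre_digraph.awalk_verts.simps)
qed (simp add: pre_digraph.awalk_verts.simps)

lemma length_vwalk_arcs: "length (vwalk_arcs xs) = length xs - 1"
  by (induction xs rule: vwalk_arcs.induct) auto

lemma nb_walk_awalk:
  assumes "pair_wf_digraph G" "nb_walk (parcs G) (x # xs)" "x \<in> pverts G"
  shows "pre_digraph.awalk (with_proj G) x (vwalk_arcs (x # xs)) (last (x # xs))"
  using assms(2,3)
proof (induction xs arbitrary: x)
  case Nil
  then show ?case by (simp add: pre_digraph.awalk_def pre_digraph.cas.simps)
next
  case (Cons y ys)
  have a: "(x, y) \<in> parcs G" using nb_walk_Cons_hd[OF Cons.prems(1)] by simp
  then have "y \<in> pverts G" using pair_wf_digraph.arc_snd_in_verts[OF assms(1)] by fastforce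
  from Cons.IH[OF nb_walk_tl[OF Cons.prems(1)] this] a Cons.prems(2)
  show ?case by (simp add: pre_digraph.awalk_def pre_digraph.cas.simps)
qed

text \<open>If the first vertex recurs, the part up to its recurrence is closed with distinct
  interior. The absence of loops and of immediate returns gives it length at least 3, as
  \<open>has_undirected_cycle\<close> demands.\<close>

lemma undirected_tree_nb_walk_distinct:
  assumes "undirected_tree T" "nb_walk (parcs T) xs"
  shows "distinct xs"
  using assms(2)
proof (induction xs)
  case (Cons x xs)
  interpret pair_bidirected_digraph T using assms(1) by (simp add: undirected_tree_def)
  have d: "distinct xs" using Cons.IH nb_walk_tl[OF Cons.prems] by blast
  moreover have "x \<notin> set xs"
  proof
    assume "x \<in> set xs"
    then obtain ys zs where xs: "xs = ys @ x # zs" by (auto simp: in_set_conv_decomp)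
    have w: "nb_walk (parcs T) (x # ys @ [x])"
      by (rule nb_walk_prefix[where ys = zs]) (use Cons.prems in \<open>simp add: xs\<close>)
    have irr: "(v, v) \<notin> parcs T" for v using pair_no_loops[of "(v, v)"] by auto
    have "2 \<le> length ys"
    proof -
      consider "ys = []" | y where "ys = [y]" | "2 \<le> length ys"
        by (metis One_nat_def Suc_1 Suc_leI le_neq_implies_less length_0_conv length_Suc_conv not_less_eq_eq zero_le)
      then show ?thesis using w irr by cases auto
    qed
    have x: "x \<in> pverts T"
      using nb_walk_Cons_hd[OF w] arc_fst_in_verts by fastforce
    have "pre_digraph.cycle (with_proj T) (vwalk_arcs (x # ys @ [x]))"
      unfolding pre_digraph.cycle_def
    proof (intro exI conjI)
      show "pre_digraph.awalk (with_proj T) x (vwalk_arcs (x # ys @ [x])) x"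
        using nb_walk_awalk[OF pair_wf_digraph_axioms w x] by simp
      show "distinct (tl (pre_digraph.awalk_verts (with_proj T) x (vwalk_arcs (x # ys @ [x]))))"
        using d by (subst vwalk_arcs_verts) (simp add: xs)
      show "vwalk_arcs (x # ys @ [x]) \<noteq> []" by (cases ys) auto
    qed
    moreover have "length (vwalk_arcs (x # ys @ [x])) \<ge> 3"
      using \<open>2 \<le> length ys\<close> by (subst length_vwalk_arcs) simp
    ultimately show False using assms(1) by (auto simp: undirected_tree_def has_undirected_cycle_def)
  qed
  ultimately show ?case by simp
qed simp

section \<open>Branches of a locally finite tree and summation along their layers\<close>

locale arc_tree =
  fixes A :: "('t \<times> 't) set"
  assumes sym_A: "sym A"
    and finite_out: "finite (A `` {x})"
    and nb_walk_distinct: "nb_walk A xs \<Longrightarrow> distinct xs"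
begin

lemma A_sym: "(x, y) \<in> A \<Longrightarrow> (y, x) \<in> A"
  using sym_A by (rule symD)

text \<open>Where the two walks first diverge, going back along one and on along the other does not
  backtrack, yet it would visit the common end twice.\<close>

lemma nb_walk_unique:
  assumes "nb_walk A xs" "nb_walk A ys" "xs \<noteq> []" "ys \<noteq> []" "hd xs = hd ys" "last xs = last ys"
  shows "xs = ys"
  using assms
proof (induction xs arbitrary: ys)
  case (Cons h xs)
  obtain ys' where ys: "ys = h # ys'" using Cons.prems by (cases ys) auto
  have d: "distinct (h # xs)" "distinct (h # ys')"
    using nb_walk_distinct Cons.prems ys by blast+
  consider "xs = []" | "ys' = []" | a xs1 b ys1 where "xs = a # xs1" "ys' = b # ys1"
    by (cases xs; cases ys') auto
  then show ?case
  proof cases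
    case 1
    then have "last ys = h" using Cons.prems by simp
    with d ys have "ys' = []" by (metis distinct.simps(2) last.simps last_in_set)
    then show ?thesis using 1 ys by simp
  next
    case 2
    then have "last (h # xs) = h" using Cons.prems ys by simp
    with d have "xs = []" by (metis distinct.simps(2) last.simps last_in_set)
    then show ?thesis using 2 ys by simp
  next
    case 3
    show ?thesis
    proof (cases "a = b")
      case True
      have "xs = ys'"
        by (rule Cons.IH) (use Cons.prems ys 3 True nb_walk_tl in \<open>auto intro: nb_walk_tl\<close>)
      then show ?thesis using ys by simp
    next
      case False
      have "nb_walk A (rev xs @ h # ys')"
      proof (rule nb_walk_append)
        show "nb_walk A (rev xs @ [h])" using nb_walk_rev[OF sym_A Cons.prems(1)] by simp
        show "nb_walk A (h # ys')" using Cons.prems ys by simp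
        show "last (rev xs) \<noteq> hd ys'" using 3 False by (simp add: last_rev)
      qed
      then have "distinct (rev xs @ h # ys')" by (rule nb_walk_distinct)
      moreover have "last ys' \<in> set xs" "last ys' \<in> set ys'"
        using Cons.prems(6) ys 3 by (metis last_ConsR last_in_set list.distinct(1))+
      ultimately show ?thesis by auto
    qed
  qed
qed simp

definition nexts :: "'t \<times> 't \<Rightarrow> ('t \<times> 't) set" where
  "nexts a = {b \<in> A. fst b = snd a \<and> snd b \<noteq> fst a}"

lemma finite_nexts: "finite (nexts a)"
proof -
  have "nexts a \<subseteq> Pair (snd a) ` (A `` {snd a})" by (auto simp: nexts_def)
  then show ?thesis using finite_out finite_subset by blast
qed

fun level :: "('t \<times> 't \<Rightarrow> real) \<Rightarrow> nat \<Rightarrow> 't \<times> 't \<Rightarrow> real" where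
  "level h 0 a = h a"
| "level h (Suc n) a = (\<Sum>b\<in>nexts a. level h n b)"

fun walks :: "nat \<Rightarrow> 't \<times> 't \<Rightarrow> 't list set" where
  "walks 0 a = {[fst a, snd a]}"
| "walks (Suc n) a = (\<Union>b\<in>nexts a. (#) (fst a) ` walks n b)"

definition last_arc :: "'t list \<Rightarrow> 't \<times> 't" where
  "last_arc xs = (last (butlast xs), last xs)"

lemma walksD:
  assumes "a \<in> A" "xs \<in> walks n a"
  shows "nb_walk A xs \<and> (\<exists>r. xs = fst a # snd a # r \<and> length r = n) \<and> last_arc xs \<in> A"
  using assms
proof (induction n arbitrary: a xs)
  case 0
  then show ?case by (auto simp: last_arc_def)
next
  case (Suc n)
  then obtain b ys where b: "b \<in> nexts a" "xs = fst a # ys" "ys \<in> walks n b" by auto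
  have bA: "b \<in> A" using b by (simp add: nexts_def)
  from Suc.IH[OF bA b(3)] obtain r
    where r: "nb_walk A ys" "ys = fst b # snd b # r" "length r = n" "last_arc ys \<in> A" by auto
  have "fst b = snd a" "snd b \<noteq> fst a" using b by (auto simp: nexts_def)
  then show ?case using b r Suc.prems by (auto simp: last_arc_def split: if_splits)
qed

lemma finite_walks: "finite (walks n a)"
  by (induction n arbitrary: a) (auto simp: finite_nexts)

text \<open>The recursion unfolds into a sum over walks. Walks through different continuing arcs are
  different, since their second and third vertices record that arc.\<close>

lemma level_eq_sum_walks:
  assumes "a \<in> A"
  shows "level h n a = (\<Sum>xs\<in>walks n a. h (last_arc xs))"
  using assms
proof (induction n arbitrary: a)
  case 0
  then show ?case by (simp add: last_arc_def)
next
  case (Suc n)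
  have nA: "b \<in> A" if "b \<in> nexts a" for b using that by (simp add: nexts_def)
  have "(\<Sum>xs\<in>walks (Suc n) a. h (last_arc xs))
      = (\<Sum>b\<in>nexts a. \<Sum>xs\<in>(#) (fst a) ` walks n b. h (last_arc xs))"
    unfolding walks.simps
  proof (rule sum.UNION_disjoint)
    show "\<forall>b\<in>nexts a. \<forall>c\<in>nexts a. b \<noteq> c \<longrightarrow> (#) (fst a) ` walks n b \<inter> (#) (fst a) ` walks n c = {}"
    proof (intro ballI impI equals0I)
      fix b c xs assume bc: "b \<in> nexts a" "c \<in> nexts a" "b \<noteq> c"
        and xs: "xs \<in> (#) (fst a) ` walks n b \<inter> (#) (fst a) ` walks n c"
      then obtain ys where "ys \<in> walks n b" "ys \<in> walks n c" by auto
      then show False using walksD[OF nA[OF bc(1)]] walksD[OF nA[OF bc(2)]] bc(3)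
        by (fastforce intro: prod_eqI)
    qed
  qed (auto simp: finite_nexts finite_walks)
  also have "\<dots> = (\<Sum>b\<in>nexts a. \<Sum>xs\<in>walks n b. h (last_arc xs))"
  proof (rule sum.cong[OF refl])
    fix b assume b: "b \<in> nexts a"
    have "(\<Sum>xs\<in>(#) (fst a) ` walks n b. h (last_arc xs)) = (\<Sum>xs\<in>walks n b. h (last_arc (fst a # xs)))"
      by (subst sum.reindex) (auto simp: o_def)
    also have "\<dots> = (\<Sum>xs\<in>walks n b. h (last_arc xs))"
      by (rule sum.cong[OF refl]) (auto simp: last_arc_def dest!: walksD[OF nA[OF b]])
    finally show "(\<Sum>xs\<in>(#) (fst a) ` walks n b. h (last_arc xs)) = (\<Sum>xs\<in>walks n b. h (last_arc xs))" .
  qed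
  also have "\<dots> = level h (Suc n) a"
    using Suc.IH nA by simp
  finally show ?case by simp
qed

text \<open>Layers consist of walks of different lengths, and uniqueness of walks makes
  \<open>last_arc\<close> injective on them. So the left side is a finite partial sum of
  \<open>h\<close> over distinct arcs.\<close>

lemma sum_level_le:
  assumes a: "a \<in> A" and h: "h summable_on A" "\<And>b. b \<in> A \<Longrightarrow> 0 \<le> h b"
  shows "(\<Sum>n<N. level h n a) \<le> infsum h A"
proof -
  let ?W = "\<Union>n\<in>{..<N}. walks n a"
  have "(\<Sum>n<N. level h n a) = (\<Sum>n<N. \<Sum>xs\<in>walks n a. h (last_arc xs))"
    using level_eq_sum_walks[OF a] by simp
  also have "\<dots> = (\<Sum>xs\<in>?W. h (last_arc xs))"
  proof (rule sum.UNION_disjoint[symmetric])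
    show "\<forall>i\<in>{..<N}. \<forall>j\<in>{..<N}. i \<noteq> j \<longrightarrow> walks i a \<inter> walks j a = {}"
      by (fastforce dest: walksD[OF a])
  qed (auto simp: finite_walks)
  also have "\<dots> = sum h (last_arc ` ?W)"
  proof (rule sum.reindex_cong[symmetric, where l = last_arc])
    show "inj_on last_arc ?W"
    proof (rule inj_onI)
      fix xs ys assume "xs \<in> ?W" "ys \<in> ?W" and e: "last_arc xs = last_arc ys"
      then obtain r s where "nb_walk A xs" "nb_walk A ys" "xs = fst a # snd a # r" "ys = fst a # snd a # s"
        by (fastforce dest: walksD[OF a])
      then show "xs = ys" using e by (intro nb_walk_unique) (auto simp: last_arc_def)
    qed
  qed auto
  also have "\<dots> \<le> infsum h A"
    by (rule finite_sum_le_infsum) (use h in \<open>auto simp: finite_walks dest: walksD[OF a]\<close>)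
  finally show ?thesis .
qed

lemma level_nonneg: "(\<And>b. b \<in> A \<Longrightarrow> 0 \<le> h b) \<Longrightarrow> a \<in> A \<Longrightarrow> 0 \<le> level h n a"
  by (induction n arbitrary: a) (auto intro!: sum_nonneg simp: nexts_def)

lemma summable_level:
  assumes "a \<in> A" "h summable_on A" "\<And>b. b \<in> A \<Longrightarrow> 0 \<le> h b"
  shows "summable (\<lambda>n. level h n a)"
  using sum_level_le[OF assms] level_nonneg[OF assms(3,1)] by (intro summableI_nonneg_bounded) auto

definition branch_sum :: "('t \<times> 't \<Rightarrow> real) \<Rightarrow> 't \<times> 't \<Rightarrow> real" where
  "branch_sum h a = (\<Sum>n. level h n a)"

lemma branch_sum_nonneg:
  assumes "a \<in> A" "h summable_on A" "\<And>b. b \<in> A \<Longrightarrow> 0 \<le> h b"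
  shows "0 \<le> branch_sum h a"
  unfolding branch_sum_def using summable_level[OF assms] level_nonneg[OF assms(3,1)]
  by (rule suminf_nonneg)

lemma branch_sum_rec:
  assumes "a \<in> A" "h summable_on A" "\<And>b. b \<in> A \<Longrightarrow> 0 \<le> h b"
  shows "branch_sum h a = h a + (\<Sum>b\<in>nexts a. branch_sum h b)"
proof -
  have s: "summable (\<lambda>n. level h n b)" if "b \<in> nexts a" for b
    using that summable_level[OF _ assms(2,3)] by (auto simp: nexts_def)
  have "branch_sum h a = (\<Sum>n. level h (Suc n) a) + level h 0 a"
    unfolding branch_sum_def using suminf_split_head[OF summable_level[OF assms]] by simp
  also have "(\<Sum>n. level h (Suc n) a) = (\<Sum>b\<in>nexts a. branch_sum h b)"
    unfolding branch_sum_def level.simps by (rule suminf_sum) (rule s)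
  finally show ?thesis by simp
qed

end

section \<open>Solutions on a single edge\<close>

text \<open>Together with \<open>sinz\<close> the fundamental system of -u'' = z u, that is cos
  (sqrt z x) and sin (sqrt z x) / sqrt z, continued to z <= 0. In the product one factor is always
  1, so continuity in z needs no case distinction.\<close>

definition cosz :: "real \<Rightarrow> real \<Rightarrow> real" where
  "cosz z x = cos (sqrt (max z 0) * x) * cosh (sqrt (max (- z) 0) * x)"

definition sinz :: "real \<Rightarrow> real \<Rightarrow> real" where
  "sinz z x = (if z > 0 then sin (sqrt z * x) / sqrt z
     else if z < 0 then sinh (sqrt (- z) * x) / sqrt (- z) else x)"

lemma cosz_0 [simp]: "cosz z 0 = 1" and sinz_0 [simp]: "sinz z 0 = 0"
  by (simp_all add: cosz_def sinz_def)

lemma sqrt_minus_square: "z < 0 \<Longrightarrow> sqrt (- z) * (sqrt (- z) * t) = - z * t"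
  by (simp flip: mult.assoc)

lemma cosz_deriv: "((\<lambda>x. cosz z x) has_real_derivative (- z * sinz z x)) (at x within A)"
  unfolding cosz_def sinz_def
  by (cases z "0::real" rule: linorder_cases)
    (auto intro!: derivative_eq_intros simp: max_def field_simps sqrt_minus_square)

lemma sinz_deriv: "((\<lambda>x. sinz z x) has_real_derivative cosz z x) (at x within A)"
  unfolding cosz_def sinz_def
  by (cases z "0::real" rule: linorder_cases)
    (auto intro!: derivative_eq_intros simp: max_def field_simps sqrt_minus_square)

lemma cosz_sinz_pythagoras: "(cosz z x)\<^sup>2 + z * (sinz z x)\<^sup>2 = 1"
proof (cases z "0::real" rule: linorder_cases)
  case less
  then have "cosh (sqrt (- z) * x) ^ 2 = 1 + sinh (sqrt (- z) * x) ^ 2"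
    by (simp add: cosh_square_eq)
  then show ?thesis using less by (simp add: cosz_def sinz_def max_def power_divide field_simps)
qed (auto simp: cosz_def sinz_def max_def power_divide)

lemma sinz_diff: "sinz z (x - y) = sinz z x * cosz z y - cosz z x * sinz z y"
  by (cases z "0::real" rule: linorder_cases)
    (auto simp: cosz_def sinz_def max_def sin_diff sinh_diff right_diff_distrib diff_divide_distrib)

text \<open>Positive zeros exist only for z > 0, the first one at pi / sqrt z; the hypothesis places
  x before it.\<close>

lemma sinz_pos:
  assumes "0 < x" "z * x\<^sup>2 < pi\<^sup>2"
  shows "0 < sinz z x"
proof (cases "z > 0")
  case True
  have "(sqrt z * x)\<^sup>2 < pi\<^sup>2" using assms True by (simp add: power_mult_distrib)
  then have "sqrt z * x < pi" using power_less_imp_less_base by fastforce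
  then show ?thesis using True assms by (auto simp: sinz_def intro!: divide_pos_pos sin_gt_zero)
qed (use assms in \<open>auto simp: sinz_def\<close>)

lemma continuous_on_cosz [continuous_intros]:
  assumes "continuous_on S g" "continuous_on S h"
  shows "continuous_on S (\<lambda>t. cosz (g t) (h t))"
proof -
  have sq: "continuous_on S (\<lambda>t. sqrt (max (g t) 0))" "continuous_on S (\<lambda>t. sqrt (max (- g t) 0))"
    by (intro continuous_on_real_sqrt continuous_on_max continuous_on_minus continuous_on_const assms)+
  have c: "continuous_on S (\<lambda>t. cos (r t))" if "continuous_on S r" for r :: "'a \<Rightarrow> real"
    by (rule continuous_on_compose2[OF _ that, of UNIV cos]) (auto intro: continuous_on_cos)
  show ?thesis
    unfolding cosz_def by (intro c continuous_on_mult continuous_on_cosh sq assms)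
qed

text \<open>The integral form removes the case distinction at z = 0, so that joint continuity in z
  and x is inherited from \<open>cosz\<close>.\<close>

lemma sinz_eq_integral: "sinz z x = integral {0..1} (\<lambda>t. x * cosz z (t * x))"
proof -
  have "((\<lambda>t. x * cosz z (t * x)) has_integral (sinz z (1 * x) - sinz z (0 * x))) {0..1}"
  proof (rule fundamental_theorem_of_calculus)
    fix t :: real
    have "((\<lambda>t. sinz z (t * x)) has_real_derivative cosz z (t * x) * x) (at t within {0..1})"
      by (rule DERIV_chain2[OF sinz_deriv]) (auto intro!: derivative_eq_intros)
    then show "((\<lambda>t. sinz z (t * x)) has_vector_derivative x * cosz z (t * x)) (at t within {0..1})"
      by (simp add: has_real_derivative_iff_has_vector_derivative mult.commute)
  qed simp
  from integral_unique[OF this] show ?thesis by simp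
qed

lemma continuous_on_sinz [continuous_intros]:
  assumes "continuous_on S g" "continuous_on S h"
  shows "continuous_on S (\<lambda>t. sinz (g t) (h t))"
proof -
  have "continuous_on UNIV (\<lambda>p::real \<times> real. integral (cbox 0 1) (\<lambda>t. snd p * cosz (fst p) (t * snd p)))"
    by (rule integral_continuous_on_param) (simp add: split_beta; intro continuous_intros)
  then have "continuous_on UNIV (\<lambda>p. sinz (fst p) (snd p))"
    unfolding cbox_interval sinz_eq_integral[symmetric] .
  from continuous_on_compose2[OF this, of S "\<lambda>t. (g t, h t)"] assms
  show ?thesis by (auto intro: continuous_intros)
qed

text \<open>The two auxiliary functions pull (u, v) back to 0 by the inverse transfer matrix. Their
  derivatives vanish, and since the determinant is 1 the relation can be solved for u and v.\<close>

lemma ode_solution: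
  fixes u v :: "real \<Rightarrow> real"
  assumes u: "\<And>x. x \<in> {0..L} \<Longrightarrow> (u has_real_derivative v x) (at x within {0..L})"
    and v: "\<And>x. x \<in> {0..L} \<Longrightarrow> (v has_real_derivative - z * u x) (at x within {0..L})"
    and x: "x \<in> {0..L}"
  shows "u x = cosz z x * u 0 + sinz z x * v 0" "v x = cosz z x * v 0 - z * sinz z x * u 0"
proof -
  let ?A = "\<lambda>x. u x * cosz z x - v x * sinz z x"
  let ?B = "\<lambda>x. z * (u x * sinz z x) + v x * cosz z x"
  have 0: "0 \<in> {0..L}" using x by auto
  obtain kA where "\<And>x. x \<in> {0..L} \<Longrightarrow> ?A x = kA"
  proof (rule has_field_derivative_zero_constant[of "{0..L}", THEN exE])
    show "(?A has_field_derivative 0) (at y within {0..L})" if "y \<in> {0..L}" for y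
      by (rule derivative_eq_intros u[OF that] v[OF that] cosz_deriv sinz_deriv refl)+ (simp add: algebra_simps)
  qed auto
  then have "?A x = ?A 0" using x 0 by metis
  then have A: "u x * cosz z x - v x * sinz z x = u 0" by simp
  obtain kB where "\<And>x. x \<in> {0..L} \<Longrightarrow> ?B x = kB"
  proof (rule has_field_derivative_zero_constant[of "{0..L}", THEN exE])
    show "(?B has_field_derivative 0) (at y within {0..L})" if "y \<in> {0..L}" for y
      by (rule derivative_eq_intros u[OF that] v[OF that] cosz_deriv sinz_deriv refl)+ (simp add: algebra_simps)
  qed auto
  then have "?B x = ?B 0" using x 0 by metis
  then have B: "z * (u x * sinz z x) + v x * cosz z x = v 0" by simp
  note P = cosz_sinz_pythagoras[of z x, unfolded power2_eq_square]
  have "u x = u x * (cosz z x * cosz z x + z * (sinz z x * sinz z x))" by (simp add: P)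
  also have "\<dots> = cosz z x * u 0 + sinz z x * v 0" unfolding A[symmetric] B[symmetric] by algebra
  finally show "u x = cosz z x * u 0 + sinz z x * v 0" .
  have "v x = v x * (cosz z x * cosz z x + z * (sinz z x * sinz z x))" by (simp add: P)
  also have "\<dots> = cosz z x * v 0 - z * sinz z x * u 0" unfolding A[symmetric] B[symmetric] by algebra
  finally show "v x = cosz z x * v 0 - z * sinz z x * u 0" .
qed

section \<open>Solutions on the base graph with sign-twisted edges\<close>

text \<open>
  The projection of a component of the covering tree may return to the same edge with the opposite
  sign. It is a function on the base graph only after every edge in \<open>\<Sigma>\<close> has been twisted by \<open>- 1\<close>.
  The vertex condition holds in \<open>Y\<close>; all other vertices are zeros.
\<close>

definition edge_sign :: "('v \<times> 'v) set \<Rightarrow> 'v \<times> 'v \<Rightarrow> real" where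
  "edge_sign \<Sigma> a = (if a \<in> \<Sigma> then - 1 else 1)"

lemma edge_sign_square [simp]: "edge_sign \<Sigma> a * edge_sign \<Sigma> a = 1"
  by (simp add: edge_sign_def)

text \<open>\<open>F\<close> holds the values at the vertices, \<open>D\<close> the slopes leaving
  along the arcs. The edge equations are the transfer matrix across the edge, with the slope negated
  because it is outgoing at the far end as well.\<close>

definition graph_solution ::
  "'v pair_pre_digraph \<Rightarrow> ('v \<Rightarrow> real) \<Rightarrow> 'v set \<Rightarrow> ('v \<times> 'v) set \<Rightarrow> ('v set \<Rightarrow> real) \<Rightarrow> real \<Rightarrow>
    ('v \<Rightarrow> real) \<Rightarrow> ('v \<times> 'v \<Rightarrow> real) \<Rightarrow> bool" where
  "graph_solution G \<beta> Y \<Sigma> len z F D \<longleftrightarrow>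
     (\<forall>a\<in>parcs G.
        F (snd a) = edge_sign \<Sigma> a * (cosz z (len (arc_edge a)) * F (fst a) + sinz z (len (arc_edge a)) * D a) \<and>
        D (flip a) = edge_sign \<Sigma> a * (z * sinz z (len (arc_edge a)) * F (fst a) - cosz z (len (arc_edge a)) * D a)) \<and>
     (\<forall>v\<in>pverts G. if v \<in> Y then (\<Sum>w\<in>neighbours G v. D (v, w)) = \<beta> v * F v else F v = 0)"

definition data_norm :: "'v pair_pre_digraph \<Rightarrow> ('v \<Rightarrow> real) \<Rightarrow> ('v \<times> 'v \<Rightarrow> real) \<Rightarrow> real" where
  "data_norm G F D = (\<Sum>a\<in>parcs G. (F (fst a))\<^sup>2 + (D a)\<^sup>2)"

text \<open>The bounds are imposed at every index, also outside \<open>G\<close>, so that the data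
  range over a product of compact intervals.\<close>

definition normal_solution ::
  "'v pair_pre_digraph \<Rightarrow> ('v \<Rightarrow> real) \<Rightarrow> 'v set \<Rightarrow> ('v \<times> 'v) set \<Rightarrow> ('v set \<Rightarrow> real) \<Rightarrow> real \<Rightarrow>
    ('v \<Rightarrow> real) \<Rightarrow> ('v \<times> 'v \<Rightarrow> real) \<Rightarrow> bool" where
  "normal_solution G \<beta> Y \<Sigma> len z F D \<longleftrightarrow> graph_solution G \<beta> Y \<Sigma> len z F D \<and> data_norm G F D = 1 \<and>
     (\<forall>v. F v \<in> {-1..1}) \<and> (\<forall>a. D a \<in> {-1..1})"

lemma normalize:
  assumes "graph_solution G \<beta> Y \<Sigma> len z F D" "data_norm G F D \<noteq> 0" "finite (parcs G)"
    "\<And>v. v \<notin> fst ` parcs G \<Longrightarrow> F v = 0" "\<And>a. a \<notin> parcs G \<Longrightarrow> D a = 0"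
  shows "\<exists>c. c \<noteq> 0 \<and> normal_solution G \<beta> Y \<Sigma> len z (\<lambda>v. c * F v) (\<lambda>a. c * D a)"
proof -
  have pos: "0 < data_norm G F D"
    using assms(2) sum_nonneg[of "parcs G" "\<lambda>a. (F (fst a))\<^sup>2 + (D a)\<^sup>2"]
    unfolding data_norm_def by (simp add: less_le)
  define c where "c = 1 / sqrt (data_norm G F D)"
  have c2: "c\<^sup>2 * data_norm G F D = 1" using pos by (simp add: c_def power_divide)
  have sol: "graph_solution G \<beta> Y \<Sigma> len z (\<lambda>v. c * F v) (\<lambda>a. c * D a)"
    unfolding graph_solution_def
  proof (intro conjI ballI)
    fix a assume "a \<in> parcs G"
    then have e: "F (snd a) = edge_sign \<Sigma> a * (cosz z (len (arc_edge a)) * F (fst a) + sinz z (len (arc_edge a)) * D a)"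
      "D (flip a) = edge_sign \<Sigma> a * (z * sinz z (len (arc_edge a)) * F (fst a) - cosz z (len (arc_edge a)) * D a)"
      using assms(1) unfolding graph_solution_def by blast+
    show "c * F (snd a) = edge_sign \<Sigma> a * (cosz z (len (arc_edge a)) * (c * F (fst a)) + sinz z (len (arc_edge a)) * (c * D a))"
      "c * D (flip a) = edge_sign \<Sigma> a * (z * sinz z (len (arc_edge a)) * (c * F (fst a)) - cosz z (len (arc_edge a)) * (c * D a))"
      unfolding e by (simp_all add: algebra_simps)
  next
    fix v assume "v \<in> pverts G"
    then show "if v \<in> Y then (\<Sum>w\<in>neighbours G v. c * D (v, w)) = \<beta> v * (c * F v) else c * F v = 0"
      using assms(1) unfolding graph_solution_def by (auto simp flip: sum_distrib_left)
  qed
  have norm: "data_norm G (\<lambda>v. c * F v) (\<lambda>a. c * D a) = 1"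
    using c2 by (simp add: data_norm_def power_mult_distrib sum_distrib_left distrib_left)
  have le: "(c * F (fst a))\<^sup>2 + (c * D a)\<^sup>2 \<le> 1" if "a \<in> parcs G" for a
    using norm member_le_sum[OF that, of "\<lambda>a. (c * F (fst a))\<^sup>2 + (c * D a)\<^sup>2"] assms(3)
    unfolding data_norm_def by auto
  have bd: "x \<in> {-1..1}" if "x\<^sup>2 + y\<^sup>2 \<le> 1" for x y :: real
  proof -
    have "x\<^sup>2 \<le> 1" using that zero_le_power2[of y] by linarith
    then show ?thesis using abs_square_le_1[of x] by auto
  qed
  have F1: "c * F v \<in> {-1..1}" for v
  proof (cases "v \<in> fst ` parcs G")
    case True
    then obtain a where "a \<in> parcs G" "v = fst a" by blast
    then show ?thesis using bd[OF le] by blast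
  qed (simp add: assms(4))
  have D1: "c * D a \<in> {-1..1}" for a
  proof (cases "a \<in> parcs G")
    case True
    then show ?thesis using bd[of "c * D a" "c * F (fst a)"] le[OF True] by (simp add: add.commute)
  qed (simp add: assms(5))
  show ?thesis
    using sol norm F1 D1 pos unfolding normal_solution_def by (intro exI[of _ c]) (simp add: c_def)
qed

subsection \<open>Green's formula on the base graph\<close>

context pair_graph
begin

lemma flip_in: "a \<in> parcs G \<Longrightarrow> flip a \<in> parcs G"
  using arcs_symmetric by (cases a) auto

lemma sum_flip: "(\<Sum>a\<in>parcs G. h (flip a)) = sum h (parcs G)"
  by (rule sum.reindex_bij_witness[of _ flip flip]) (auto simp: flip_in)

lemma sum_arcs: "sum h (parcs G) = (\<Sum>v\<in>pverts G. \<Sum>w\<in>neighbours G v. h (v, w))"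
proof -
  have "parcs G = Sigma (pverts G) (neighbours G)"
    using arc_fst_in_verts by (force simp: neighbours_def)
  moreover have "finite (neighbours G v)" for v
    by (rule finite_subset[of _ "snd ` parcs G"]) (force simp: neighbours_def, use pair_finite_arcs in simp)
  ultimately show ?thesis by (simp add: sum.Sigma pair_finite_verts)
qed

text \<open>The vertex conditions involve neither lengths nor z. In \<open>Y\<close> both slope sums
  are the same multiple of the value, elsewhere both values are 0, so the terms cancel vertex by
  vertex.\<close>

lemma sum_wronskian:
  assumes "graph_solution G \<beta> Y \<Sigma> len z F D" "graph_solution G \<beta> Y \<Sigma> len' z' F' D'"
  shows "(\<Sum>a\<in>parcs G. F (fst a) * D' a - F' (fst a) * D a) = 0"
proof -
  have "(\<Sum>w\<in>neighbours G v. F v * D' (v, w) - F' v * D (v, w)) = 0" if "v \<in> pverts G" for v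
    using assms that unfolding graph_solution_def
    by (cases "v \<in> Y") (auto simp: sum_subtractf simp flip: sum_distrib_left)
  then show ?thesis by (subst sum_arcs) simp
qed

text \<open>Opposite arcs of an unmoved edge carry opposite Wronskians, because the transfer matrix
  has determinant 1. Of the vanishing total only the two arcs of the moved edge remain, and the one
  that starts at the common zero contributes nothing. The other is evaluated by the addition formula
  \<open>sinz_diff\<close>.\<close>

lemma moved_length:
  assumes sol: "graph_solution G \<beta> Y \<Sigma> len z F D" "graph_solution G \<beta> Y \<Sigma> len' z F' D'"
    and e: "e \<in> parcs G" and len: "\<And>c. c \<in> edges G \<Longrightarrow> c \<noteq> arc_edge e \<Longrightarrow> len c = len' c"
    and node: "F (fst e) = 0" "F' (fst e) = 0"
  shows "D e * D' e * sinz z (len' (arc_edge e) - len (arc_edge e)) = 0"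
proof -
  define W where "W a = F (fst a) * D' a - F' (fst a) * D a" for a
  have anti: "W (flip a) = - W a" if a: "a \<in> parcs G - {e, flip e}" for a
  proof -
    have "arc_edge a \<noteq> arc_edge e"
    proof
      assume "arc_edge a = arc_edge e"
      then have "a = e \<or> a = flip e"
        by (cases a; cases e) (auto simp: arc_edge_def doubleton_eq_iff)
      then show False using a by blast
    qed
    then have l: "len (arc_edge a) = len' (arc_edge a)" using len a by (auto simp: edges_def)
    let ?c = "cosz z (len (arc_edge a))" and ?s = "sinz z (len (arc_edge a))" and ?\<sigma> = "edge_sign \<Sigma> a"
    have "F (snd a) = ?\<sigma> * (?c * F (fst a) + ?s * D a)" "D (flip a) = ?\<sigma> * (z * ?s * F (fst a) - ?c * D a)"
      "F' (snd a) = ?\<sigma> * (?c * F' (fst a) + ?s * D' a)" "D' (flip a) = ?\<sigma> * (z * ?s * F' (fst a) - ?c * D' a)"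
      using sol a l unfolding graph_solution_def by auto
    then have "W (flip a) = - (?\<sigma> * ?\<sigma>) * (?c\<^sup>2 + z * ?s\<^sup>2) * W a"
      unfolding W_def flip_simps by algebra
    then show ?thesis by (simp add: cosz_sinz_pythagoras)
  qed
  have "(\<Sum>a\<in>parcs G - {e, flip e}. W a) = (\<Sum>a\<in>parcs G - {e, flip e}. W (flip a))"
  proof (rule sum.reindex_bij_witness[of _ flip flip])
    fix a assume a: "a \<in> parcs G - {e, flip e}"
    then have "flip a \<noteq> e" "flip a \<noteq> flip e" by (metis DiffD2 flip_simps(3) insertCI)+
    then show "flip a \<in> parcs G - {e, flip e}" "flip a \<in> parcs G - {e, flip e}" using a flip_in by blast+
  qed simp_all
  also have "\<dots> = - (\<Sum>a\<in>parcs G - {e, flip e}. W a)"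
    by (simp add: anti sum_negf)
  finally have 0: "(\<Sum>a\<in>parcs G - {e, flip e}. W a) = 0" by simp
  have "flip e \<noteq> e" using pair_no_loops[OF e] by (cases e) auto
  then have "sum W (parcs G) = (\<Sum>a\<in>parcs G - {e, flip e}. W a) + W e + W (flip e)"
    using e flip_in[OF e] sum.subset_diff[of "{e, flip e}" "parcs G" W] pair_finite_arcs by auto
  then have "W (flip e) = 0"
    using 0 sum_wronskian[OF sol] node by (simp add: W_def)
  moreover
  let ?l = "len (arc_edge e)" and ?l' = "len' (arc_edge e)" and ?\<sigma> = "edge_sign \<Sigma> e"
  have "F (snd e) = ?\<sigma> * (sinz z ?l * D e)" "D (flip e) = ?\<sigma> * (- cosz z ?l * D e)"
    "F' (snd e) = ?\<sigma> * (sinz z ?l' * D' e)" "D' (flip e) = ?\<sigma> * (- cosz z ?l' * D' e)"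
    using sol e node unfolding graph_solution_def by auto
  then have "W (flip e) = (?\<sigma> * ?\<sigma>) * (D e * D' e * (sinz z ?l' * cosz z ?l - cosz z ?l' * sinz z ?l))"
    unfolding W_def flip_simps by algebra
  ultimately show ?thesis by (simp add: sinz_diff)
qed

text \<open>Orthogonality of eigenfunctions for different parameters, with every edge counted in
  both directions. The derivative of the Wronskian along an edge is z - z' times the product, the
  twisting sign enters squared, and the boundary terms cancel by
  \<open>sum_wronskian\<close>.\<close>

lemma overlap_Green:
  fixes len :: "'a set \<Rightarrow> real"
  assumes sol: "graph_solution G \<beta> Y \<Sigma> len z F D" "graph_solution G \<beta> Y \<Sigma> len z' F' D'"
    and z: "z \<noteq> z'" and len: "\<And>c. c \<in> edges G \<Longrightarrow> 0 < len c"
  shows "(\<Sum>a\<in>parcs G. integral {0..len (arc_edge a)} (\<lambda>x.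
    (cosz z x * F (fst a) + sinz z x * D a) * (cosz z' x * F' (fst a) + sinz z' x * D' a))) = 0"
proof -
  define W where "W a = F (fst a) * D' a - F' (fst a) * D a" for a
  define I where "I a = integral {0..len (arc_edge a)} (\<lambda>x.
    (cosz z x * F (fst a) + sinz z x * D a) * (cosz z' x * F' (fst a) + sinz z' x * D' a))" for a
  have edge: "(z - z') * I a = - (W a + W (flip a))" if a: "a \<in> parcs G" for a
  proof -
    let ?l = "len (arc_edge a)" and ?\<sigma> = "edge_sign \<Sigma> a"
    let ?u = "\<lambda>x. cosz z x * F (fst a) + sinz z x * D a"
    let ?u' = "\<lambda>x. cosz z' x * F' (fst a) + sinz z' x * D' a"
    let ?v = "\<lambda>x. - z * sinz z x * F (fst a) + cosz z x * D a"
    let ?v' = "\<lambda>x. - z' * sinz z' x * F' (fst a) + cosz z' x * D' a"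
    let ?w = "\<lambda>x. ?u x * ?v' x - ?u' x * ?v x"
    have "((\<lambda>x. (z - z') * (?u x * ?u' x)) has_integral ?w ?l - ?w 0) {0..?l}"
    proof (rule fundamental_theorem_of_calculus)
      show "0 \<le> ?l" using len[of "arc_edge a"] a by (simp add: edges_def less_imp_le)
      fix x
      have "(?w has_real_derivative (z - z') * (?u x * ?u' x)) (at x within {0..?l})"
        by (rule derivative_eq_intros cosz_deriv sinz_deriv refl)+ (simp add: algebra_simps)
      then show "(?w has_vector_derivative (z - z') * (?u x * ?u' x)) (at x within {0..?l})"
        by (simp add: has_real_derivative_iff_has_vector_derivative)
    qed
    then have "(z - z') * I a = ?w ?l - ?w 0"
      using integral_unique by (simp only: I_def flip: integral_mult_right)
    also have "?w 0 = W a" by (simp add: W_def)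
    also have "?w ?l = - W (flip a)"
    proof -
      have "F (snd a) = ?\<sigma> * ?u ?l" "D (flip a) = - (?\<sigma> * ?v ?l)"
        "F' (snd a) = ?\<sigma> * ?u' ?l" "D' (flip a) = - (?\<sigma> * ?v' ?l)"
        using sol a unfolding graph_solution_def by (auto simp: algebra_simps)
      then have "W (flip a) = - (?\<sigma> * ?\<sigma>) * ?w ?l"
        unfolding W_def flip_simps by algebra
      then show ?thesis by simp
    qed
    finally show ?thesis by simp
  qed
  have "(z - z') * sum I (parcs G) = - (sum W (parcs G) + (\<Sum>a\<in>parcs G. W (flip a)))"
    by (simp add: sum_distrib_left edge sum_subtractf sum_negf)
  also have "\<dots> = 0"
  proof -
    have "sum W (parcs G) = 0" using sum_wronskian[OF sol] by (simp add: W_def)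
    then show ?thesis by (simp add: sum_flip)
  qed
  finally show ?thesis using z by (simp add: I_def)
qed

end

section \<open>Closed and compact sets of solution data\<close>

lemma closed_graph_solution:
  fixes L :: "'x::topological_space \<Rightarrow> 'v set \<Rightarrow> real"
  assumes "\<And>c. continuous_on UNIV (\<lambda>x. L x c)" "continuous_on UNIV Z"
    "\<And>v. continuous_on UNIV (\<lambda>x. F x v)" "\<And>a. continuous_on UNIV (\<lambda>x. D x a)"
  shows "closed {x. graph_solution G \<beta> Y \<Sigma> (L x) (Z x) (F x) (D x)}"
  unfolding graph_solution_def Ball_def
  by (intro closed_Collect_conj closed_Collect_all closed_Collect_imp closed_Collect_eq continuous_intros assms
      open_Collect_const | simp | (split if_split, intro conjI impI))+

lemma closed_normal_solution:
  fixes L :: "'x::topological_space \<Rightarrow> 'v set \<Rightarrow> real"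
  assumes "\<And>c. continuous_on UNIV (\<lambda>x. L x c)" "continuous_on UNIV Z"
    "\<And>v. continuous_on UNIV (\<lambda>x. F x v)" "\<And>a. continuous_on UNIV (\<lambda>x. D x a)"
  shows "closed {x. normal_solution G \<beta> Y \<Sigma> (L x) (Z x) (F x) (D x)}"
  unfolding normal_solution_def data_norm_def atLeastAtMost_iff
  by (intro closed_Collect_conj closed_Collect_all closed_graph_solution closed_Collect_eq closed_Collect_le
      continuous_intros assms)

lemma compact_functions:
  fixes K :: "'b::topological_space set"
  assumes "compact K"
  shows "compact {f :: 'a \<Rightarrow> 'b. \<forall>i. f i \<in> K}"
proof -
  have "compactin (product_topology (\<lambda>_::'a. euclidean) UNIV) (PiE UNIV (\<lambda>_::'a. K))"
    using assms by (simp add: compactin_PiE)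
  moreover have "PiE UNIV (\<lambda>_::'a. K) = {f. \<forall>i. f i \<in> K}" by (auto simp: PiE_UNIV_domain)
  ultimately show ?thesis by (simp add: euclidean_product_topology)
qed

lemma continuous_on_fst_apply [continuous_intros]:
  fixes g :: "'x::topological_space \<Rightarrow> ('i \<Rightarrow> 'b::topological_space) \<times> 'c::topological_space"
  assumes "continuous_on S g"
  shows "continuous_on S (\<lambda>x. fst (g x) i)"
  by (rule continuous_on_product_then_coordinatewise) (intro continuous_intros assms)

lemma continuous_on_snd_apply [continuous_intros]:
  fixes g :: "'x::topological_space \<Rightarrow> 'c::topological_space \<times> ('i \<Rightarrow> 'b::topological_space)"
  assumes "continuous_on S g"
  shows "continuous_on S (\<lambda>x. snd (g x) i)"
  by (rule continuous_on_product_then_coordinatewise) (intro continuous_intros assms)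

text \<open>Function spaces are Hausdorff, but no type class instance says so; this is the consequence used here.\<close>

lemma islimpt_remove1:
  fixes x y :: "real \<times> ('a \<Rightarrow> real) \<times> ('b \<Rightarrow> real)"
  assumes "x islimpt T" "closed K" "T - {y} \<subseteq> K"
  shows "x \<in> K"
proof (rule ccontr)
  assume x: "x \<notin> K"
  show False
  proof (cases "x = y")
    case True
    have "open (- K)" using assms(2) by blast
    then obtain s where "s \<in> T" "s \<notin> K" "s \<noteq> x" using assms(1) x unfolding islimpt_def by blast
    then show False using assms(3) True by blast
  next
    case False
    then obtain h where h: "continuous_on UNIV h" "h x \<noteq> (h y :: real)"
    proof -
      consider "fst x \<noteq> fst y" | v where "fst (snd x) v \<noteq> fst (snd y) v" | a where "snd (snd x) a \<noteq> snd (snd y) a"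
        using False by (auto simp: prod_eq_iff fun_eq_iff)
      then show ?thesis
      proof cases
        case 1
        show ?thesis by (rule that[of fst]) (use 1 in \<open>auto intro!: continuous_intros\<close>)
      next
        case 2
        show ?thesis by (rule that[of "\<lambda>s. fst (snd s) v"]) (use 2 in \<open>auto intro!: continuous_intros\<close>)
      next
        case 3
        show ?thesis by (rule that[of "\<lambda>s. snd (snd s) a"]) (use 3 in \<open>auto intro!: continuous_intros\<close>)
      qed
    qed
    have "open (- K \<inter> {s. h s \<noteq> h y})"
      using assms(2) by (intro open_Int open_Collect_neq h continuous_on_const) auto
    moreover have "x \<in> - K \<inter> {s. h s \<noteq> h y}" using x h(2) by simp
    ultimately obtain s where s: "s \<in> T" "s \<in> - K \<inter> {s. h s \<noteq> h y}"
      using islimptE[OF assms(1)] by metis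
    then have "s \<noteq> y" by auto
    then show False using s assms(3) by blast
  qed
qed

context pair_graph
begin

text \<open>Discreteness of the spectrum by compactness: infinitely many solutions accumulate at a
  normalized one. Orthogonality to the others passes to the limit and makes the limit orthogonal to
  itself, hence zero.\<close>

lemma finite_normal_solutions:
  fixes len :: "'a set \<Rightarrow> real"
  assumes len: "\<And>c. c \<in> edges G \<Longrightarrow> 0 < len c"
  shows "finite {z \<in> {- r..r}. \<exists>F D. normal_solution G \<beta> Y \<Sigma> len z F D}" (is "finite ?Z")
proof (rule ccontr)
  define Z where "Z = ?Z"
  assume "infinite ?Z"
  then have inf: "infinite Z" unfolding Z_def .
  have Zr: "z \<in> {- r..r}" if "z \<in> Z" for z using that by (simp add: Z_def)
  have "\<forall>z\<in>Z. \<exists>w. normal_solution G \<beta> Y \<Sigma> len z (fst w) (snd w)"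
    unfolding Z_def by auto
  then obtain w where w: "\<forall>z\<in>Z. normal_solution G \<beta> Y \<Sigma> len z (fst (w z)) (snd (w z))"
    by (rule bchoice[THEN exE])
  define F D where "F z = fst (w z)" and "D z = snd (w z)" for z
  have FD: "normal_solution G \<beta> Y \<Sigma> len z (F z) (D z)" if "z \<in> Z" for z
    using w that by (simp add: F_def D_def)
  define s where "s z = (z, F z, D z)" for z
  have inj: "inj_on s Z" by (rule inj_onI) (simp add: s_def)
  define T where "T = s ` Z"
  have "infinite T" using inf finite_imageD[OF _ inj] by (auto simp: T_def)
  define K :: "(real \<times> ('a \<Rightarrow> real) \<times> ('a \<times> 'a \<Rightarrow> real)) set"
    where "K = {- r..r} \<times> {f. \<forall>i. f i \<in> {-1..1}} \<times> {f. \<forall>i. f i \<in> {-1..1}}"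
  have "compact K" unfolding K_def by (intro compact_Times compact_functions compact_Icc)
  moreover have "T \<subseteq> K" using FD Zr by (auto simp: T_def s_def K_def normal_solution_def)
  ultimately obtain x where x: "x islimpt T"
    using Heine_Borel_imp_Bolzano_Weierstrass \<open>infinite T\<close> by blast
  have sol: "normal_solution G \<beta> Y \<Sigma> len (fst x) (fst (snd x)) (snd (snd x))"
  proof -
    let ?K = "{x. normal_solution G \<beta> Y \<Sigma> len (fst x) (fst (snd x)) (snd (snd x))}"
    have "closed ?K" by (intro closed_normal_solution continuous_intros)
    moreover have "T \<subseteq> ?K" using FD by (auto simp: T_def s_def)
    \<comment> \<open>All of \<open>T\<close> lies in \<open>?K\<close>, so the removed point is
      arbitrary.\<close>
    ultimately show ?thesis using islimpt_remove1[OF x, of ?K undefined] by blast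
  qed
  define I where "I y = (\<Sum>a\<in>parcs G. integral {0..len (arc_edge a)} (\<lambda>t.
    (cosz (fst y) t * fst (snd y) (fst a) + sinz (fst y) t * snd (snd y) a) *
    (cosz (fst x) t * fst (snd x) (fst a) + sinz (fst x) t * snd (snd x) a)))"
    for y :: "real \<times> ('a \<Rightarrow> real) \<times> ('a \<times> 'a \<Rightarrow> real)"
  have "continuous_on UNIV I"
    unfolding I_def
  proof (intro continuous_on_sum)
    fix a
    have "continuous_on (UNIV \<times> cbox 0 (len (arc_edge a))) (\<lambda>(y :: real \<times> ('a \<Rightarrow> real) \<times> ('a \<times> 'a \<Rightarrow> real), t).
      (cosz (fst y) t * fst (snd y) (fst a) + sinz (fst y) t * snd (snd y) a) *
      (cosz (fst x) t * fst (snd x) (fst a) + sinz (fst x) t * snd (snd x) a))"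
      unfolding split_beta by (intro continuous_intros)
    from integral_continuous_on_param[OF this]
    show "continuous_on UNIV (\<lambda>y. integral {0..len (arc_edge a)} (\<lambda>t.
      (cosz (fst y) t * fst (snd y) (fst a) + sinz (fst y) t * snd (snd y) a) *
      (cosz (fst x) t * fst (snd x) (fst a) + sinz (fst x) t * snd (snd x) a)))"
      by simp
  qed
  then have "closed {y. I y = 0}" by (intro closed_Collect_eq continuous_on_const)
  \<comment> \<open>The sampled solution with the limiting parameter is left out, since
    orthogonality holds only for different parameters.\<close>
  moreover have "T - {s (fst x)} \<subseteq> {y. I y = 0}"
  proof
    fix y assume "y \<in> T - {s (fst x)}"
    then obtain z where z: "z \<in> Z" "y = s z" "z \<noteq> fst x" by (auto simp: T_def)
    have "graph_solution G \<beta> Y \<Sigma> len z (F z) (D z)" using FD[OF z(1)] by (simp add: normal_solution_def)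
    from overlap_Green[OF this _ z(3) len] sol show "y \<in> {y. I y = 0}"
      by (simp add: I_def z(2) s_def normal_solution_def)
  qed
  ultimately have "I x = 0" using islimpt_remove1[OF x] by blast
  define u where "u a t = cosz (fst x) t * fst (snd x) (fst a) + sinz (fst x) t * snd (snd x) a" for a t
  have cont: "continuous_on S (\<lambda>t. u a t * u a t)" for a S
    unfolding u_def by (intro continuous_intros)
  have int: "(\<lambda>t. u a t * u a t) integrable_on {0..len (arc_edge a)}" for a
    by (rule integrable_continuous_real[OF cont])
  have "integral {0..len (arc_edge a)} (\<lambda>t. u a t * u a t) = 0" if "a \<in> parcs G" for a
    using \<open>I x = 0\<close> that pair_finite_arcs unfolding I_def u_def[symmetric]
    by (subst (asm) sum_nonneg_eq_0_iff) (auto intro!: integral_nonneg int)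
  have zero: "fst (snd x) (fst a) = 0 \<and> snd (snd x) a = 0" if a: "a \<in> parcs G" for a
  proof -
    let ?l = "len (arc_edge a)"
    have l: "0 < ?l" using len a by (simp add: edges_def)
    have u0: "u a t = 0" if "t \<in> {0..?l}" for t
    proof -
      have "u a t * u a t = 0"
        by (rule integral_eq_0_iff[THEN iffD1, rule_format, OF cont _ _ _ that])
          (use l \<open>\<And>a. a \<in> parcs G \<Longrightarrow> integral {0..len (arc_edge a)} (\<lambda>t. u a t * u a t) = 0\<close> a in auto)
      then show ?thesis by simp
    qed
    have "u a 0 = 0" by (rule u0) (use l in simp)
    then have f: "fst (snd x) (fst a) = 0" by (simp add: u_def)
    \<comment> \<open>Small enough that z t^2 <= 1 < pi^2. Then \<open>sinz\<close> is positive at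
      t, and u a t = 0 forces the slope to vanish.\<close>
    define t where "t = min ?l (1 / (1 + \<bar>fst x\<bar>))"
    have t: "0 < t" "t \<le> ?l" "t \<le> 1 / (1 + \<bar>fst x\<bar>)" using l by (auto simp: t_def)
    moreover have "1 / (1 + \<bar>fst x\<bar>) \<le> 1" by simp
    ultimately have "t \<le> 1" by linarith
    have "fst x * t\<^sup>2 \<le> (1 + \<bar>fst x\<bar>) * t" 
      using t \<open>t \<le> 1\<close> by (intro mult_mono) (auto simp: power2_eq_square mult_left_le_one_le)
    also have "\<dots> \<le> 1" using t(3) by (simp add: field_simps)
    also have "1 < pi\<^sup>2" using pi_gt3 by (simp add: power2_eq_square less_1_mult)
    finally have "0 < sinz (fst x) t" using t by (intro sinz_pos) auto
    moreover have "u a t = 0" by (rule u0) (use t in simp)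
    ultimately show ?thesis using f by (simp add: u_def)
  qed
  then have "data_norm G (fst (snd x)) (snd (snd x)) = 0" by (simp add: data_norm_def)
  then show False using sol by (simp add: normal_solution_def)
qed

end

section \<open>Exceptional edge lengths\<close>

text \<open>
  Two solutions for the same \<open>z\<close>, one of which has a nonzero derivative along the edge of \<open>e\<close> at a
  zero, while the other one vanishes on that edge. The bounds in terms of \<open>n\<close> make the set closed.
\<close>

definition bad_lengths ::
  "'v pair_pre_digraph \<Rightarrow> ('v \<Rightarrow> real) \<Rightarrow> 'v set \<Rightarrow> ('v \<times> 'v) set \<Rightarrow> 'v set \<Rightarrow> ('v \<times> 'v) set \<Rightarrow>
    'v \<times> 'v \<Rightarrow> nat \<Rightarrow> ('v set \<Rightarrow> real) set" where
  "bad_lengths G \<beta> Y \<Sigma> Y' \<Sigma>' e n = {len \<in> topspace (edge_length_space G). \<exists>z F D F' D'.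
     z \<in> {- real n..real n} \<and>
     (normal_solution G \<beta> Y \<Sigma> len z F D \<and> F (fst e) = 0 \<and> 1 / (real n + 1) \<le> \<bar>D e\<bar>) \<and>
     normal_solution G \<beta> Y' \<Sigma>' len z F' D' \<and> F' (fst e) = 0 \<and> F' (snd e) = 0 \<and> D' e = 0 \<and> D' (flip e) = 0}"

lemma bad_lengthsE:
  assumes "len \<in> bad_lengths G \<beta> Y \<Sigma> Y' \<Sigma>' e n"
  obtains z F D F' D' where "z \<in> {- real n..real n}"
    "normal_solution G \<beta> Y \<Sigma> len z F D" "F (fst e) = 0" "1 / (real n + 1) \<le> \<bar>D e\<bar>"
    "normal_solution G \<beta> Y' \<Sigma>' len z F' D'" "F' (fst e) = 0" "F' (snd e) = 0" "D' e = 0" "D' (flip e) = 0"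
  using assms unfolding bad_lengths_def by (elim CollectE conjE exE)

lemma topspace_edge_length_space:
  "len \<in> topspace (edge_length_space G) \<longleftrightarrow> len \<in> extensional (edges G) \<and> (\<forall>c\<in>edges G. 0 < len c)"
  by (auto simp: edge_length_space_def PiE_def Pi_iff)

text \<open>The set is the projection of a closed set, and the bounds on z and on the data confine
  the witnesses to the compact \<open>K\<close>. Projection along a compact factor is a closed
  map.\<close>

lemma closedin_bad_lengths:
  fixes G :: "'v pair_pre_digraph"
  shows "closedin (edge_length_space G) (bad_lengths G \<beta> Y \<Sigma> Y' \<Sigma>' e n)"
proof -
  let ?X = "edge_length_space G"
  define K :: "(real \<times> ('v \<Rightarrow> real) \<times> ('v \<times> 'v \<Rightarrow> real) \<times> ('v \<Rightarrow> real) \<times> ('v \<times> 'v \<Rightarrow> real)) set"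
    where "K = {- real n..real n} \<times> {f. \<forall>i. f i \<in> {-1..1}} \<times> {f. \<forall>i. f i \<in> {-1..1}} \<times>
      {f. \<forall>i. f i \<in> {-1..1}} \<times> {f. \<forall>i. f i \<in> {-1..1}}"
  have K: "compact K" unfolding K_def by (intro compact_Times compact_functions compact_Icc)
  let ?P = "prod_topology ?X (top_of_set K)"
  define C :: "(('v set \<Rightarrow> real) \<times> real \<times> ('v \<Rightarrow> real) \<times> ('v \<times> 'v \<Rightarrow> real) \<times> ('v \<Rightarrow> real) \<times> ('v \<times> 'v \<Rightarrow> real)) set"
    where "C = {x. (normal_solution G \<beta> Y \<Sigma> (fst x) (fst (snd x)) (fst (snd (snd x))) (fst (snd (snd (snd x)))) \<and>
       fst (snd (snd x)) (fst e) = 0 \<and> 1 / (real n + 1) \<le> \<bar>fst (snd (snd (snd x))) e\<bar>) \<and>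
     normal_solution G \<beta> Y' \<Sigma>' (fst x) (fst (snd x)) (fst (snd (snd (snd (snd x))))) (snd (snd (snd (snd (snd x))))) \<and>
       fst (snd (snd (snd (snd x)))) (fst e) = 0 \<and> fst (snd (snd (snd (snd x)))) (snd e) = 0 \<and>
       snd (snd (snd (snd (snd x)))) e = 0 \<and> snd (snd (snd (snd (snd x)))) (flip e) = 0}"
  have "closed C"
    unfolding C_def
    by (intro closed_Collect_conj closed_normal_solution closed_Collect_eq closed_Collect_le continuous_intros)
  have coord: "continuous_map ?P euclideanreal (\<lambda>p. fst p c)" for c
  proof (cases "c \<in> edges G")
    case True
    have "continuous_map ?X (top_of_set {0<..}) (\<lambda>len. len c)"
      unfolding edge_length_space_def by (rule continuous_map_product_projection[OF True])
    then have "continuous_map ?X euclideanreal (\<lambda>len. len c)" by (rule continuous_map_into_fulltopology)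
    from continuous_map_compose[OF continuous_map_fst this] show ?thesis by (simp add: o_def)
  next
    case False
    \<comment> \<open>Off the edges an extensional length vector has the fixed value
      \<open>undefined\<close>, so this coordinate is constant.\<close>
    have "continuous_map ?P euclideanreal (\<lambda>p. undefined)" by simp
    then show ?thesis
    proof (rule continuous_map_eq)
      fix p assume "p \<in> topspace ?P"
      then have "fst p \<in> extensional (edges G)" by (auto simp: topspace_edge_length_space)
      then show "undefined = fst p c" using False by (simp add: extensional_def)
    qed
  qed
  have "continuous_map ?P euclidean fst"
    unfolding euclidean_product_topology[symmetric] continuous_map_componentwise_UNIV using coord by blast
  moreover have "continuous_map ?P euclidean snd"
    using continuous_map_snd by (rule continuous_map_into_fulltopology)
  ultimately have "continuous_map ?P (prod_topology euclidean euclidean) (\<lambda>p. (fst p, snd p))"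
    by (rule continuous_map_pairedI)
  then have "continuous_map ?P euclidean (\<lambda>p. p)" by simp
  then have "closedin ?P {p \<in> topspace ?P. p \<in> C}"
    by (rule closedin_continuous_map_preimage) (use \<open>closed C\<close> in simp)
  moreover have "closed_map ?P ?X fst"
    by (rule closed_map_fst) (use K in \<open>simp add: compact_space_subtopology\<close>)
  ultimately have "closedin ?X (fst ` {p \<in> topspace ?P. p \<in> C})"
    by (simp add: closed_map_def)
  moreover have "fst ` {p \<in> topspace ?P. p \<in> C} = bad_lengths G \<beta> Y \<Sigma> Y' \<Sigma>' e n" (is "?L = ?R")
  proof (intro equalityI subsetI)
    fix len assume "len \<in> ?L"
    then show "len \<in> ?R" by (fastforce simp: bad_lengths_def C_def K_def)
  next
    fix len assume "len \<in> ?R"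
    then obtain z F D F' D' where *: "len \<in> topspace ?X" "z \<in> {- real n..real n}"
      "normal_solution G \<beta> Y \<Sigma> len z F D \<and> F (fst e) = 0 \<and> 1 / (real n + 1) \<le> \<bar>D e\<bar>"
      "normal_solution G \<beta> Y' \<Sigma>' len z F' D' \<and> F' (fst e) = 0 \<and> F' (snd e) = 0 \<and> D' e = 0 \<and> D' (flip e) = 0"
      unfolding bad_lengths_def by blast
    then have "(z, F, D, F', D') \<in> K" unfolding K_def normal_solution_def by blast
    then have "(len, z, F, D, F', D') \<in> {p \<in> topspace ?P. p \<in> C}" using * by (simp add: C_def)
    then show "len \<in> ?L" by (rule image_eqI[rotated]) simp
  qed
  ultimately show ?thesis by simp
qed

context pair_graph
begin

lemma arc_edge_eq_iff: "arc_edge a = arc_edge b \<longleftrightarrow> a = b \<or> a = flip b"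
  by (cases a; cases b) (auto simp: arc_edge_def doubleton_eq_iff)

text \<open>Zero data along an edge satisfy its transfer equations whatever its length is.\<close>

lemma graph_solution_change_length:
  assumes "graph_solution G \<beta> Y \<Sigma> len z F D"
    and "F (fst e) = 0" "F (snd e) = 0" "D e = 0" "D (flip e) = 0"
    and "\<And>c. c \<in> edges G \<Longrightarrow> c \<noteq> arc_edge e \<Longrightarrow> len c = len' c"
  shows "graph_solution G \<beta> Y \<Sigma> len' z F D"
  unfolding graph_solution_def
proof (rule conjI, rule ballI)
  fix a assume a: "a \<in> parcs G"
  show "F (snd a) = edge_sign \<Sigma> a * (cosz z (len' (arc_edge a)) * F (fst a) + sinz z (len' (arc_edge a)) * D a) \<and>
        D (flip a) = edge_sign \<Sigma> a * (z * sinz z (len' (arc_edge a)) * F (fst a) - cosz z (len' (arc_edge a)) * D a)"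
  proof (cases "arc_edge a = arc_edge e")
    case True
    then consider "a = e" | "a = flip e" by (auto simp: arc_edge_eq_iff)
    then show ?thesis by cases (simp_all add: assms(2-5))
  next
    case False
    then have "len (arc_edge a) = len' (arc_edge a)" using assms(6) a by (simp add: edges_def)
    then show ?thesis using assms(1) a unfolding graph_solution_def by simp
  qed
qed (use assms(1) in \<open>simp add: graph_solution_def\<close>)

text \<open>
  If only the length of the edge of \<open>e\<close> moves in a short interval, then the solution that does not
  vanish there forces \<open>z\<close> to change injectively, but the other solution allows finitely many \<open>z\<close>.
\<close>

lemma bad_lengths_nowhere_dense:
  assumes e: "e \<in> parcs G" and T: "openin (edge_length_space G) T" "T \<subseteq> bad_lengths G \<beta> Y \<Sigma> Y' \<Sigma>' e n"
  shows "T = {}"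
proof (rule ccontr)
  let ?X = "edge_length_space G"
  assume "T \<noteq> {}"
  then obtain len where "len \<in> T" by blast
  have len: "len \<in> extensional (edges G)" "\<And>c. c \<in> edges G \<Longrightarrow> 0 < len c"
    using openin_subset[OF T(1)] \<open>len \<in> T\<close> topspace_edge_length_space by blast+
  define e0 where "e0 = arc_edge e"
  have e0: "e0 \<in> edges G" using e by (simp add: e0_def edges_def)
  define g where "g s = len(e0 := s)" for s
  have "continuous_map (top_of_set {0<..}) ?X g"
    unfolding edge_length_space_def continuous_map_componentwise
  proof (intro conjI ballI)
    show "g ` topspace (top_of_set {0<..}) \<subseteq> extensional (edges G)"
      using len(1) e0 by (auto simp: g_def extensional_def)
    fix c assume "c \<in> edges G"
    then show "continuous_map (top_of_set {0<..}) (top_of_set {0<..}) (\<lambda>s. g s c)"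
      using len(2) by (cases "c = e0") (simp_all add: g_def)
  qed
  from openin_continuous_map_preimage[OF this T(1)]
  have "openin (top_of_set {0<..}) {s \<in> {0<..}. g s \<in> T}" by simp
  then have "open {s \<in> {0<..}. g s \<in> T}" by (simp add: openin_open_eq open_greaterThan)
  moreover have "len e0 \<in> {s \<in> {0<..}. g s \<in> T}" using \<open>len \<in> T\<close> len(2)[OF e0] by (simp add: g_def)
  ultimately obtain \<delta> where \<delta>: "0 < \<delta>" "ball (len e0) \<delta> \<subseteq> {s \<in> {0<..}. g s \<in> T}"
    by (meson open_contains_ball)
  \<comment> \<open>\<open>\<delta>\<close> keeps the moved lengths inside \<open>T\<close>. The
    bound 1 / (n + 1) keeps z (s' - s)^2 below pi^2 for |z| <= n, so that \<open>sinz\<close> cannot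
    vanish at s' - s.\<close>
  define d where "d = min \<delta> (1 / (real n + 1))"
  have d: "0 < d" "d \<le> \<delta>" "d \<le> 1 / (real n + 1)" using \<delta> by (auto simp: d_def)
  define J where "J = {len e0<..<len e0 + d}"
  have bad: "g s \<in> bad_lengths G \<beta> Y \<Sigma> Y' \<Sigma>' e n" if "s \<in> J" for s
  proof -
    have "s \<in> ball (len e0) \<delta>" using that d by (auto simp: J_def dist_real_def)
    with \<delta>(2) have "g s \<in> T" by blast
    with T(2) show ?thesis by (rule subsetD)
  qed
  have "\<forall>s\<in>J. \<exists>z. z \<in> {- real n..real n} \<and>
      (\<exists>F D. normal_solution G \<beta> Y \<Sigma> (g s) z F D \<and> F (fst e) = 0 \<and> 1 / (real n + 1) \<le> \<bar>D e\<bar>) \<and>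
      (\<exists>F D. normal_solution G \<beta> Y' \<Sigma>' (g s) z F D \<and> F (fst e) = 0 \<and> F (snd e) = 0 \<and> D e = 0 \<and> D (flip e) = 0)"
    (is "\<forall>s\<in>J. ?Q s")
  proof
    fix s assume "s \<in> J"
    from bad[OF this] show "?Q s" by (rule bad_lengthsE) (intro exI conjI; assumption)
  qed
  then obtain \<zeta> where \<zeta>: "\<forall>s\<in>J. \<zeta> s \<in> {- real n..real n} \<and>
      (\<exists>F D. normal_solution G \<beta> Y \<Sigma> (g s) (\<zeta> s) F D \<and> F (fst e) = 0 \<and> 1 / (real n + 1) \<le> \<bar>D e\<bar>) \<and>
      (\<exists>F D. normal_solution G \<beta> Y' \<Sigma>' (g s) (\<zeta> s) F D \<and> F (fst e) = 0 \<and> F (snd e) = 0 \<and> D e = 0 \<and> D (flip e) = 0)"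
    by (rule bchoice[THEN exE])
  have g_same: "g s c = g s' c" if "c \<noteq> arc_edge e" for s s' c using that by (simp add: g_def e0_def)
  have ne: "\<zeta> s \<noteq> \<zeta> s'" if s: "s \<in> J" "s' \<in> J" "s < s'" for s s'
  proof
    assume eq: "\<zeta> s = \<zeta> s'"
    from \<zeta> s(1) obtain F D where FD: "graph_solution G \<beta> Y \<Sigma> (g s) (\<zeta> s) F D" "F (fst e) = 0" "1 / (real n + 1) \<le> \<bar>D e\<bar>"
      unfolding normal_solution_def by blast
    from \<zeta> s(2) obtain F' D' where FD': "graph_solution G \<beta> Y \<Sigma> (g s') (\<zeta> s) F' D'" "F' (fst e) = 0" "1 / (real n + 1) \<le> \<bar>D' e\<bar>"
      unfolding normal_solution_def eq by blast
    have "D e * D' e * sinz (\<zeta> s) (g s' (arc_edge e) - g s (arc_edge e)) = 0"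
      by (rule moved_length[OF FD(1) FD'(1) e _ FD(2) FD'(2)]) (rule g_same)
    then have "D e * D' e * sinz (\<zeta> s) (s' - s) = 0" by (simp add: g_def e0_def)
    moreover have "0 < 1 / (real n + 1)" by simp
    then have "D e \<noteq> 0" "D' e \<noteq> 0" using FD(3) FD'(3) by auto
    moreover have "0 < sinz (\<zeta> s) (s' - s)"
    proof (rule sinz_pos)
      have lt: "0 < s' - s" "s' - s \<le> 1 / (real n + 1)" using s d by (auto simp: J_def)
      then show "0 < s' - s" by simp
      have "\<zeta> s * (s' - s)\<^sup>2 \<le> (real n + 1) * (1 / (real n + 1))\<^sup>2"
      proof (rule mult_mono)
        show "\<zeta> s \<le> real n + 1" using \<zeta> s(1) by fastforce
        show "(s' - s)\<^sup>2 \<le> (1 / (real n + 1))\<^sup>2" using lt by (intro power_mono) auto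
      qed auto
      also have "\<dots> \<le> 1" by (simp add: power2_eq_square)
      also have "1 < pi\<^sup>2" using pi_gt3 by (simp add: power2_eq_square less_1_mult)
      finally show "\<zeta> s * (s' - s)\<^sup>2 < pi\<^sup>2" .
    qed
    ultimately show False by simp
  qed
  have inj: "inj_on \<zeta> J"
  proof (rule inj_onI)
    fix s s' assume "s \<in> J" "s' \<in> J" "\<zeta> s = \<zeta> s'"
    then show "s = s'" using ne[of s s'] ne[of s' s] by (cases s s' rule: linorder_cases) simp_all
  qed
  \<comment> \<open>The second solutions vanish on the moved edge, so all of them are solutions for
    the one fixed vector \<open>len\<close>.\<close>
  have "\<zeta> ` J \<subseteq> {z \<in> {- real n..real n}. \<exists>F D. normal_solution G \<beta> Y' \<Sigma>' len z F D}"
  proof (rule image_subsetI)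
    fix s assume s: "s \<in> J"
    from \<zeta> s obtain F D where FD: "normal_solution G \<beta> Y' \<Sigma>' (g s) (\<zeta> s) F D"
      "F (fst e) = 0" "F (snd e) = 0" "D e = 0" "D (flip e) = 0" by blast
    have "graph_solution G \<beta> Y' \<Sigma>' len (\<zeta> s) F D"
      by (rule graph_solution_change_length[of _ _ _ "g s" _ _ _ e])
        (use FD in \<open>simp_all add: normal_solution_def g_def e0_def\<close>)
    then have "normal_solution G \<beta> Y' \<Sigma>' len (\<zeta> s) F D" using FD(1) by (simp add: normal_solution_def)
    then show "\<zeta> s \<in> {z \<in> {- real n..real n}. \<exists>F D. normal_solution G \<beta> Y' \<Sigma>' len z F D}" using \<zeta> s by blast
  qed
  then have "finite (\<zeta> ` J)" by (rule finite_subset) (rule finite_normal_solutions[OF len(2)])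
  then have "finite J" by (rule finite_imageD[OF _ inj])
  then show False using d by (simp add: J_def infinite_Ioo)
qed

text \<open>The exceptional sets are indexed by subsets of finite sets, an arc and a natural number,
  so there are countably many, each closed and without interior.\<close>

lemma residual_good_lengths:
  fixes \<beta> :: "'a \<Rightarrow> real"
  assumes "S \<subseteq> topspace (edge_length_space G)"
    and "\<And>len. len \<in> topspace (edge_length_space G) - S \<Longrightarrow>
      \<exists>Y\<subseteq>pverts G. \<exists>\<Sigma>\<subseteq>parcs G. \<exists>Y'\<subseteq>pverts G. \<exists>\<Sigma>'\<subseteq>parcs G. \<exists>e\<in>parcs G. \<exists>n.
        len \<in> bad_lengths G \<beta> Y \<Sigma> Y' \<Sigma>' e n"
  shows "residual_in (edge_length_space G) S"
proof -
  let ?X = "edge_length_space G"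
  define good where "good = (\<lambda>(Y, \<Sigma>, Y', \<Sigma>', e, n). topspace ?X - bad_lengths G \<beta> Y \<Sigma> Y' \<Sigma>' e n)"
  define I :: "('a set \<times> ('a \<times> 'a) set \<times> 'a set \<times> ('a \<times> 'a) set \<times> ('a \<times> 'a) \<times> nat) set"
    where "I = Pow (pverts G) \<times> Pow (parcs G) \<times> Pow (pverts G) \<times> Pow (parcs G) \<times> parcs G \<times> UNIV"
  have "countable I"
    unfolding I_def using pair_finite_verts pair_finite_arcs
    by (intro countable_SIGMA) (auto intro: countable_finite)
  then have "countable (good ` I)" by simp
  moreover have "\<forall>U\<in>good ` I. openin ?X U \<and> ?X closure_of U = topspace ?X"
  proof
    fix U assume "U \<in> good ` I"
    then obtain Y \<Sigma> Y' \<Sigma>' e n where U: "U = topspace ?X - bad_lengths G \<beta> Y \<Sigma> Y' \<Sigma>' e n" and e: "e \<in> parcs G"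
      by (auto simp: good_def I_def)
    have "?X closure_of U = topspace ?X"
      unfolding dense_intersects_open
    proof (intro allI impI)
      fix T assume T: "openin ?X T \<and> T \<noteq> {}"
      then have "\<not> T \<subseteq> bad_lengths G \<beta> Y \<Sigma> Y' \<Sigma>' e n" using bad_lengths_nowhere_dense[OF e] by blast
      then show "U \<inter> T \<noteq> {}" using T openin_subset[of ?X T] by (auto simp: U)
    qed
    then show "openin ?X U \<and> ?X closure_of U = topspace ?X"
      using closedin_bad_lengths[of G \<beta> Y \<Sigma> Y' \<Sigma>' e n] by (simp add: U openin_diff)
  qed
  moreover have "topspace ?X \<inter> \<Inter> (good ` I) \<subseteq> S"
  proof
    fix len assume len: "len \<in> topspace ?X \<inter> \<Inter> (good ` I)"
    show "len \<in> S"
    proof (rule ccontr)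
      assume "len \<notin> S"
      then have "len \<in> topspace ?X - S" using len by blast
      from assms(2)[OF this] obtain Y \<Sigma> Y' \<Sigma>' e n
        where *: "Y \<subseteq> pverts G" "\<Sigma> \<subseteq> parcs G" "Y' \<subseteq> pverts G" "\<Sigma>' \<subseteq> parcs G" "e \<in> parcs G"
          and bad: "len \<in> bad_lengths G \<beta> Y \<Sigma> Y' \<Sigma>' e n"
        by (elim bexE exE conjE)
      then have "(Y, \<Sigma>, Y', \<Sigma>', e, n) \<in> I" by (simp add: I_def)
      with len have "len \<in> good (Y, \<Sigma>, Y', \<Sigma>', e, n)" by blast
      then show False using bad by (simp add: good_def)
    qed
  qed
  ultimately show ?thesis unfolding residual_in_def using assms(1) by blast
qed

end

section \<open>Reduction of eigenfunctions to vertex data\<close>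

text \<open>Regularity: the weak second derivative agrees almost everywhere with the continuous
  function - z f. So f' is an integral of a continuous function and is differentiable
  everywhere.\<close>

lemma H2_solution:
  fixes f f' f'' :: "real \<Rightarrow> complex"
  assumes H2: "H2_on L f f' f''" and eq: "AE x\<in>{0..L} in lborel. z * f x = - f'' x" and x: "x \<in> {0..L}"
  shows "(f has_vector_derivative f' x) (at x within {0..L})"
    and "(f' has_vector_derivative - z * f x) (at x within {0..L})"
proof -
  have f: "(f has_vector_derivative f' x) (at x within {0..L})" if "x \<in> {0..L}" for x
    using H2 that unfolding H2_on_def by blast
  then show "(f has_vector_derivative f' x) (at x within {0..L})" using x .
  have cont: "continuous_on {0..L} (\<lambda>y. - z * f y)"
    by (intro continuous_intros continuous_on_vector_derivative[OF f])
  have f': "f' x = f' 0 + integral {0..x} (\<lambda>y. - z * f y)" if x: "x \<in> {0..L}" for x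
  proof -
    have sub: "{0..x} \<subseteq> {0..L}" using x by auto
    have si: "set_integrable lborel {0..x} (\<lambda>y. - z * f y)"
      by (rule borel_integrable_atLeastAtMost') (rule continuous_on_subset[OF cont sub])
    have "set_borel_measurable lborel {0..L} f''" using H2 unfolding H2_on_def L2_on_def by blast
    then have meas: "(\<lambda>y. indicat_real {0..x} y *\<^sub>R f'' y) \<in> borel_measurable lborel"
      unfolding set_borel_measurable_def[symmetric] by (rule set_borel_measurable_subset) (use sub in auto)
    have ae: "AE y in lborel. indicat_real {0..x} y *\<^sub>R f'' y = indicat_real {0..x} y *\<^sub>R (- z * f y)"
      using eq
    proof eventually_elim
      case (elim y)
      show ?case
      proof (cases "y \<in> {0..x}")
        case True
        then have "z * f y = - f'' y" using elim sub by blast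
        then have "f'' y = - z * f y" by (simp add: minus_equation_iff)
        then show ?thesis by simp
      qed simp
    qed
    have "set_lebesgue_integral lborel {0..x} f'' = set_lebesgue_integral lborel {0..x} (\<lambda>y. - z * f y)"
      unfolding set_lebesgue_integral_def
      by (rule integral_cong_AE[OF meas borel_measurable_integrable[OF si[unfolded set_integrable_def]] ae])
    also have "\<dots> = integral {0..x} (\<lambda>y. - z * f y)" by (rule set_borel_integral_eq_integral(2)[OF si])
    finally have "set_lebesgue_integral lborel {0..x} f'' = integral {0..x} (\<lambda>y. - z * f y)" .
    moreover have "f' x = f' 0 + set_lebesgue_integral lborel {0..x} f''"
      using H2 x unfolding H2_on_def by blast
    ultimately show ?thesis by (simp only:)
  qed
  have "((\<lambda>u. f' 0 + integral {0..u} (\<lambda>y. - z * f y)) has_vector_derivative 0 + - z * f x) (at x within {0..L})"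
    by (intro has_vector_derivative_add has_vector_derivative_const integral_has_vector_derivative[OF cont x])
  then have "((\<lambda>u. f' 0 + integral {0..u} (\<lambda>y. - z * f y)) has_vector_derivative - z * f x) (at x within {0..L})"
    by simp
  then show "(f' has_vector_derivative - z * f x) (at x within {0..L})"
    by (rule has_vector_derivative_transform[OF x, rotated]) (rule f')
qed

lemma L2_norm_sq_continuous:
  assumes "continuous_on {0..L} f"
  shows "L2_norm_sq L f = integral {0..L} (\<lambda>x. (cmod (f x))\<^sup>2)"
  unfolding L2_norm_sq_def
  by (rule set_borel_integral_eq_integral(2)) (intro borel_integrable_atLeastAtMost' continuous_intros assms)

text \<open>Integrate the derivative of (L - x) |g x|^2, which vanishes at L, and estimate the mixed
  term by 2ab <= a^2 + b^2.\<close>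

lemma trace_bound:
  fixes g g' :: "real \<Rightarrow> complex"
  assumes L: "0 < L" and g: "\<And>x. x \<in> {0..L} \<Longrightarrow> (g has_vector_derivative g' x) (at x within {0..L})"
    and g': "continuous_on {0..L} g'"
  shows "L * (cmod (g 0))\<^sup>2 \<le> (1 + L) * integral {0..L} (\<lambda>x. (cmod (g x))\<^sup>2) + L * integral {0..L} (\<lambda>x. (cmod (g' x))\<^sup>2)"
proof -
  have cg: "continuous_on {0..L} g" by (rule continuous_on_vector_derivative[OF g])
  let ?h = "\<lambda>x. - ((cmod (g x))\<^sup>2) + (L - x) * (2 * (g x \<bullet> g' x))"
  have "(?h has_integral ((L - L) * (g L \<bullet> g L) - (L - 0) * (g 0 \<bullet> g 0))) {0..L}"
  proof (rule fundamental_theorem_of_calculus)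
    fix x assume x: "x \<in> {0..L}"
    have i: "((\<lambda>x. g x \<bullet> g x) has_vector_derivative g x \<bullet> g' x + g' x \<bullet> g x) (at x within {0..L})"
      by (rule bounded_bilinear.has_vector_derivative[OF bounded_bilinear_inner g[OF x] g[OF x]])
    have l: "((\<lambda>x. L - x) has_vector_derivative - 1) (at x within {0..L})"
      by (auto intro!: derivative_eq_intros)
    have "((\<lambda>x. (L - x) * (g x \<bullet> g x)) has_vector_derivative
        (L - x) * (g x \<bullet> g' x + g' x \<bullet> g x) + - 1 * (g x \<bullet> g x)) (at x within {0..L})"
      by (rule has_vector_derivative_mult[OF l i])
    then show "((\<lambda>x. (L - x) * (g x \<bullet> g x)) has_vector_derivative ?h x) (at x within {0..L})"
      by (rule back_subst) (simp add: power2_norm_eq_inner inner_commute)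
  qed (use L in simp)
  then have "L * (cmod (g 0))\<^sup>2 = - integral {0..L} ?h"
    by (simp add: integral_unique power2_norm_eq_inner)
  also have "\<dots> = integral {0..L} (\<lambda>x. - ?h x)" by (simp only: integral_neg)
  also have "\<dots> \<le> integral {0..L} (\<lambda>x. (1 + L) * (cmod (g x))\<^sup>2 + L * (cmod (g' x))\<^sup>2)"
  proof (rule integral_le)
    show "(\<lambda>x. - ?h x) integrable_on {0..L}"
      by (intro integrable_continuous_real continuous_intros cg g')
    show "(\<lambda>x. (1 + L) * (cmod (g x))\<^sup>2 + L * (cmod (g' x))\<^sup>2) integrable_on {0..L}"
      by (intro integrable_continuous_real continuous_intros cg g')
    fix x assume x: "x \<in> {0..L}"
    have "0 \<le> (cmod (g x + g' x))\<^sup>2" by simp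
    then have "- (2 * (g x \<bullet> g' x)) \<le> (cmod (g x))\<^sup>2 + (cmod (g' x))\<^sup>2"
      by (simp add: power2_norm_eq_inner inner_add_left inner_add_right inner_commute)
    then have "(L - x) * - (2 * (g x \<bullet> g' x)) \<le> (L - x) * ((cmod (g x))\<^sup>2 + (cmod (g' x))\<^sup>2)"
      using x by (intro mult_left_mono) auto
    also have "\<dots> \<le> L * ((cmod (g x))\<^sup>2 + (cmod (g' x))\<^sup>2)"
      using x by (intro mult_right_mono) auto
    finally show "- ?h x \<le> (1 + L) * (cmod (g x))\<^sup>2 + L * (cmod (g' x))\<^sup>2"
      by (simp add: algebra_simps)
  qed
  also have "\<dots> = (1 + L) * integral {0..L} (\<lambda>x. (cmod (g x))\<^sup>2) + L * integral {0..L} (\<lambda>x. (cmod (g' x))\<^sup>2)"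
  proof -
    have "(\<lambda>x. (1 + L) * (cmod (g x))\<^sup>2) integrable_on {0..L}" "(\<lambda>x. L * (cmod (g' x))\<^sup>2) integrable_on {0..L}"
      by (intro integrable_continuous_real continuous_intros cg g')+
    then show ?thesis by (simp add: integral_add)
  qed
  finally show ?thesis .
qed

text \<open>The current Im (cnj f * f') has derivative - Im z |f|^2, since the remaining term |f'|^2
  is real.\<close>

lemma imaginary_flux:
  fixes f f' :: "real \<Rightarrow> complex"
  assumes L: "0 < L" and f: "\<And>x. x \<in> {0..L} \<Longrightarrow> (f has_vector_derivative f' x) (at x within {0..L})"
    and f': "\<And>x. x \<in> {0..L} \<Longrightarrow> (f' has_vector_derivative - z * f x) (at x within {0..L})"
  shows "Im (cnj (f L) * f' L) - Im (cnj (f 0) * f' 0) = - Im z * integral {0..L} (\<lambda>x. (cmod (f x))\<^sup>2)"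
proof -
  have "((\<lambda>x. - Im z * (cmod (f x))\<^sup>2) has_integral (Im (cnj (f L) * f' L) - Im (cnj (f 0) * f' 0))) {0..L}"
  proof (rule fundamental_theorem_of_calculus)
    fix x assume x: "x \<in> {0..L}"
    have "((\<lambda>x. cnj (f x)) has_vector_derivative cnj (f' x)) (at x within {0..L})"
      by (rule bounded_linear.has_vector_derivative[OF bounded_linear_cnj f[OF x]])
    from bounded_linear.has_vector_derivative[OF bounded_linear_Im has_vector_derivative_mult[OF this f'[OF x]]]
    show "((\<lambda>x. Im (cnj (f x) * f' x)) has_vector_derivative - Im z * (cmod (f x))\<^sup>2) (at x within {0..L})"
      by (rule back_subst) (subst cmod_power2, simp add: algebra_simps power2_eq_square)
  qed (use L in simp)
  from integral_unique[OF this] show ?thesis by simp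
qed

text \<open>\<open>g\<close> is \<open>f\<close> read from the other end. The chain rule with x to L
  - x produces the sign, and one-sided derivatives are unique.\<close>

lemma reversed_derivative:
  fixes f g f' g' :: "real \<Rightarrow> complex"
  assumes L: "0 < L" and f: "\<And>x. x \<in> {0..L} \<Longrightarrow> (f has_vector_derivative f' x) (at x within {0..L})"
    and g: "\<And>x. x \<in> {0..L} \<Longrightarrow> (g has_vector_derivative g' x) (at x within {0..L})"
    and eq: "\<And>x. x \<in> {0..L} \<Longrightarrow> g (L - x) = f x"
  shows "g 0 = f L" "g' 0 = - f' L"
proof -
  show "g 0 = f L" using eq[of L] L by simp
  have im: "(\<lambda>x. L - x) ` {0..L} = {0..L}"
    by (auto simp: image_iff intro: bexI[of _ "L - _"])
  have l: "((\<lambda>x. L - x) has_vector_derivative - 1) (at L within {0..L})"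
    by (auto intro!: derivative_eq_intros)
  have "(g has_vector_derivative g' 0) (at (L - L) within (\<lambda>x. L - x) ` {0..L})"
    using g[of 0] L unfolding im by simp
  from vector_diff_chain_within[OF l this]
  have "((\<lambda>x. g (L - x)) has_vector_derivative - g' 0) (at L within {0..L})" by (simp add: o_def)
  then have "(f has_vector_derivative - g' 0) (at L within {0..L})"
    by (rule has_vector_derivative_transform[rotated 2]) (use L eq in auto)
  with f[of L] L have "- g' 0 = f' L"
    using vector_derivative_unique_within_closed_interval[of 0 L L f "- g' 0" "f' L"] by simp
  then show "g' 0 = - f' L" by (metis minus_minus)
qed


text \<open>For real z the equation has real coefficients, so a real-linear functional such as Re or
  Im maps solutions to real solutions.\<close>

lemma real_part_ode:
  fixes f f' :: "real \<Rightarrow> complex" and R :: "complex \<Rightarrow> real"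
  assumes R: "bounded_linear R" and z: "Im z = 0"
    and f: "\<And>x. x \<in> {0..L} \<Longrightarrow> (f has_vector_derivative f' x) (at x within {0..L})"
    and f': "\<And>x. x \<in> {0..L} \<Longrightarrow> (f' has_vector_derivative - z * f x) (at x within {0..L})"
    and x: "x \<in> {0..L}"
  shows "R (f x) = cosz (Re z) x * R (f 0) + sinz (Re z) x * R (f' 0)"
    "R (f' x) = cosz (Re z) x * R (f' 0) - Re z * sinz (Re z) x * R (f 0)"
proof -
  have zR: "z = complex_of_real (Re z)" using z by (simp add: complex_eq_iff)
  have mult: "R (- z * w) = - Re z * R w" for w
  proof -
    have "- z * w = (- Re z) *\<^sub>R w" by (subst zR) (simp add: scaleR_conv_of_real)
    then show ?thesis using bounded_linear.linear[OF R] by (simp only: linear_scale real_scaleR_def)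
  qed
  have u: "((\<lambda>x. R (f x)) has_real_derivative R (f' x)) (at x within {0..L})" if "x \<in> {0..L}" for x
    using bounded_linear.has_vector_derivative[OF R f[OF that]]
    by (simp add: has_real_derivative_iff_has_vector_derivative)
  have v: "((\<lambda>x. R (f' x)) has_real_derivative - Re z * R (f x)) (at x within {0..L})" if "x \<in> {0..L}" for x
    using bounded_linear.has_vector_derivative[OF R f'[OF that]]
    unfolding has_real_derivative_iff_has_vector_derivative mult .
  show "R (f x) = cosz (Re z) x * R (f 0) + sinz (Re z) x * R (f' 0)"
    "R (f' x) = cosz (Re z) x * R (f' 0) - Re z * sinz (Re z) x * R (f 0)"
    using ode_solution[of L "\<lambda>x. R (f x)" "\<lambda>x. R (f' x)" "Re z" x, OF u v x] by simp_all
qed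

text \<open>Passage from Sobolev functions to real vertex data. Trace bounds, uniform over the
  edges, make values and slopes at the vertices square summable. The current shows that z is real,
  and a real-linear functional then yields a real solution that is still nonzero.\<close>

lemma ex_real_eigenfunction:
  fixes T :: "'t pair_pre_digraph" and \<alpha> :: "'t \<Rightarrow> ereal"
  assumes T: "pair_bidirected_digraph T"
    and fin: "\<And>v. v \<in> pverts T \<Longrightarrow> finite (neighbours T v)"
    and len: "0 < m" "\<And>a. a \<in> parcs T \<Longrightarrow> m \<le> len (arc_edge a) \<and> len (arc_edge a) \<le> M"
    and z: "z \<in> point_spectrum T len \<alpha>"
  shows "Im z = 0 \<and> (\<exists>F D.
    (\<forall>a\<in>parcs T. F (snd a) = cosz (Re z) (len (arc_edge a)) * F (fst a) + sinz (Re z) (len (arc_edge a)) * D a \<and>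
       D (flip a) = Re z * sinz (Re z) (len (arc_edge a)) * F (fst a) - cosz (Re z) (len (arc_edge a)) * D a) \<and>
    (\<forall>v\<in>pverts T. if \<alpha> v = \<infinity> then F v = 0 else (\<Sum>w\<in>neighbours T v. D (v, w)) = real_of_ereal (\<alpha> v) * F v) \<and>
    (\<lambda>a. (F (fst a))\<^sup>2 + (D a)\<^sup>2) summable_on parcs T \<and>
    (\<exists>a\<in>parcs T. (F (fst a))\<^sup>2 + (D a)\<^sup>2 \<noteq> 0))"
proof -
  interpret T: pair_bidirected_digraph T by (rule T)
  let ?A = "parcs T"
  define L where "L a = len (arc_edge a)" for a
  have flip_A: "flip a \<in> ?A" if "a \<in> ?A" for a using that T.arcs_symmetric by (cases a) auto
  have L_flip: "L (flip a) = L a" for a by (simp add: L_def arc_edge_def insert_commute)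
  have Lpos: "0 < L a" "m \<le> L a" "L a \<le> M" if "a \<in> ?A" for a
    using len(2)[OF that] len(1) by (auto simp: L_def)
  from z obtain f where f: "(f, \<lambda>a x. z * f a x) \<in> schroedinger T len \<alpha>"
    and nz: "\<not> (\<forall>a\<in>?A. AE x\<in>{0..L a} in lborel. f a x = 0)"
    unfolding point_spectrum_def L_def by blast
  from f obtain f' f'' where H2: "H2_graph T len f f' f''"
    and delta: "\<forall>v\<in>pverts T. delta_condition T \<alpha> f f' v"
    and ae: "\<forall>a\<in>?A. AE x\<in>{0..L a} in lborel. z * f a x = - f'' a x"
    unfolding schroedinger_def L_def by blast
  have H2a: "H2_on (L a) (f a) (f' a) (f'' a)" if "a \<in> ?A" for a
    using H2 that unfolding H2_graph_def L_def by blast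
  have d1: "(f a has_vector_derivative f' a x) (at x within {0..L a})"
    and d2: "(f' a has_vector_derivative - z * f a x) (at x within {0..L a})"
    if "a \<in> ?A" "x \<in> {0..L a}" for a x
    using H2_solution[OF H2a[OF that(1)] _ that(2)] ae that(1) by blast+
  have c1: "continuous_on {0..L a} (f a)" and c2: "continuous_on {0..L a} (f' a)" if "a \<in> ?A" for a
    by (rule continuous_on_vector_derivative[OF d1[OF that]], assumption,
        rule continuous_on_vector_derivative[OF d2[OF that]], assumption)
  have cons: "f (flip a) (L a - x) = f a x" if "a \<in> ?A" "x \<in> {0..L a}" for a x
    using H2 that unfolding H2_graph_def consistent_def L_def by (cases a) (auto simp: arc_edge_def)
  have rev: "f (flip a) 0 = f a (L a)" "f' (flip a) 0 = - f' a (L a)" if a: "a \<in> ?A" for a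
    by (rule reversed_derivative[OF Lpos(1)[OF a] d1[OF a] d1[OF flip_A[OF a], unfolded L_flip] cons[OF a]]; assumption)+
  define N where "N g a = integral {0..L a} (\<lambda>x. (cmod (g a x))\<^sup>2)" for g :: "'t \<times> 't \<Rightarrow> real \<Rightarrow> complex" and a
  have N_nonneg: "0 \<le> N g a" if "continuous_on {0..L a} (g a)" for g a
    unfolding N_def by (intro integral_nonneg integrable_continuous_real continuous_intros that) simp
  have N_norm: "N f a = L2_norm_sq (L a) (f a)" "N f' a = L2_norm_sq (L a) (f' a)" if "a \<in> ?A" for a
    using L2_norm_sq_continuous[OF c1[OF that]] L2_norm_sq_continuous[OF c2[OF that]] by (simp_all add: N_def)
  have sum0: "(\<lambda>a. L2_norm_sq (L a) (f a) + L2_norm_sq (L a) (f' a) + L2_norm_sq (L a) (f'' a)) summable_on ?A"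
    using H2 unfolding H2_graph_def L_def by blast
  have norm_nonneg: "0 \<le> L2_norm_sq l g" for l g
    unfolding L2_norm_sq_def set_lebesgue_integral_def by (intro integral_nonneg_AE) simp
  have sumN: "(\<lambda>a. N f a + N f' a) summable_on ?A"
    by (rule summable_on_comparison_test[OF sum0]) (simp_all add: N_norm norm_nonneg)
  have sumNf: "N f summable_on ?A"
    by (rule summable_on_comparison_test[OF sumN]) (simp_all add: N_norm norm_nonneg)
  define Q where "Q a = (cmod (f a 0))\<^sup>2 + (cmod (f' a 0))\<^sup>2" for a
  \<comment> \<open>Collects the coefficients of the trace bounds for f and for f', the latter with
    f'' = - z f. Lengths are bounded above by \<open>M\<close>, and \<open>m\<close> bounds the
    divisor from below.\<close>
  define K where "K = ((1 + M) + M * (cmod z)\<^sup>2 + M + (1 + M)) / m"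
  have Q_le: "Q a \<le> K * (N f a + N f' a)" if a: "a \<in> ?A" for a
  proof -
    have cz: "continuous_on {0..L a} (\<lambda>x. - z * f a x)" by (intro continuous_intros c1[OF a])
    have 1: "L a * (cmod (f a 0))\<^sup>2 \<le> (1 + L a) * N f a + L a * N f' a"
      unfolding N_def by (rule trace_bound[OF Lpos(1)[OF a] d1[OF a] c2[OF a]])
    have "L a * (cmod (f' a 0))\<^sup>2 \<le> (1 + L a) * N f' a + L a * integral {0..L a} (\<lambda>x. (cmod (- z * f a x))\<^sup>2)"
      unfolding N_def by (rule trace_bound[OF Lpos(1)[OF a] d2[OF a] cz])
    also have "integral {0..L a} (\<lambda>x. (cmod (- z * f a x))\<^sup>2) = (cmod z)\<^sup>2 * N f a"
      unfolding N_def by (simp add: norm_mult power_mult_distrib)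
    finally have 2: "L a * (cmod (f' a 0))\<^sup>2 \<le> (1 + L a) * N f' a + L a * ((cmod z)\<^sup>2 * N f a)" .
    have n: "0 \<le> N f a" "0 \<le> N f' a" using N_nonneg c1[OF a] c2[OF a] by blast+
    have M: "0 \<le> M" using Lpos[OF a] by simp
    have "m * Q a \<le> L a * Q a" using Lpos[OF a] by (intro mult_right_mono) (auto simp: Q_def)
    also have "\<dots> \<le> (1 + L a) * N f a + L a * N f' a + ((1 + L a) * N f' a + L a * ((cmod z)\<^sup>2 * N f a))"
      using 1 2 by (simp add: Q_def distrib_left)
    also have "\<dots> \<le> (1 + M) * N f a + M * N f' a + ((1 + M) * N f' a + M * ((cmod z)\<^sup>2 * N f a))"
      using Lpos[OF a] n by (intro add_mono mult_right_mono) auto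
    also have "\<dots> \<le> ((1 + M) + M * (cmod z)\<^sup>2 + M + (1 + M)) * (N f a + N f' a)"
    proof -
      have "0 \<le> (M + (1 + M)) * N f a + ((1 + M) + M * (cmod z)\<^sup>2) * N f' a" using M n by simp
      then show ?thesis by (simp add: algebra_simps)
    qed
    finally show ?thesis using len(1) by (simp add: K_def pos_le_divide_eq mult.commute)
  qed
  have sumQ: "Q summable_on ?A"
    by (rule summable_on_comparison_test[OF summable_on_cmult_right[OF sumN]]) (use Q_le in \<open>auto simp: Q_def\<close>)
  have oa: "out_arcs (with_proj T) v = Pair v ` neighbours T v" if "v \<in> pverts T" for v
    by (auto simp: out_arcs_def neighbours_def)
  have "\<forall>v\<in>pverts T. \<exists>c. (\<forall>a\<in>out_arcs (with_proj T) v. f a 0 = c) \<and>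
        (if \<alpha> v = \<infinity> then c = 0
         else (\<Sum>a\<in>out_arcs (with_proj T) v. f' a 0) = complex_of_real (real_of_ereal (\<alpha> v)) * c)"
    using delta unfolding delta_condition_def .
  then obtain c where c: "\<forall>v\<in>pverts T. (\<forall>a\<in>out_arcs (with_proj T) v. f a 0 = c v) \<and>
        (if \<alpha> v = \<infinity> then c v = 0
         else (\<Sum>a\<in>out_arcs (with_proj T) v. f' a 0) = complex_of_real (real_of_ereal (\<alpha> v)) * c v)"
    by (rule bchoice[THEN exE])
  have cf: "f a 0 = c (fst a)" if "a \<in> ?A" for a
  proof -
    have "fst a \<in> pverts T" using T.arc_fst_in_verts[OF that] .
    moreover have "a \<in> out_arcs (with_proj T) (fst a)" using that by (simp add: out_arcs_def)
    ultimately show ?thesis using c by blast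
  qed
  have kirch: "if \<alpha> v = \<infinity> then c v = 0
      else (\<Sum>w\<in>neighbours T v. f' (v, w) 0) = complex_of_real (real_of_ereal (\<alpha> v)) * c v" if v: "v \<in> pverts T" for v
  proof -
    have eq: "(\<Sum>a\<in>out_arcs (with_proj T) v. f' a 0) = (\<Sum>w\<in>neighbours T v. f' (v, w) 0)"
      unfolding oa[OF v] by (subst sum.reindex) (auto simp: inj_on_def)
    have "if \<alpha> v = \<infinity> then c v = 0
      else (\<Sum>a\<in>out_arcs (with_proj T) v. f' a 0) = complex_of_real (real_of_ereal (\<alpha> v)) * c v"
      using c v by blast
    then show ?thesis unfolding eq .
  qed
  have real: "Im z = 0"
  proof (rule ccontr)
    assume z0: "Im z \<noteq> 0"
    \<comment> \<open>The outgoing current sums to zero at every vertex by the delta condition, and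
      over the two arcs of an edge to Im z times the energy. Absolute summability allows both
      groupings.\<close>
    define h where "h a = Im (cnj (f a 0) * f' a 0)" for a
    have h_le: "\<bar>h a\<bar> \<le> Q a" for a
    proof -
      have "\<bar>h a\<bar> \<le> cmod (f a 0) * cmod (f' a 0)"
        unfolding h_def using abs_Im_le_cmod[of "cnj (f a 0) * f' a 0"] by (simp add: norm_mult)
      also have "\<dots> \<le> Q a"
        using sum_squares_bound[of "cmod (f a 0)" "cmod (f' a 0)"]
          mult_nonneg_nonneg[OF norm_ge_zero norm_ge_zero, of "f a 0" "f' a 0"]
        unfolding Q_def by linarith
      finally show ?thesis .
    qed
    have "(\<lambda>a. norm (h a)) summable_on ?A"
      by (rule summable_on_comparison_test[OF sumQ]) (use h_le in auto)
    then have sumh: "h summable_on ?A" by (rule abs_summable_summable)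
    have A_Sigma: "?A = Sigma (pverts T) (neighbours T)"
      using T.arc_fst_in_verts by (force simp: neighbours_def)
    have "infsum h ?A = (\<Sum>\<^sub>\<infinity>v\<in>pverts T. \<Sum>\<^sub>\<infinity>w\<in>neighbours T v. h (v, w))"
      using infsum_Sigma_banach[of h "pverts T" "neighbours T"] sumh unfolding A_Sigma by simp
    also have "\<dots> = (\<Sum>\<^sub>\<infinity>v\<in>pverts T. 0)"
    proof (rule infsum_cong)
      fix v assume v: "v \<in> pverts T"
      have "(\<Sum>\<^sub>\<infinity>w\<in>neighbours T v. h (v, w)) = (\<Sum>w\<in>neighbours T v. h (v, w))"
        using fin[OF v] by simp
      also have "\<dots> = (\<Sum>w\<in>neighbours T v. Im (cnj (c v) * f' (v, w) 0))"
        using cf by (intro sum.cong) (auto simp: h_def neighbours_def)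
      also have "\<dots> = Im (cnj (c v) * (\<Sum>w\<in>neighbours T v. f' (v, w) 0))"
        by (simp add: sum_distrib_left)
      also have "\<dots> = 0"
        using kirch[OF v] by (cases "\<alpha> v = \<infinity>") auto
      finally show "(\<Sum>\<^sub>\<infinity>w\<in>neighbours T v. h (v, w)) = 0" .
    qed
    finally have h0: "infsum h ?A = 0" by simp
    have bij: "bij_betw flip ?A ?A"
      by (rule bij_betwI[of _ _ _ flip]) (auto simp: flip_A)
    have hf: "h a + h (flip a) = Im z * N f a" if a: "a \<in> ?A" for a
      using imaginary_flux[OF Lpos(1)[OF a] d1[OF a] d2[OF a]] rev[OF a] by (simp add: h_def N_def)
    have "infsum (\<lambda>a. h a + h (flip a)) ?A = infsum h ?A + infsum (\<lambda>a. h (flip a)) ?A"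
      using sumh summable_on_reindex_bij_betw[OF bij, of h] by (intro infsum_add) auto
    also have "\<dots> = 0" using h0 infsum_reindex_bij_betw[OF bij, of h] by simp
    also have "infsum (\<lambda>a. h a + h (flip a)) ?A = infsum (\<lambda>a. Im z * N f a) ?A"
      by (rule infsum_cong) (rule hf)
    also have "\<dots> = Im z * infsum (N f) ?A" by (rule infsum_cmult_right')
    finally have "infsum (N f) ?A = 0" using z0 by simp
    then have N0: "N f a = 0" if "a \<in> ?A" for a
      by (intro nonneg_infsum_le_0D[OF _ sumNf _ that] N_nonneg c1) simp_all
    have "f a x = 0" if a: "a \<in> ?A" and x: "x \<in> {0..L a}" for a x
    proof -
      have "(cmod (f a x))\<^sup>2 = 0"
        by (rule integral_eq_0_iff[THEN iffD1, rule_format, OF _ _ _ _ x])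
          (use N0[OF a] Lpos(1)[OF a] c1[OF a] in \<open>auto simp: N_def intro!: continuous_intros\<close>)
      then show ?thesis by simp
    qed
    then have "\<forall>a\<in>?A. AE x\<in>{0..L a} in lborel. f a x = 0" by (intro ballI AE_I2) blast
    with nz show False ..
  qed
  have "\<exists>a\<in>?A. \<exists>x\<in>{0..L a}. f a x \<noteq> 0"
  proof (rule ccontr)
    assume "\<not> ?thesis"
    then have "f a x = 0" if "a \<in> ?A" "x \<in> {0..L a}" for a x using that by blast
    then have "\<forall>a\<in>?A. AE x\<in>{0..L a} in lborel. f a x = 0" by (intro ballI AE_I2) blast
    with nz show False ..
  qed
  then obtain a0 x0 where a0: "a0 \<in> ?A" "x0 \<in> {0..L a0}" "f a0 x0 \<noteq> 0" by blast
  \<comment> \<open>The real or the imaginary part, whichever is nonzero at the chosen point, so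
    that the real solution is nontrivial.\<close>
  obtain R where R: "bounded_linear R" "R (f a0 x0) \<noteq> (0::real)" "\<And>w. \<bar>R w\<bar> \<le> cmod w"
  proof (cases "Re (f a0 x0) = 0")
    case True
    then have "Im (f a0 x0) \<noteq> 0" using a0 by (simp add: complex_eq_iff)
    then show ?thesis using that[of Im] bounded_linear_Im abs_Im_le_cmod by blast
  next
    case False
    then show ?thesis using that[of Re] bounded_linear_Re abs_Re_le_cmod by blast
  qed
  define F D where "F v = R (c v)" and "D a = R (f' a 0)" for v a
  have lin: "linear R" using R(1) by (rule bounded_linear.linear)
  have sol: "R (f a x) = cosz (Re z) x * R (f a 0) + sinz (Re z) x * R (f' a 0)"
    "R (f' a x) = cosz (Re z) x * R (f' a 0) - Re z * sinz (Re z) x * R (f a 0)"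
    if "a \<in> ?A" "x \<in> {0..L a}" for a x
    using real_part_ode[OF R(1) real d1[OF that(1)] d2[OF that(1)] that(2)] by blast+
  have Fa: "R (f a 0) = F (fst a)" if "a \<in> ?A" for a using cf[OF that] by (simp add: F_def)
  have edge: "F (snd a) = cosz (Re z) (L a) * F (fst a) + sinz (Re z) (L a) * D a"
    "D (flip a) = Re z * sinz (Re z) (L a) * F (fst a) - cosz (Re z) (L a) * D a" if a: "a \<in> ?A" for a
  proof -
    have l: "L a \<in> {0..L a}" using Lpos(1)[OF a] by simp
    have "F (snd a) = R (f a (L a))" using rev(1)[OF a] Fa[OF flip_A[OF a]] by simp
    then show "F (snd a) = cosz (Re z) (L a) * F (fst a) + sinz (Re z) (L a) * D a"
      using sol(1)[OF a l] Fa[OF a] by (simp add: D_def)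
    have "D (flip a) = - R (f' a (L a))" using rev(2)[OF a] by (simp add: D_def linear_neg[OF lin])
    then show "D (flip a) = Re z * sinz (Re z) (L a) * F (fst a) - cosz (Re z) (L a) * D a"
      using sol(2)[OF a l] Fa[OF a] by (simp add: D_def)
  qed
  have vertex: "if \<alpha> v = \<infinity> then F v = 0 else (\<Sum>w\<in>neighbours T v. D (v, w)) = real_of_ereal (\<alpha> v) * F v"
    if v: "v \<in> pverts T" for v
  proof (cases "\<alpha> v = \<infinity>")
    case True
    then show ?thesis using kirch[OF v] by (simp add: F_def linear_0[OF lin])
  next
    case False
    have "(\<Sum>w\<in>neighbours T v. D (v, w)) = R (\<Sum>w\<in>neighbours T v. f' (v, w) 0)"
      by (simp add: D_def linear_sum[OF lin])
    also have "\<dots> = R (real_of_ereal (\<alpha> v) *\<^sub>R c v)"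
      using kirch[OF v] False by (simp add: scaleR_conv_of_real)
    also have "\<dots> = real_of_ereal (\<alpha> v) * F v" by (simp add: F_def linear_scale[OF lin])
    finally show ?thesis using False by simp
  qed
  have summable: "(\<lambda>a. (F (fst a))\<^sup>2 + (D a)\<^sup>2) summable_on ?A"
  proof (rule summable_on_comparison_test[OF sumQ])
    fix a assume a: "a \<in> ?A"
    have sq: "(R w)\<^sup>2 \<le> (cmod w)\<^sup>2" for w using R(3)[of w] by (metis abs_ge_zero power2_abs power_mono)
    show "(F (fst a))\<^sup>2 + (D a)\<^sup>2 \<le> Q a"
      unfolding Q_def Fa[OF a, symmetric] D_def by (intro add_mono sq)
  qed simp
  have "(F (fst a0))\<^sup>2 + (D a0)\<^sup>2 \<noteq> 0"
  proof
    assume "(F (fst a0))\<^sup>2 + (D a0)\<^sup>2 = 0"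
    then have "F (fst a0) = 0" "D a0 = 0" by (simp_all add: sum_power2_eq_zero_iff)
    then have "R (f a0 x0) = 0" using sol(1)[OF a0(1,2)] Fa[OF a0(1)] by (simp add: D_def)
    then show False using R(2) by simp
  qed
  then show ?thesis
    using real edge vertex summable a0(1) unfolding L_def by blast
qed

section \<open>Square summable solutions on the covering tree\<close>

lemma sum_UN_le:
  fixes h :: "'b \<Rightarrow> real"
  assumes "finite I" "\<And>i. i \<in> I \<Longrightarrow> finite (A i)" "\<And>i x. i \<in> I \<Longrightarrow> x \<in> A i \<Longrightarrow> 0 \<le> h x"
  shows "sum h (\<Union>i\<in>I. A i) \<le> (\<Sum>i\<in>I. sum h (A i))"
  using assms
proof (induction I rule: finite_induct)
  case (insert i I)
  have "sum h (\<Union>j\<in>insert i I. A j) \<le> sum h (A i) + sum h (\<Union>j\<in>I. A j)"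
    using insert.prems insert.hyps
    by (subst UN_insert, subst sum_Un) (auto intro!: sum_nonneg)
  also have "sum h (\<Union>j\<in>I. A j) \<le> (\<Sum>j\<in>I. sum h (A j))"
    by (rule insert.IH) (use insert.prems in auto)
  finally show ?case using insert.hyps by simp
qed simp

text \<open>\<open>NG\<close> gives the neighbourhoods in the base graph. The transfer coefficients
  \<open>C\<close> and \<open>S\<close> are indexed by base arcs, so arcs over the same base arc
  have the same transfer matrix. \<open>f\<close> holds vertex values, \<open>p\<close> outgoing
  slopes, and \<open>Dir\<close> is the set of Dirichlet vertices.\<close>

locale tree_solution = arc_tree A
  for A :: "('t \<times> 't) set" +
  fixes V :: "'t set" and NG :: "'v \<Rightarrow> 'v set" and \<Xi> :: "'t \<Rightarrow> 'v"
    and C S :: "'v \<times> 'v \<Rightarrow> real" and z :: real and \<beta> :: "'v \<Rightarrow> real" and Dir :: "'v set"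
    and f :: "'t \<Rightarrow> real" and p :: "'t \<times> 't \<Rightarrow> real"
  assumes A_V: "A \<subseteq> V \<times> V"
    and covering: "x \<in> V \<Longrightarrow> bij_betw \<Xi> (A `` {x}) (NG (\<Xi> x))"
    and finite_fibres: "finite (map_prod \<Xi> \<Xi> ` A)"
    and no_loop: "(x, y) \<in> A \<Longrightarrow> \<Xi> x \<noteq> \<Xi> y"
    and connected: "x \<in> V \<Longrightarrow> y \<in> V \<Longrightarrow> (x, y) \<in> A\<^sup>*"
    and infinite_A: "infinite A"
    and pythagoras: "a \<in> A \<Longrightarrow> (C (map_prod \<Xi> \<Xi> a))\<^sup>2 + z * (S (map_prod \<Xi> \<Xi> a))\<^sup>2 = 1"
    and edge_f: "a \<in> A \<Longrightarrow> f (snd a) = C (map_prod \<Xi> \<Xi> a) * f (fst a) + S (map_prod \<Xi> \<Xi> a) * p a"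
    and edge_p: "a \<in> A \<Longrightarrow> p (flip a) = z * S (map_prod \<Xi> \<Xi> a) * f (fst a) - C (map_prod \<Xi> \<Xi> a) * p a"
    and kirchhoff: "x \<in> V \<Longrightarrow> \<Xi> x \<notin> Dir \<Longrightarrow> (\<Sum>y\<in>A `` {x}. p (x, y)) = \<beta> (\<Xi> x) * f x"
    and dirichlet: "x \<in> V \<Longrightarrow> \<Xi> x \<in> Dir \<Longrightarrow> f x = 0"
    and dirichlet_leaf: "x \<in> V \<Longrightarrow> \<Xi> x \<in> Dir \<Longrightarrow> card (A `` {x}) = 1"
    and summable: "(\<lambda>a. (f (fst a))\<^sup>2 + (p a)\<^sup>2) summable_on A"
begin

abbreviation P :: "'t \<times> 't \<Rightarrow> 'v \<times> 'v" where
  "P \<equiv> map_prod \<Xi> \<Xi>"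

definition q :: "'t \<times> 't \<Rightarrow> real" where
  "q a = (f (fst a))\<^sup>2 + (p a)\<^sup>2"

definition outs :: "'t \<Rightarrow> ('t \<times> 't) set" where
  "outs x = Pair x ` (A `` {x})"

lemma q_nonneg: "0 \<le> q a"
  by (simp add: q_def)

lemma q_eq_0_iff: "q a = 0 \<longleftrightarrow> f (fst a) = 0 \<and> p a = 0"
  by (simp add: q_def sum_power2_eq_zero_iff)

lemma q_summable: "q summable_on A"
  using summable by (simp add: q_def[abs_def])

lemma outs_iff: "b \<in> outs x \<longleftrightarrow> b \<in> A \<and> fst b = x"
  by (cases b) (auto simp: outs_def)

lemma finite_outs: "finite (outs x)"
  by (simp add: outs_def finite_out)

lemma flip_A: "a \<in> A \<Longrightarrow> flip a \<in> A"
  by (cases a) (auto intro: A_sym)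

lemma fst_V: "a \<in> A \<Longrightarrow> fst a \<in> V" and snd_V: "a \<in> A \<Longrightarrow> snd a \<in> V"
  using A_V by auto

lemma P_flip: "P (flip a) = flip (P a)"
  by (simp add: flip_def)

lemma flip_image_P:
  assumes "a \<in> P ` K" "\<And>b. b \<in> K \<Longrightarrow> flip b \<in> K"
  shows "flip a \<in> P ` K"
proof -
  obtain b where "a = P b" "b \<in> K" using assms(1) by (rule imageE)
  then have "flip a = P (flip b)" "flip b \<in> K" using assms(2) by (simp_all only: P_flip)
  then show ?thesis by (rule image_eqI)
qed

lemma nexts_outs: "a \<in> A \<Longrightarrow> nexts a = outs (snd a) - {flip a}"
  by (auto simp: nexts_def outs_iff flip_def prod_eq_iff)

lemma sum_outs: "(\<Sum>y\<in>A `` {x}. h (x, y)) = sum h (outs x)"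
  unfolding outs_def by (subst sum.reindex) (auto simp: inj_on_def o_def)

lemma bij_P: "x \<in> V \<Longrightarrow> bij_betw P (outs x) (Pair (\<Xi> x) ` NG (\<Xi> x))"
  using covering[of x] by (auto simp: bij_betw_def inj_on_def outs_def image_image)

lemma outs_P_inj: "a \<in> outs x \<Longrightarrow> b \<in> outs x \<Longrightarrow> P a = P b \<Longrightarrow> a = b"
  using bij_P[of x] fst_V[of a] by (auto simp: bij_betw_def outs_iff dest: inj_onD)

text \<open>The arc out of \<open>x\<close> over the same base arc as \<open>b\<close>, meant for
  \<open>b\<close> starting in the fibre of \<open>x\<close>. It matches two branches of the tree
  arc by arc.\<close>

definition shift :: "'t \<Rightarrow> 't \<times> 't \<Rightarrow> 't \<times> 't" where
  "shift x b = inv_into (outs x) P (P b)"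

lemma shift_bij:
  assumes "x \<in> V" "x' \<in> V" "\<Xi> x = \<Xi> x'"
  shows "bij_betw (shift x') (outs x) (outs x')"
proof -
  have "bij_betw (inv_into (outs x') P \<circ> P) (outs x) (outs x')"
    by (rule bij_betw_trans[OF bij_P[OF assms(1)]])
      (use bij_betw_inv_into[OF bij_P[OF assms(2)]] assms(3) in simp)
  then show ?thesis by (simp add: shift_def[abs_def] o_def)
qed

lemma shift_P:
  assumes "x' \<in> V" "b \<in> A" "\<Xi> (fst b) = \<Xi> x'"
  shows "shift x' b \<in> outs x'" "P (shift x' b) = P b"
proof -
  have "P b \<in> P ` outs (fst b)" using assms(2) by (auto simp: outs_iff)
  then have "P b \<in> P ` outs x'"
    using bij_P[OF assms(1)] bij_P[OF fst_V[OF assms(2)]] assms(3) by (simp add: bij_betw_def)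
  then show "shift x' b \<in> outs x'" "P (shift x' b) = P b"
    unfolding shift_def by (rule inv_into_into, rule f_inv_into_f)
qed

lemma shift_eq:
  assumes "b \<in> A" "b' \<in> A" "P b = P b'"
  shows "shift (fst b') b = b'"
proof (rule outs_P_inj)
  have "\<Xi> (fst b) = \<Xi> (fst b')" using assms(3) by (metis fst_map_prod)
  from shift_P[OF fst_V[OF assms(2)] assms(1) this] assms
  show "shift (fst b') b \<in> outs (fst b')" "P (shift (fst b') b) = P b'" by auto
qed (use assms in \<open>simp add: outs_iff\<close>)

subsection \<open>Proportionality of square summable solutions\<close>

definition wronskian :: "'t \<times> 't \<Rightarrow> 't \<times> 't \<Rightarrow> real" where
  "wronskian a a' = f (fst a) * p a' - f (fst a') * p a"

text \<open>The transfer matrix has determinant 1; the sign arises because slopes are outgoing at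
  both ends.\<close>

lemma wronskian_flip:
  assumes "a \<in> A" "a' \<in> A" "P a = P a'"
  shows "wronskian (flip a) (flip a') = - wronskian a a'"
proof -
  let ?c = "C (P a)" and ?s = "S (P a)"
  have "wronskian (flip a) (flip a')
      = (?c * f (fst a) + ?s * p a) * (z * ?s * f (fst a') - ?c * p a')
        - (?c * f (fst a') + ?s * p a') * (z * ?s * f (fst a) - ?c * p a)"
    using edge_f[OF assms(1)] edge_f[OF assms(2)] edge_p[OF assms(1)] edge_p[OF assms(2)]
    by (simp add: wronskian_def assms(3))
  also have "\<dots> = - (?c\<^sup>2 + z * ?s\<^sup>2) * wronskian a a'"
    unfolding wronskian_def by algebra
  finally show ?thesis using pythagoras[OF assms(1)] by simp
qed

lemma wronskian_sum_outs:
  assumes "x \<in> V" "x' \<in> V" "\<Xi> x = \<Xi> x'"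
  shows "(\<Sum>b\<in>outs x. wronskian b (shift x' b)) = 0"
proof -
  have *: "b \<in> outs x \<Longrightarrow> fst b = x \<and> fst (shift x' b) = x'" for b
    using shift_P(1)[OF assms(2), of b] assms(3) by (auto simp: outs_iff)
  have "(\<Sum>b\<in>outs x. wronskian b (shift x' b)) = f x * (\<Sum>b\<in>outs x. p (shift x' b)) - f x' * sum p (outs x)"
    unfolding wronskian_def using * by (simp add: sum_subtractf sum_distrib_left)
  also have "(\<Sum>b\<in>outs x. p (shift x' b)) = sum p (outs x')"
    by (rule sum.reindex_bij_betw[OF shift_bij[OF assms]])
  also have "f x * sum p (outs x') - f x' * sum p (outs x) = 0"
    using kirchhoff[OF assms(1)] kirchhoff[OF assms(2)] dirichlet[OF assms(1)] dirichlet[OF assms(2)] assms(3)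
    by (cases "\<Xi> x \<in> Dir") (auto simp: sum_outs)
  finally show ?thesis .
qed

lemma shift_bij_nexts:
  assumes "a \<in> A" "a' \<in> A" "P a = P a'"
  shows "bij_betw (shift (snd a')) (nexts a) (nexts a')"
proof -
  have eq: "\<Xi> (snd a) = \<Xi> (snd a')" using assms(3) by (metis snd_map_prod)
  have "shift (snd a') (flip a) = flip a'"
    using shift_eq[OF flip_A[OF assms(1)] flip_A[OF assms(2)]] assms(3) by (simp add: P_flip)
  note bij = shift_bij[OF snd_V[OF assms(1)] snd_V[OF assms(2)] eq]
  have "flip a \<in> outs (snd a)" using flip_A[OF assms(1)] by (simp add: outs_iff)
  then have "shift (snd a') ` (outs (snd a) - {flip a}) = outs (snd a') - {flip a'}"
    using inj_on_image_set_diff[OF bij_betw_imp_inj_on[OF bij], of "outs (snd a)" "{flip a}"]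
      bij_betw_imp_surj_on[OF bij] \<open>shift (snd a') (flip a) = flip a'\<close> by simp
  then have "bij_betw (shift (snd a')) (outs (snd a) - {flip a}) (outs (snd a') - {flip a'})"
    by (rule bij_betw_subset[OF bij Diff_subset])
  then show ?thesis by (simp add: nexts_outs assms)
qed

text \<open>Conservation: the two end vertices lie in one fibre and obey the same condition, so the
  Wronskians around them sum to zero. What arrives through the arc leaves through its
  continuations.\<close>

lemma wronskian_nexts:
  assumes "a \<in> A" "a' \<in> A" "P a = P a'"
  shows "wronskian a a' = (\<Sum>b\<in>nexts a. wronskian b (shift (snd a') b))"
proof -
  have eq: "\<Xi> (snd a) = \<Xi> (snd a')" using assms(3) by (metis snd_map_prod)
  have "shift (snd a') (flip a) = flip a'"
    using shift_eq[OF flip_A[OF assms(1)] flip_A[OF assms(2)]] assms(3) by (simp add: P_flip)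
  moreover have "flip a \<in> outs (snd a)" using flip_A[OF assms(1)] by (simp add: outs_iff)
  moreover note wronskian_sum_outs[OF snd_V[OF assms(1)] snd_V[OF assms(2)] eq]
  ultimately have "wronskian (flip a) (flip a') + (\<Sum>b\<in>nexts a. wronskian b (shift (snd a') b)) = 0"
    using sum.remove[OF finite_outs, of "flip a" "snd a" "\<lambda>b. wronskian b (shift (snd a') b)"]
    by (simp add: nexts_outs assms)
  then show ?thesis using wronskian_flip[OF assms] by simp
qed

text \<open>Conservation is pushed through n layers of two branches of the same shape, and the last
  layer is estimated by |xy| <= (x^2 + y^2) / 2.\<close>

lemma wronskian_le_level:
  assumes "a \<in> A" "a' \<in> A" "P a = P a'"
  shows "\<bar>wronskian a a'\<bar> \<le> level q n a + level q n a'"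
  using assms
proof (induction n arbitrary: a a')
  case 0
  have "\<bar>x * y\<bar> \<le> (x\<^sup>2 + y\<^sup>2) / 2" for x y :: real
  proof -
    have "0 \<le> (\<bar>x\<bar> - \<bar>y\<bar>)\<^sup>2" by simp
    then show ?thesis by (simp add: power2_diff abs_mult)
  qed
  then have "\<bar>f (fst a) * p a'\<bar> \<le> ((f (fst a))\<^sup>2 + (p a')\<^sup>2) / 2" "\<bar>f (fst a') * p a\<bar> \<le> ((f (fst a'))\<^sup>2 + (p a)\<^sup>2) / 2"
    by blast+
  moreover have "0 \<le> (f (fst a))\<^sup>2" "0 \<le> (p a')\<^sup>2" "0 \<le> (f (fst a'))\<^sup>2" "0 \<le> (p a)\<^sup>2" by auto
  ultimately show ?case by (simp add: wronskian_def q_def)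
next
  case (Suc n)
  have eq: "\<Xi> (snd a) = \<Xi> (snd a')" using Suc.prems by (metis snd_map_prod)
  have "\<bar>wronskian a a'\<bar> \<le> (\<Sum>b\<in>nexts a. \<bar>wronskian b (shift (snd a') b)\<bar>)"
    unfolding wronskian_nexts[OF Suc.prems] by (rule sum_abs)
  also have "\<dots> \<le> (\<Sum>b\<in>nexts a. level q n b + level q n (shift (snd a') b))"
  proof (rule sum_mono)
    fix b assume "b \<in> nexts a"
    then have b: "b \<in> A" "fst b = snd a" by (auto simp: nexts_def)
    from shift_P[OF snd_V[OF Suc.prems(2)] b(1)] eq b
    show "\<bar>wronskian b (shift (snd a') b)\<bar> \<le> level q n b + level q n (shift (snd a') b)"
      by (intro Suc.IH) (auto simp: outs_iff)
  qed
  also have "\<dots> = level q (Suc n) a + level q (Suc n) a'"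
    by (simp add: sum.distrib sum.reindex_bij_betw[OF shift_bij_nexts[OF Suc.prems]])
  finally show ?case .
qed

text \<open>The bound by layers holds for every n, and layers are terms of a convergent series, so
  they tend to 0.\<close>

lemma wronskian_0:
  assumes "a \<in> A" "a' \<in> A" "P a = P a'"
  shows "wronskian a a' = 0"
proof -
  have s: "(\<lambda>n. level q n b) \<longlonglongrightarrow> 0" if "b \<in> A" for b
    by (rule summable_LIMSEQ_zero) (rule summable_level[OF that q_summable q_nonneg])
  have "(\<lambda>n. level q n a + level q n a') \<longlonglongrightarrow> 0 + 0"
    by (intro tendsto_add s assms)
  then have "\<bar>wronskian a a'\<bar> \<le> 0 + 0"
    by (rule LIMSEQ_le_const) (use wronskian_le_level[OF assms] in blast)
  then show ?thesis by simp
qed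

definition scaled :: "real \<Rightarrow> 't \<times> 't \<Rightarrow> 't \<times> 't \<Rightarrow> bool" where
  "scaled c a a' \<longleftrightarrow> c \<noteq> 0 \<and> a \<in> A \<and> a' \<in> A \<and> P a = P a' \<and> f (fst a') = c * f (fst a) \<and> p a' = c * p a"

lemma scaled_flip:
  assumes "scaled c a a'"
  shows "scaled c (flip a) (flip a')"
proof -
  have a: "a \<in> A" "a' \<in> A" "P a' = P a" "c \<noteq> 0" and fp: "f (fst a') = c * f (fst a)" "p a' = c * p a"
    using assms by (auto simp: scaled_def)
  have "f (snd a') = c * f (snd a)"
    unfolding edge_f[OF a(1)] edge_f[OF a(2)] a(3) fp by (simp add: algebra_simps)
  moreover have "p (flip a') = c * p (flip a)"
    unfolding edge_p[OF a(1)] edge_p[OF a(2)] a(3) fp by (simp add: algebra_simps)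
  ultimately show ?thesis
    unfolding scaled_def P_flip using a flip_A by auto
qed

lemma scaled_inverse: "scaled c a a' \<Longrightarrow> scaled (1 / c) a' a"
  by (auto simp: scaled_def)

lemma scaled_q: "scaled c a a' \<Longrightarrow> q a' = c\<^sup>2 * q a"
  by (simp add: scaled_def q_def power_mult_distrib algebra_simps)

text \<open>The Wronskian is the determinant of two nonzero vectors (value, slope); as it vanishes,
  they are proportional.\<close>

lemma ex_scaled:
  assumes "a \<in> A" "a' \<in> A" "P a = P a'" "q a \<noteq> 0" "q a' \<noteq> 0"
  shows "\<exists>c. scaled c a a'"
proof -
  have W: "f (fst a) * p a' = f (fst a') * p a" using wronskian_0[OF assms(1-3)] by (simp add: wronskian_def)
  show ?thesis
  proof (cases "f (fst a) = 0")
    case True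
    then have "p a \<noteq> 0" "f (fst a') = 0" using assms(4) W by (auto simp: q_eq_0_iff)
    moreover have "p a' \<noteq> 0" using assms(5) \<open>f (fst a') = 0\<close> by (auto simp: q_eq_0_iff)
    ultimately have "scaled (p a' / p a) a a'" using True assms by (auto simp: scaled_def)
    then show ?thesis ..
  next
    case False
    then have "p a' = f (fst a') / f (fst a) * p a" using W by (simp add: field_simps)
    moreover from this have "f (fst a') \<noteq> 0" using assms(5) by (auto simp: q_eq_0_iff)
    ultimately have "scaled (f (fst a') / f (fst a)) a a'" using False assms by (auto simp: scaled_def)
    then show ?thesis ..
  qed
qed

subsection \<open>Components of the support\<close>

text \<open>
  Arcs \<open>a\<close> with \<open>q a \<noteq> 0\<close> form the support of the solution; \<open>step\<close> connects arcs of the support that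
  can be reached from each other without passing through a zero of \<open>f\<close> at a vertex. The shape of
  a component depends only on the projection of one of its arcs (lemma \<open>transport\<close>).
\<close>

definition step :: "(('t \<times> 't) \<times> ('t \<times> 't)) set" where
  "step = {(a, b). a \<in> A \<and> (b = flip a \<or> b \<in> outs (snd a) \<and> f (snd a) \<noteq> 0)}"

lemma step_A: "(a, b) \<in> step \<Longrightarrow> a \<in> A \<and> b \<in> A"
  by (auto simp: step_def outs_iff flip_A)

lemma steps_A: "(a, b) \<in> step\<^sup>* \<Longrightarrow> a \<in> A \<Longrightarrow> b \<in> A"
  by (induction rule: rtrancl_induct) (auto dest: step_A)

lemma step_flip: "a \<in> A \<Longrightarrow> (a, flip a) \<in> step"
  by (simp add: step_def)

text \<open>A step from b to c across a vertex is undone by the path c, flip c, flip b, b.\<close>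

lemma steps_sym: "(a, b) \<in> step\<^sup>* \<Longrightarrow> (b, a) \<in> step\<^sup>*"
proof (induction rule: rtrancl_induct)
  case (step b c)
  have "(c, b) \<in> step\<^sup>*"
  proof (cases "c = flip b")
    case True
    then show ?thesis using step_flip[of c] step_A[OF step(2)] by auto
  next
    case False
    then have c: "c \<in> A" "fst c = snd b" "f (snd b) \<noteq> 0" "b \<in> A" using step(2) by (auto simp: step_def outs_iff)
    then have "(c, flip c) \<in> step" "(flip c, flip b) \<in> step" "(flip b, b) \<in> step"
      using flip_A[of b] flip_A[of c] step_flip[of "flip b"] by (auto simp: step_def outs_iff)
    then show ?thesis by (meson converse_rtrancl_into_rtrancl rtrancl.rtrancl_refl)
  qed
  then show ?case using step.IH by (rule rtrancl_trans)
qed simp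

lemma q_flip:
  assumes "a \<in> A" "q a \<noteq> 0"
  shows "q (flip a) \<noteq> 0"
proof
  assume "q (flip a) = 0"
  moreover have "f (fst a) = C (P (flip a)) * f (fst (flip a)) + S (P (flip a)) * p (flip a)"
    "p a = z * S (P (flip a)) * f (fst (flip a)) - C (P (flip a)) * p (flip a)"
    using edge_f[OF flip_A[OF assms(1)]] edge_p[OF flip_A[OF assms(1)]] by simp_all
  ultimately show False using assms(2) by (simp add: q_eq_0_iff)
qed

lemma steps_q: "(a, b) \<in> step\<^sup>* \<Longrightarrow> q a \<noteq> 0 \<Longrightarrow> q b \<noteq> 0"
proof (induction rule: rtrancl_induct)
  case (step b c)
  then show ?case using q_flip[of b] by (auto simp: step_def outs_iff q_eq_0_iff)
qed

text \<open>Across a vertex where \<open>f\<close> is nonzero the values already have ratio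
  \<open>c\<close>, and the vanishing Wronskian extends this ratio to the slopes of all outgoing
  arcs.\<close>

lemma transport:
  assumes "(a, b) \<in> step\<^sup>*" "scaled c a a'"
  shows "\<exists>b'. (a', b') \<in> step\<^sup>* \<and> scaled c b b'"
  using assms
proof (induction rule: rtrancl_induct)
  case base
  then show ?case by blast
next
  case (step b d)
  then obtain b' where b': "(a', b') \<in> step\<^sup>*" "scaled c b b'" by blast
  then have A: "b \<in> A" "b' \<in> A" "P b = P b'" "c \<noteq> 0" by (auto simp: scaled_def)
  show ?case
  proof (cases "d = flip b")
    case True
    then show ?thesis using b' A scaled_flip step_flip by (meson rtrancl.rtrancl_into_rtrancl)
  next
    case False
    then have d: "d \<in> A" "fst d = snd b" "f (snd b) \<noteq> 0" using step(2) by (auto simp: step_def outs_iff)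
    have fb: "f (snd b') = c * f (snd b)" using scaled_flip[OF b'(2)] by (simp add: scaled_def)
    let ?d = "shift (snd b') d"
    have "\<Xi> (fst d) = \<Xi> (snd b')" using A(3) d(2) by (metis snd_map_prod)
    from shift_P[OF snd_V[OF A(2)] d(1) this] have d': "?d \<in> A" "fst ?d = snd b'" "P ?d = P d"
      by (auto simp: outs_iff)
    have "f (snd b) * p ?d = f (snd b') * p d"
      using wronskian_0[OF d(1) d'(1)] d' d by (simp add: wronskian_def)
    then have "scaled c d ?d" using d d' fb A by (simp add: scaled_def)
    moreover have "(b', ?d) \<in> step" using d' A fb d(3) by (simp add: step_def outs_iff)
    ultimately show ?thesis using b' by (meson rtrancl.rtrancl_into_rtrancl)
  qed
qed

lemma q_le: "a \<in> A \<Longrightarrow> q a \<le> infsum q A"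
  using finite_sum_le_infsum[OF q_summable, of "{a}"] q_nonneg by simp

section \<open>Self-maps of a component and their scaling factors\<close>

lemma scaled_power:
  assumes "(a, b) \<in> step\<^sup>*" "scaled c a b"
  shows "\<exists>b. scaled (c ^ n) a b"
proof (induction n)
  case 0
  show ?case by (rule exI[of _ a]) (use assms(2) in \<open>simp add: scaled_def\<close>)
next
  case (Suc n)
  then obtain d where "scaled (c ^ n) a d" by blast
  from transport[OF assms(1) this] obtain e where "scaled (c ^ n) b e" by blast
  then have "scaled (c ^ Suc n) a e" using assms(2) by (auto simp: scaled_def)
  then show ?case ..
qed

lemma scale_le_1:
  assumes "(a, b) \<in> step\<^sup>*" "scaled c a b" "q a \<noteq> 0"
  shows "\<bar>c\<bar> \<le> 1"
proof (rule ccontr)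
  assume "\<not> \<bar>c\<bar> \<le> 1"
  then have "1 < c\<^sup>2" using abs_square_le_1 linorder_not_le by blast
  then obtain n where n: "infsum q A / q a < (c\<^sup>2) ^ n" using real_arch_pow by blast
  obtain d where d: "scaled (c ^ n) a d" using scaled_power[OF assms(1,2)] by blast
  have "q d \<le> infsum q A" by (rule q_le) (use d in \<open>simp add: scaled_def\<close>)
  moreover have "q d = (c\<^sup>2) ^ n * q a" using scaled_q[OF d] by (simp add: mult.commute flip: power_mult)
  ultimately show False using n assms(3) q_nonneg[of a] by (simp add: divide_less_eq)
qed

lemma scale_abs_1:
  assumes "(a, b) \<in> step\<^sup>*" "scaled c a b" "q a \<noteq> 0"
  shows "\<bar>c\<bar> = 1"
proof -
  have "\<bar>1 / c\<bar> \<le> 1"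
    by (rule scale_le_1[OF steps_sym[OF assms(1)] scaled_inverse[OF assms(2)] steps_q[OF assms(1,3)]])
  moreover have "c \<noteq> 0" using assms(2) by (simp add: scaled_def)
  ultimately show ?thesis using scale_le_1[OF assms] by (simp add: field_simps)
qed

text \<open>
  Transporting an arc of a component to another arc of the same fibre can be iterated; since \<open>q\<close> is
  bounded, the scaling factor has absolute value one.
\<close>

lemma component_q_eq:
  assumes "(a, b) \<in> step\<^sup>*" "P a = P b" "a \<in> A" "q a \<noteq> 0"
  shows "q a = q b" "\<exists>c. \<bar>c\<bar> = 1 \<and> scaled c a b"
proof -
  obtain c where c: "scaled c a b"
    using ex_scaled[OF assms(3) steps_A[OF assms(1,3)] assms(2,4) steps_q[OF assms(1,4)]] by blast
  with scale_abs_1[OF assms(1) c assms(4)] show "\<exists>c. \<bar>c\<bar> = 1 \<and> scaled c a b" by blast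
  have "c\<^sup>2 = 1" using scale_abs_1[OF assms(1) c assms(4)] by (metis power2_abs power_one)
  then show "q a = q b" using scaled_q[OF c] by simp
qed

text \<open>Without such a zero one component fills the tree, since Dirichlet vertices are leaves
  and block nothing. By \<open>component_q_eq\<close> the energy then depends only on the base arc,
  so it has a positive minimum, which contradicts summability over infinitely many arcs.\<close>

lemma ex_node:
  assumes a0: "a0 \<in> A" "q a0 \<noteq> 0"
  shows "\<exists>a\<in>A. q a \<noteq> 0 \<and> f (fst a) = 0 \<and> \<Xi> (fst a) \<notin> Dir"
proof (rule ccontr)
  assume none: "\<not> ?thesis"
  let ?R = "step\<^sup>* `` {a0}"
  have RA: "b \<in> A \<and> q b \<noteq> 0" if "b \<in> ?R" for b using that steps_A steps_q a0 by auto
  have outs: "outs (fst b) \<subseteq> ?R" if b: "b \<in> ?R" for b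
  proof
    fix c assume c: "c \<in> outs (fst b)"
    show "c \<in> ?R"
    proof (cases "f (fst b) = 0")
      case False
      have "(b, flip b) \<in> step" "(flip b, c) \<in> step"
        using RA[OF b] flip_A[of b] c False by (auto simp: step_def)
      then show ?thesis using b by (auto intro: rtrancl.rtrancl_into_rtrancl)
    next
      case True
      \<comment> \<open>By \<open>none\<close> this zero is a Dirichlet vertex, hence a leaf, and
        its only outgoing arc is \<open>b\<close> itself.\<close>
      then have "card (A `` {fst b}) = 1" using none RA[OF b] dirichlet_leaf fst_V by blast
      then have "card (outs (fst b)) = 1" by (simp add: outs_def card_image inj_on_def)
      then obtain d where "outs (fst b) = {d}" by (auto simp: card_1_singleton_iff)
      moreover have "b \<in> outs (fst b)" using RA[OF b] by (simp add: outs_iff)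
      ultimately have "c = b" using c by simp
      then show ?thesis using b by simp
    qed
  qed
  have outs': "outs x \<subseteq> ?R" if "(fst a0, x) \<in> A\<^sup>*" for x
    using that
  proof (induction rule: rtrancl_induct)
    case base
    show ?case using outs[of a0] by simp
  next
    case (step x y)
    then have "(x, y) \<in> outs x" by (simp add: outs_iff)
    then have "(x, y) \<in> ?R" using step.IH by blast
    then have "(y, x) \<in> ?R" using step_flip[of "(x, y)"] step(2) by (auto intro: rtrancl.rtrancl_into_rtrancl)
    then show ?case using outs[of "(y, x)"] by simp
  qed
  have A_R: "A \<subseteq> ?R"
  proof
    fix b assume b: "b \<in> A"
    have "outs (fst b) \<subseteq> ?R"
      by (rule outs', rule connected[OF fst_V[OF a0(1)] fst_V[OF b]])
    then show "b \<in> ?R" using b by (auto simp: outs_iff)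
  qed
  define g where "g v = q (SOME b. b \<in> A \<and> P b = v)" for v
  have g: "q a = g (P a) \<and> 0 < g (P a)" if "a \<in> A" for a
  proof -
    let ?b = "SOME b. b \<in> A \<and> P b = P a"
    have b: "?b \<in> A \<and> P ?b = P a" by (rule someI[of _ a]) (use that in simp)
    have "(?b, a) \<in> step\<^sup>*" using A_R b that steps_sym by (meson Image_singleton_iff rtrancl_trans subsetD)
    moreover have "q ?b \<noteq> 0" using RA[of ?b] b A_R by blast
    ultimately have "q ?b = q a" using b by (intro component_q_eq(1)) simp_all
    moreover have "q a \<noteq> 0" using RA A_R that by blast
    ultimately show ?thesis using q_nonneg[of a] by (simp add: g_def)
  qed
  let ?m = "Min (g ` P ` A)"
  have fin: "finite (g ` P ` A)" "g ` P ` A \<noteq> {}" using finite_fibres a0 by auto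
  then have m: "0 < ?m" using g by auto
  have mq: "?m \<le> q a" if "a \<in> A" for a using g[OF that] fin that by simp
  obtain n :: nat where n: "infsum q A / ?m < real n" using reals_Archimedean2 by blast
  obtain F where F: "finite F" "card F = n" "F \<subseteq> A" using infinite_arbitrarily_large[OF infinite_A] by blast
  have "real n * ?m = (\<Sum>a\<in>F. ?m)" using F by simp
  also have "\<dots> \<le> sum q F" by (rule sum_mono) (use F mq in blast)
  also have "\<dots> \<le> infsum q A" by (rule finite_sum_le_infsum) (use F q_summable q_nonneg in auto)
  finally show False using n m by (simp add: divide_less_eq)
qed

text \<open>If f x were nonzero, the arc at x over P a would carry nonzero data and be a nonzero
  multiple of \<open>a\<close>, whose starting value is 0.\<close>

lemma node_fibre:
  assumes "a \<in> A" "q a \<noteq> 0" "f (fst a) = 0" "x \<in> V" "\<Xi> x = \<Xi> (fst a)"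
  shows "f x = 0"
proof (rule ccontr)
  assume f: "f x \<noteq> 0"
  from shift_P[OF assms(4,1)] assms(5) have b: "shift x a \<in> A" "fst (shift x a) = x" "P (shift x a) = P a"
    by (auto simp: outs_iff)
  then have "q (shift x a) \<noteq> 0" using f by (simp add: q_eq_0_iff)
  then obtain c where "scaled c a (shift x a)" using ex_scaled[of a "shift x a"] b assms by metis
  then show False using f b assms(3) by (simp add: scaled_def)
qed


subsection \<open>Projection of a component to the base graph\<close>

lemma component_outs:
  assumes "b \<in> step\<^sup>* `` {a0}" "a0 \<in> A" "f (fst b) \<noteq> 0"
  shows "outs (fst b) \<subseteq> step\<^sup>* `` {a0}"
proof
  fix c assume "c \<in> outs (fst b)"
  then have "(b, flip b) \<in> step" "(flip b, c) \<in> step"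
    using assms steps_A[of a0 b] flip_A[of b] by (auto simp: step_def)
  then show "c \<in> step\<^sup>* `` {a0}" using assms(1) by (auto intro: rtrancl.rtrancl_into_rtrancl)
qed

text \<open>Two lifts of a base arc inside one component differ by a factor of absolute value 1, so
  the component descends to the base graph up to signs.\<close>

lemma component_projection:
  assumes a0: "a0 \<in> A" "q a0 \<noteq> 0"
  defines "K \<equiv> step\<^sup>* `` {a0}"
  shows "\<exists>Y \<Sigma> F D.
    (\<forall>a\<in>P ` A. F (snd a) = (if a \<in> \<Sigma> then - 1 else 1) * (C a * F (fst a) + S a * D a) \<and>
       D (flip a) = (if a \<in> \<Sigma> then - 1 else 1) * (z * S a * F (fst a) - C a * D a)) \<and>
    Y \<subseteq> fst ` P ` A - Dir \<and> \<Sigma> \<subseteq> P ` A \<and>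
    (\<forall>v\<in>Y. (\<Sum>w\<in>NG v. D (v, w)) = \<beta> v * F v) \<and>
    (\<forall>v. v \<notin> Y \<longrightarrow> F v = 0) \<and>
    (\<forall>a. a \<notin> P ` K \<longrightarrow> D a = 0) \<and> (\<forall>a\<in>P ` A - P ` K. F (fst a) = 0) \<and>
    (\<forall>a\<in>P ` K. (F (fst a))\<^sup>2 + (D a)\<^sup>2 \<noteq> 0) \<and>
    (\<forall>b\<in>K. f (fst b) = 0 \<longrightarrow> \<Xi> (fst b) \<notin> Y)"
proof -
  have KA: "b \<in> A \<and> q b \<noteq> 0" if "b \<in> K" for b
    using that a0 steps_A steps_q by (auto simp: K_def)
  have K_flip: "flip b \<in> K" if "b \<in> K" for b
    using that KA[OF that] step_flip[of b] by (auto simp: K_def intro: rtrancl.rtrancl_into_rtrancl)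
  have K_K: "(b, c) \<in> step\<^sup>*" if "b \<in> K" "c \<in> K" for b c
    using that rtrancl_trans[OF steps_sym, of a0 b c] by (simp add: K_def)
  define Y where "Y = {\<Xi> (fst b) |b. b \<in> K \<and> f (fst b) \<noteq> 0}"
  define s where "s v = (SOME b. b \<in> K \<and> f (fst b) \<noteq> 0 \<and> \<Xi> (fst b) = v)" for v
  have s: "s v \<in> K \<and> f (fst (s v)) \<noteq> 0 \<and> \<Xi> (fst (s v)) = v" if "v \<in> Y" for v
    unfolding s_def by (rule someI_ex) (use that in \<open>auto simp: Y_def\<close>)
  have s_outs: "outs (fst (s v)) \<subseteq> K" if "v \<in> Y" for v
    using component_outs[of "s v" a0] s[OF that] a0 by (simp add: K_def)
  have P_outs: "a \<in> P ` outs (fst (s (fst a)))" if "a \<in> P ` A" "fst a \<in> Y" for a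
  proof -
    obtain b where b: "a = P b" "b \<in> A" using \<open>a \<in> P ` A\<close> by (rule imageE)
    let ?x = "fst (s (fst a))"
    have x: "?x \<in> V" using s[OF that(2)] KA fst_V by simp
    have "\<Xi> (fst b) = \<Xi> ?x" using s[OF that(2)] b(1) by simp
    note sh = shift_P[OF x b(2) this]
    have "P (shift ?x b) \<in> P ` outs ?x" using sh(1) by (rule imageI)
    then show ?thesis by (simp only: sh(2) b(1)[symmetric])
  qed
  \<comment> \<open>Over a vertex v of \<open>Y\<close> all outgoing arcs are lifted at the single
    vertex \<open>fst (s v)\<close>, so that its Kirchhoff condition carries over. At a zero any
    lift in \<open>K\<close> serves.\<close>
  define rep where "rep a = (if fst a \<in> Y then inv_into (outs (fst (s (fst a)))) P a else SOME b. b \<in> K \<and> P b = a)" for a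
  define F where "F v = (if v \<in> Y then f (fst (s v)) else 0)" for v
  define D where "D a = (if a \<in> P ` K then p (rep a) else 0)" for a
  have Y_K: "a \<in> P ` K" if "a \<in> P ` A" "fst a \<in> Y" for a
    using P_outs[OF that] s_outs[OF that(2)] by blast
  have PK_A: "P ` K \<subseteq> P ` A" using KA by blast
  have rep: "rep a \<in> K \<and> P (rep a) = a \<and> f (fst (rep a)) = F (fst a)" if a: "a \<in> P ` K" for a
  proof (cases "fst a \<in> Y")
    case True
    have "a \<in> P ` A" using a PK_A by (rule rev_subsetD)
    note m = P_outs[OF this True]
    have r: "rep a = inv_into (outs (fst (s (fst a)))) P a" unfolding rep_def by (rule if_P[OF True])
    have ro: "rep a \<in> outs (fst (s (fst a)))" unfolding r by (rule inv_into_into[OF m])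
    then have "fst (rep a) = fst (s (fst a))" by (simp add: outs_iff)
    moreover have "rep a \<in> K" using ro s_outs[OF True] by (rule rev_subsetD)
    moreover have "P (rep a) = a" unfolding r by (rule f_inv_into_f[OF m])
    ultimately show ?thesis using True by (simp add: F_def)
  next
    case False
    have r: "rep a = (SOME b. b \<in> K \<and> P b = a)" unfolding rep_def by (rule if_not_P[OF False])
    have "\<exists>b. b \<in> K \<and> P b = a" using a by (metis imageE)
    then have r': "rep a \<in> K \<and> P (rep a) = a" unfolding r by (rule someI_ex)
    then have "\<Xi> (fst (rep a)) = fst a" by (metis fst_map_prod)
    moreover have "\<Xi> (fst (rep a)) \<in> Y" if "f (fst (rep a)) \<noteq> 0"
      unfolding Y_def using r' that by blast
    ultimately have "f (fst (rep a)) = 0" using False by metis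
    then show ?thesis using False r' by (simp add: F_def)
  qed
  \<comment> \<open>The reversed representative of \<open>a\<close> and the representative of
    \<open>flip a\<close> may be different lifts; \<Sigma> marks the arcs where the factor between
    them is -1.\<close>
  define \<Sigma> where "\<Sigma> = {a \<in> P ` K. scaled (- 1) (flip (rep a)) (rep (flip a))}"
  have edge: "F (snd a) = (if a \<in> \<Sigma> then - 1 else 1) * (C a * F (fst a) + S a * D a) \<and>
       D (flip a) = (if a \<in> \<Sigma> then - 1 else 1) * (z * S a * F (fst a) - C a * D a)" if a: "a \<in> P ` A" for a
  proof (cases "a \<in> P ` K")
    case True
    then have fl: "flip a \<in> P ` K" using K_flip by (rule flip_image_P)
    let ?r = "rep a" and ?r' = "rep (flip a)"
    have r: "?r \<in> K" "P ?r = a" "f (fst ?r) = F (fst a)" "?r' \<in> K" "P ?r' = flip a" "f (fst ?r') = F (snd a)"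
      using rep[OF True] rep[OF fl] by simp_all
    have "P (flip ?r) = P ?r'" using r by (simp only: P_flip)
    then obtain c where c: "\<bar>c\<bar> = 1" "scaled c (flip ?r) ?r'"
      using component_q_eq(2)[OF K_K[OF K_flip[OF r(1)] r(4)]] KA[OF K_flip[OF r(1)]] by blast
    have "scaled (if a \<in> \<Sigma> then - 1 else 1) (flip ?r) ?r'"
    proof (cases "c = 1")
      case True
      have "a \<notin> \<Sigma> \<or> scaled (- 1) (flip ?r) ?r'" by (simp add: \<Sigma>_def)
      then show ?thesis using c True by auto
    next
      case False
      then have "c = - 1" using c by auto
      then show ?thesis using c True by (simp add: \<Sigma>_def)
    qed
    then have "f (fst ?r') = (if a \<in> \<Sigma> then - 1 else 1) * f (snd ?r)" "p ?r' = (if a \<in> \<Sigma> then - 1 else 1) * p (flip ?r)"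
      unfolding scaled_def by simp_all
    moreover have "?r \<in> A" using r KA by blast
    ultimately show ?thesis using edge_f[of ?r] edge_p[of ?r] r True fl by (simp add: D_def)
  next
    case False
    \<comment> \<open>Off the projection the slopes are 0, and neither end lies in \<open>Y\<close>,
      because a vertex of \<open>Y\<close> brings all its arcs into the projection.\<close>
    have "flip a \<notin> P ` K"
    proof
      assume "flip a \<in> P ` K"
      then have "flip (flip a) \<in> P ` K" using K_flip by (rule flip_image_P)
      then show False using False by simp
    qed
    moreover have "fst a \<notin> Y" using Y_K[OF a] False by blast
    moreover have "flip a \<in> P ` A" using a flip_A by (rule flip_image_P)
    then have "snd a \<notin> Y" using Y_K[of "flip a"] \<open>flip a \<notin> P ` K\<close> by auto
    ultimately show ?thesis using False by (simp add: F_def D_def)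
  qed
  have kirch: "(\<Sum>w\<in>NG v. D (v, w)) = \<beta> v * F v" if v: "v \<in> Y" for v
  proof -
    let ?x = "fst (s v)"
    have x: "?x \<in> V" "\<Xi> ?x = v" "f ?x \<noteq> 0" using s[OF v] KA fst_V by auto
    have "(\<Sum>w\<in>NG v. D (v, w)) = sum D (Pair v ` NG v)"
      by (subst sum.reindex) (auto simp: inj_on_def o_def)
    also have "\<dots> = (\<Sum>b\<in>outs ?x. D (P b))"
      using sum.reindex_bij_betw[OF bij_P[OF x(1)], of D] x by simp
    also have "\<dots> = (\<Sum>b\<in>outs ?x. p b)"
    proof (rule sum.cong[OF refl])
      fix b assume b: "b \<in> outs ?x"
      then have bK: "b \<in> K" "P b \<in> P ` K" using s_outs[OF v] by auto
      have "inj_on P (outs ?x)" using bij_P[OF x(1)] by (simp add: bij_betw_def)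
      moreover have "\<Xi> (fst b) = v" using b x by (simp add: outs_iff)
      ultimately have "rep (P b) = b" using b v by (simp add: rep_def inv_into_f_f)
      then show "D (P b) = p b" using bK by (simp add: D_def)
    qed
    also have "\<dots> = \<beta> v * F v"
      using kirchhoff[OF x(1)] dirichlet[OF x(1)] x v by (auto simp: sum_outs F_def)
    finally show ?thesis .
  qed
  have Y_V: "Y \<subseteq> fst ` P ` A - Dir"
  proof
    fix v assume "v \<in> Y"
    then obtain b where b: "b \<in> K" "f (fst b) \<noteq> 0" "v = \<Xi> (fst b)" unfolding Y_def by blast
    have bA: "b \<in> A" using KA[OF b(1)] by blast
    have "v = fst (P b)" using b(3) by simp
    also have "fst (P b) \<in> fst ` P ` A" by (intro imageI bA)
    finally have "v \<in> fst ` P ` A" .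
    moreover have "v \<notin> Dir" using dirichlet[OF fst_V[OF bA]] b(2,3) by blast
    ultimately show "v \<in> fst ` P ` A - Dir" by (rule DiffI)
  qed
  have nz: "(F (fst a))\<^sup>2 + (D a)\<^sup>2 \<noteq> 0" if "a \<in> P ` K" for a
    using rep[OF that] KA[of "rep a"] that by (simp add: q_def D_def)
  have node: "\<Xi> (fst b) \<notin> Y" if b: "b \<in> K" "f (fst b) = 0" for b
  proof
    assume "\<Xi> (fst b) \<in> Y"
    then obtain c where "c \<in> K" "f (fst c) \<noteq> 0" "\<Xi> (fst c) = \<Xi> (fst b)" by (auto simp: Y_def)
    then show False using node_fibre[of b "fst c"] KA b fst_V by blast
  qed
  have zero: "F v = 0" if "v \<notin> Y" for v using that by (simp add: F_def)
  have zero': "D a = 0" if "a \<notin> P ` K" for a using that by (simp add: D_def)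
  have sub: "\<Sigma> \<subseteq> P ` A" using PK_A by (auto simp only: \<Sigma>_def)
  have off: "F (fst a) = 0" if "a \<in> P ` A - P ` K" for a using that Y_K[of a] zero by blast
  show ?thesis
    by (rule exI[of _ Y], rule exI[of _ \<Sigma>], rule exI[of _ F], rule exI[of _ D])
      (intro conjI, rule ballI, erule edge, rule Y_V, rule sub, rule ballI, erule kirch, intro allI impI,
        erule zero, intro allI impI, erule zero', rule ballI, erule off, rule ballI, erule nz,
        intro ballI impI, erule (1) node)
qed


subsection \<open>A single type of components is impossible\<close>

abbreviation B :: "'t \<times> 't \<Rightarrow> real" where
  "B \<equiv> branch_sum q"

lemma B_rec: "a \<in> A \<Longrightarrow> B a = q a + sum B (nexts a)"
  by (rule branch_sum_rec[OF _ q_summable q_nonneg])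

lemma B_nonneg: "a \<in> A \<Longrightarrow> 0 \<le> B a"
  by (rule branch_sum_nonneg[OF _ q_summable q_nonneg])

lemma nexts_A: "b \<in> nexts a \<Longrightarrow> b \<in> A"
  by (simp add: nexts_def)

section \<open>Energies of the branches met when walking forward inside a component\<close>

definition forward :: "(('t \<times> 't) \<times> ('t \<times> 't)) set" where
  "forward = {(a, b). a \<in> A \<and> f (snd a) \<noteq> 0 \<and> b \<in> nexts a}"

lemma forwards_A: "(a, b) \<in> forward\<^sup>* \<Longrightarrow> a \<in> A \<Longrightarrow> b \<in> A"
  by (induction rule: rtrancl_induct) (auto simp: forward_def nexts_A)

text \<open>Forward paths stop at zeros, so no arc of \<open>G\<close> lies behind another, and
  their branches are separate parts of the branch behind \<open>a\<close>. The induction sorts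
  \<open>G\<close> by the first continuing arc.\<close>

lemma forward_relpow_sum_le:
  assumes "a \<in> A" "finite G" "\<And>b. b \<in> G \<Longrightarrow> (\<exists>m\<le>n. (a, b) \<in> forward ^^ m) \<and> f (snd b) = 0"
  shows "sum B G \<le> B a"
  using assms
proof (induction n arbitrary: a G)
  case 0
  then have "G \<subseteq> {a}" by auto
  then have "sum B G \<le> sum B {a}" by (intro sum_mono2) (use 0 B_nonneg in auto)
  then show ?case by simp
next
  case (Suc n)
  show ?case
  proof (cases "f (snd a) = 0")
    case True
    have "G \<subseteq> {a}"
    proof
      fix b assume "b \<in> G"
      then obtain m where "(a, b) \<in> forward ^^ m" using Suc.prems by blast
      then show "b \<in> {a}"
      proof (cases m)
        case (Suc k)
        then obtain c where "(a, c) \<in> forward"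
          using \<open>(a, b) \<in> forward ^^ m\<close> by (metis relpow_Suc_D2)
        then show ?thesis using True by (auto simp: forward_def)
      qed auto
    qed
    then have "sum B G \<le> sum B {a}" by (intro sum_mono2) (use Suc.prems B_nonneg in auto)
    then show ?thesis by simp
  next
    case False
    let ?G = "\<lambda>c. {b \<in> G. \<exists>m\<le>n. (c, b) \<in> forward ^^ m}"
    have GA: "b \<in> A" if "b \<in> G" for b
      using Suc.prems(3)[OF that] forwards_A[of a b] Suc.prems(1) by (auto dest: relpow_imp_rtrancl)
    have "G \<subseteq> (\<Union>c\<in>nexts a. ?G c)"
    proof
      fix b assume b: "b \<in> G"
      then obtain m where m: "m \<le> Suc n" "(a, b) \<in> forward ^^ m" "f (snd b) = 0" using Suc.prems by blast
      have "m \<noteq> 0" using m False by (intro notI) simp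
      then obtain k where "m = Suc k" using not0_implies_Suc by blast
      with m(2) obtain c where "(a, c) \<in> forward" "(c, b) \<in> forward ^^ k" by (metis relpow_Suc_D2)
      then show "b \<in> (\<Union>c\<in>nexts a. ?G c)" using b m \<open>m = Suc k\<close> by (auto simp: forward_def)
    qed
    then have "sum B G \<le> sum B (\<Union>c\<in>nexts a. ?G c)"
      by (intro sum_mono2) (use GA B_nonneg Suc.prems in \<open>auto simp: finite_nexts\<close>)
    also have "\<dots> \<le> (\<Sum>c\<in>nexts a. sum B (?G c))"
      by (rule sum_UN_le) (use GA B_nonneg Suc.prems in \<open>auto simp: finite_nexts\<close>)
    also have "\<dots> \<le> sum B (nexts a)"
      by (intro sum_mono Suc.IH) (use Suc.prems in \<open>auto simp: nexts_A\<close>)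
    also have "\<dots> \<le> B a" using B_rec[OF Suc.prems(1)] q_nonneg[of a] by simp
    finally show ?thesis .
  qed
qed

lemma forward_sum_le:
  assumes "a \<in> A" "finite G" "\<And>b. b \<in> G \<Longrightarrow> (a, b) \<in> forward\<^sup>* \<and> f (snd b) = 0"
  shows "sum B G \<le> B a"
proof -
  have "\<exists>m. (a, b) \<in> forward ^^ m" if "b \<in> G" for b
    using assms(3)[OF that] rtrancl_imp_relpow by blast
  then obtain m where m: "\<And>b. b \<in> G \<Longrightarrow> (a, b) \<in> forward ^^ m b" by metis
  show ?thesis
  proof (rule forward_relpow_sum_le[OF assms(1,2), where n = "Max (m ` G)"])
    fix b assume b: "b \<in> G"
    then have "m b \<le> Max (m ` G)" using assms(2) by simp
    then show "(\<exists>k\<le>Max (m ` G). (a, b) \<in> forward ^^ k) \<and> f (snd b) = 0"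
      using m[OF b] assms(3)[OF b] by blast
  qed
qed

text \<open>Excluding \<open>a\<close> places all of \<open>G\<close> strictly behind it, which
  leaves room for the term q a.\<close>

lemma q_forward_sum_le:
  assumes "a \<in> A" "finite G" "\<And>b. b \<in> G \<Longrightarrow> (a, b) \<in> forward\<^sup>* \<and> f (snd b) = 0 \<and> b \<noteq> a"
  shows "q a + sum B G \<le> B a"
proof -
  let ?G = "\<lambda>c. {b \<in> G. (c, b) \<in> forward\<^sup>*}"
  have GA: "b \<in> A" if "b \<in> G" for b using forwards_A[of a b] assms(1) assms(3)[OF that] by blast
  have "G \<subseteq> (\<Union>c\<in>nexts a. ?G c)"
  proof
    fix b assume b: "b \<in> G"
    then obtain c where "(a, c) \<in> forward" "(c, b) \<in> forward\<^sup>*"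
      using assms(3)[OF b] by (metis converse_rtranclE)
    then show "b \<in> (\<Union>c\<in>nexts a. ?G c)" using b by (auto simp: forward_def)
  qed
  then have "sum B G \<le> sum B (\<Union>c\<in>nexts a. ?G c)"
    by (intro sum_mono2) (use GA B_nonneg assms in \<open>auto simp: finite_nexts\<close>)
  also have "\<dots> \<le> (\<Sum>c\<in>nexts a. sum B (?G c))"
    by (rule sum_UN_le) (use GA B_nonneg assms in \<open>auto simp: finite_nexts\<close>)
  also have "\<dots> \<le> sum B (nexts a)"
    by (intro sum_mono forward_sum_le) (use assms in \<open>auto simp: nexts_A\<close>)
  finally show ?thesis using B_rec[OF assms(1)] by simp
qed

text \<open>A path in the component cannot leave through the start of \<open>a\<close>, which is a
  zero. With backtracking removed it runs forward from \<open>a\<close> and reaches the arc or its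
  reverse.\<close>

lemma component_forward:
  assumes "a \<in> A" "f (fst a) = 0" "(a, b) \<in> step\<^sup>*"
  shows "(a, b) \<in> forward\<^sup>* \<or> (a, flip b) \<in> forward\<^sup>*"
  using assms(3)
proof (induction rule: rtrancl_induct)
  case (step b c)
  then have bA: "b \<in> A" by (auto simp: step_def)
  show ?case
  proof (cases "c = flip b")
    case True
    then show ?thesis using step.IH by auto
  next
    case False
    then have c: "c \<in> nexts b" "f (snd b) \<noteq> 0" using step(2) nexts_outs[OF bA] by (auto simp: step_def)
    consider "(a, b) \<in> forward\<^sup>*" | "(a, flip b) \<in> forward\<^sup>*" using step.IH by blast
    then show ?thesis
    proof cases
      case 1
      moreover have "(b, c) \<in> forward" using c bA by (simp add: forward_def)
      ultimately show ?thesis by (meson rtrancl.rtrancl_into_rtrancl)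
    next
      case 2
      moreover have "flip b \<noteq> a" using assms(2) c by auto
      ultimately obtain d where d: "(a, d) \<in> forward\<^sup>*" "(d, flip b) \<in> forward"
        by (metis rtranclE)
      then have "flip b \<in> nexts d" "d \<in> A" "f (snd d) \<noteq> 0" by (auto simp: forward_def)
      then have "snd d = snd b" by (auto simp: nexts_def)
      show ?thesis
      proof (cases "c = flip d")
        case True
        then show ?thesis using d by auto
      next
        case False
        then have "c \<in> nexts d" using c \<open>snd d = snd b\<close> \<open>d \<in> A\<close> by (auto simp: nexts_def flip_def prod_eq_iff)
        then have "(d, c) \<in> forward" using \<open>d \<in> A\<close> \<open>f (snd d) \<noteq> 0\<close> by (simp add: forward_def)
        then show ?thesis using d by (meson rtrancl.rtrancl_into_rtrancl)
      qed
    qed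
  qed
qed simp

text \<open>
  Suppose that every component contains a lift of the arc \<open>P e\<close>, which starts at the vertex \<open>w\<close>.
  Then all components are copies of a single one, up to the square \<open>\<tau>\<close> of an amplitude. Let \<open>E i\<close>
  be the infimum of the normalized energy \<open>far\<close> behind \<open>w\<close>, seen from a component that enters \<open>w\<close>
  through its arc number \<open>i\<close>. The energy of the branch opposite to an arc number \<open>j\<close> is at least
  \<open>X j * \<tau>\<close>, and the Kirchhoff condition at \<open>w\<close> with the Cauchy-Schwarz inequality turns this into
  \<open>W i * (D i + s) \<le> E i * D i * Q\<close> with \<open>s = (\<Sum>m\<in>I. E m * D m)\<close> and \<open>Q = sum W I\<close>. Summation
  over \<open>i\<close> gives a contradiction.
\<close>

lemma ex_component_avoiding:
  assumes e: "e \<in> A" "q e \<noteq> 0" "f (fst e) = 0" "\<Xi> (fst e) \<notin> Dir"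
  shows "\<exists>a\<in>A. q a \<noteq> 0 \<and> (\<forall>b. (a, b) \<in> step\<^sup>* \<longrightarrow> P b \<noteq> P e)"
proof (rule ccontr)
  assume "\<not> ?thesis"
  then have all: "\<exists>b. (a, b) \<in> step\<^sup>* \<and> P b = P e" if "a \<in> A" "q a \<noteq> 0" for a using that by blast
  define w where "w = \<Xi> (fst e)"
  have node: "f x = 0" if "x \<in> V" "\<Xi> x = w" for x
    using node_fibre[OF e(1-3) that(1)] that(2) by (simp add: w_def)
  \<comment> \<open>Any lift of P e in the component gives the same value by
    \<open>component_q_eq\<close>, so the choice is immaterial.\<close>
  define \<tau> where "\<tau> a = q (SOME b. (a, b) \<in> step\<^sup>* \<and> P b = P e)" for a
  have \<tau>: "\<tau> a = q b" if "a \<in> A" "q a \<noteq> 0" "(a, b) \<in> step\<^sup>*" "P b = P e" for a b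
  proof -
    let ?b = "SOME b. (a, b) \<in> step\<^sup>* \<and> P b = P e"
    have b: "(a, ?b) \<in> step\<^sup>* \<and> P ?b = P e" by (rule someI_ex) (rule all[OF that(1,2)])
    have "(?b, b) \<in> step\<^sup>*" by (rule rtrancl_trans[OF steps_sym that(3)]) (use b in blast)
    moreover have "?b \<in> A" "q ?b \<noteq> 0" using b that steps_A steps_q by blast+
    ultimately show ?thesis
      unfolding \<tau>_def by (intro component_q_eq(1)) (simp_all add: b that(4))
  qed
  have \<tau>_pos: "0 < \<tau> a" if "a \<in> A" "q a \<noteq> 0" for a
    using all[OF that] \<tau>[OF that] steps_q[of a] that q_nonneg by (metis less_eq_real_def)
  have \<tau>_step: "\<tau> b = \<tau> a" if "a \<in> A" "q a \<noteq> 0" "(a, b) \<in> step\<^sup>*" for a b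
  proof -
    have b: "b \<in> A" "q b \<noteq> 0" using that steps_A steps_q by blast+
    then obtain d where "(b, d) \<in> step\<^sup>*" "P d = P e" using all by blast
    then show ?thesis using \<tau>[OF b] \<tau>[OF that(1,2)] that(3) by (metis rtrancl_trans)
  qed
  have \<tau>_scaled: "\<tau> a' = c\<^sup>2 * \<tau> a" if c: "scaled c a a'" and "q a \<noteq> 0" for c a a'
  proof -
    have a: "a \<in> A" "a' \<in> A" "q a' \<noteq> 0" using that scaled_q[OF c] by (auto simp: scaled_def)
    from all[OF a(1) that(2)] obtain b where b: "(a, b) \<in> step\<^sup>*" "P b = P e" by blast
    from transport[OF b(1) c] obtain b' where b': "(a', b') \<in> step\<^sup>*" "scaled c b b'" by blast
    then have "P b' = P e" using b by (simp add: scaled_def)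
    then show ?thesis
      using \<tau>[OF a(1) that(2) b] \<tau>[OF a(2,3) b'(1)] scaled_q[OF b'(2)] by simp
  qed
  \<comment> \<open>Support arcs that leave the fibre of \<open>w\<close>; the base vertex at their
    other end serves as their number.\<close>
  define act where "act i = {a \<in> A. q a \<noteq> 0 \<and> P a = (w, i)}" for i
  define I where "I = {i. act i \<noteq> {}}"
  have finI: "finite I"
  proof (rule finite_subset)
    show "I \<subseteq> snd ` (P ` A)" by (force simp: I_def act_def)
  qed (use finite_fibres in blast)
  \<comment> \<open>Rescaling a component multiplies \<open>q\<close> and \<tau> by the same square,
    so the quotient depends only on i.\<close>
  define D where "D i = q (SOME a. a \<in> act i) / \<tau> (SOME a. a \<in> act i)" for i
  have D: "q a = D i * \<tau> a \<and> 0 < D i" if a: "a \<in> act i" for a i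
  proof -
    let ?a = "SOME a. a \<in> act i"
    have "?a \<in> act i" by (rule someI[of _ a]) (rule a)
    then have a': "?a \<in> A" "q ?a \<noteq> 0" "P ?a = P a" "a \<in> A" "q a \<noteq> 0" using a by (auto simp: act_def)
    then obtain c where c: "scaled c ?a a" using ex_scaled by blast
    have "0 < q ?a" using a' q_nonneg[of ?a] by simp
    moreover have "0 < \<tau> ?a" using \<tau>_pos a' by blast
    ultimately show ?thesis using scaled_q[OF c] \<tau>_scaled[OF c a'(2)] by (simp add: D_def)
  qed
  have act_node: "a \<in> A" "q a \<noteq> 0" "f (fst a) = 0" "\<Xi> (fst a) = w" "\<Xi> (snd a) = i" if "a \<in> act i" for a i
    using that node[OF fst_V, of a] by (simp_all add: act_def prod_eq_iff)
  \<comment> \<open>\<open>flip a\<close> arrives at the start of \<open>a\<close>, so this is the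
    energy of all branches there except the one behind \<open>a\<close>.\<close>
  define far where "far a = sum B (nexts (flip a))" for a
  have far_nonneg: "0 \<le> far a" for a
    unfolding far_def by (intro sum_nonneg B_nonneg nexts_A)
  define E where "E i = Inf ((\<lambda>a. far a / q a) ` act i)" for i
  have E_le: "E i * q a \<le> far a" if "a \<in> act i" for a i
  proof -
    have "E i \<le> far a / q a"
      unfolding E_def by (rule cInf_lower) (use that far_nonneg q_nonneg in \<open>auto intro!: bdd_belowI[of _ 0]\<close>)
    moreover have "0 < q a" using act_node(2)[OF that] q_nonneg[of a] by simp
    ultimately show ?thesis by (simp add: field_simps)
  qed
  define X where "X j = D j + (\<Sum>i\<in>I - {j}. E i * D i)" for j
  \<comment> \<open>The component of \<open>a\<close> contains an active arc \<open>b i\<close> for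
    every i, because all components are copies of each other. For i other than j, its reverse
    arrives at a further lift of \<open>w\<close>, and the branches beyond contribute at least E i *
    D i * \<tau> a. The arc \<open>a\<close> itself contributes D j * \<tau> a.\<close>
  have branch_ge: "X j * \<tau> a \<le> B a" if a: "a \<in> act j" for a j
  proof -
    note an = act_node[OF a]
    have "\<exists>b. (a, b) \<in> step\<^sup>* \<and> b \<in> act i" if i: "i \<in> I" for i
    proof -
      obtain d where d: "d \<in> act i" using i by (auto simp: I_def)
      obtain d' where d': "(d, d') \<in> step\<^sup>*" "P d' = P e" using all act_node[OF d] by blast
      obtain a' where a': "(a, a') \<in> step\<^sup>*" "P a' = P e" using all an by blast
      have "d' \<in> A" "q d' \<noteq> 0" "a' \<in> A" "q a' \<noteq> 0"
        using d'(1) a'(1) an(1,2) act_node(1,2)[OF d] steps_A steps_q by blast+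
      then have "\<exists>c. scaled c d' a'" using d'(2) a'(2) by (intro ex_scaled) simp_all
      then obtain c where "scaled c d' a'" ..
      from transport[OF steps_sym[OF d'(1)] this] obtain b where b: "(a', b) \<in> step\<^sup>*" "scaled c d b" by blast
      then have "b \<in> act i" using d act_node(2)[OF d] scaled_q[OF b(2)] by (simp add: act_def scaled_def)
      then show ?thesis using a' b by (meson rtrancl_trans)
    qed
    then obtain b where b: "\<And>i. i \<in> I \<Longrightarrow> (a, b i) \<in> step\<^sup>* \<and> b i \<in> act i" by metis
    have fw: "(a, flip (b i)) \<in> forward\<^sup>* \<and> f (snd (flip (b i))) = 0 \<and> flip (b i) \<noteq> a"
      if i: "i \<in> I - {j}" for i
    proof -
      have bi: "(a, b i) \<in> step\<^sup>*" "b i \<in> act i" using b i by blast+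
      note bn = act_node[OF bi(2)]
      have "b i \<noteq> a" using bn(5) an(5) i by auto
      moreover have "flip (b i) \<noteq> a"
        using an(4) bn(4) no_loop[of "fst (b i)" "snd (b i)"] bn(1) by auto
      \<comment> \<open>Reaching \<open>b i\<close> itself in the forward direction would mean
        passing its start, which is a zero.\<close>
      moreover have "(a, b i) \<notin> forward\<^sup>*"
      proof
        assume "(a, b i) \<in> forward\<^sup>*"
        then obtain d where "(d, b i) \<in> forward" using \<open>b i \<noteq> a\<close> by (metis rtranclE)
        then show False using bn(3) by (auto simp: forward_def nexts_def)
      qed
      ultimately show ?thesis using component_forward[OF an(1,3) bi(1)] bn(3) by simp
    qed
    have inj: "inj_on (\<lambda>i. flip (b i)) (I - {j})"
      using b act_node(5) by (intro inj_onI) (metis DiffD1 flip_simps(3))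
    have "q a + sum B ((\<lambda>i. flip (b i)) ` (I - {j})) \<le> B a"
    proof (rule q_forward_sum_le[OF an(1)])
      fix c assume "c \<in> (\<lambda>i. flip (b i)) ` (I - {j})"
      then obtain i where i: "i \<in> I - {j}" "c = flip (b i)" by blast
      show "(a, c) \<in> forward\<^sup>* \<and> f (snd c) = 0 \<and> c \<noteq> a"
        unfolding i(2) by (rule fw[OF i(1)])
    qed (rule finite_imageI[OF finite_Diff[OF finI]])
    then have "q a + (\<Sum>i\<in>I - {j}. B (flip (b i))) \<le> B a" by (simp add: sum.reindex[OF inj] o_def)
    moreover have "(\<Sum>i\<in>I - {j}. E i * D i * \<tau> a) \<le> (\<Sum>i\<in>I - {j}. B (flip (b i)))"
    proof (rule sum_mono)
      fix i assume i: "i \<in> I - {j}"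
      then have bi: "(a, b i) \<in> step\<^sup>*" "b i \<in> act i" using b by blast+
      have "E i * D i * \<tau> a = E i * q (b i)" using D[OF bi(2)] \<tau>_step[OF an(1,2) bi(1)] by simp
      also have "\<dots> \<le> far (b i)" by (rule E_le[OF bi(2)])
      also have "\<dots> \<le> B (flip (b i))"
        using B_rec[OF flip_A[OF act_node(1)[OF bi(2)]]] q_nonneg by (simp add: far_def)
      finally show "E i * D i * \<tau> a \<le> B (flip (b i))" .
    qed
    ultimately show ?thesis using D[OF a] by (simp add: X_def distrib_right sum_distrib_right)
  qed
  have Dpos: "0 < D i" if "i \<in> I" for i using D that by (auto simp: I_def)
  have Epos: "0 \<le> E i" if "i \<in> I" for i
    unfolding E_def using that far_nonneg q_nonneg by (intro cInf_greatest) (auto simp: I_def)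
  have Xpos: "0 < X j" if "j \<in> I" for j
    unfolding X_def using Dpos Epos that by (intro add_pos_nonneg sum_nonneg mult_nonneg_nonneg) (auto intro: less_imp_le)
  \<comment> \<open>The squared slope of an active arc divided by its branch bound X j * \<tau>; the
    amplitude cancels.\<close>
  define W where "W j = D j / X j" for j
  have Wpos: "0 < W j" if "j \<in> I" for j using Dpos Xpos that by (simp add: W_def)
  define Q where "Q = sum W I"
  have key: "q a \<le> far a * (Q - W i)" if a: "a \<in> act i" for a i
  proof -
    note an = act_node[OF a]
    define N where "N = {b \<in> nexts (flip a). q b \<noteq> 0}"
    define g where "g b = \<Xi> (snd b)" for b :: "'t \<times> 't"
    have N: "b \<in> act (g b)" "fst b = fst a" "b \<noteq> a" if "b \<in> N" for b
      using that an by (auto simp: N_def nexts_def act_def g_def prod_eq_iff)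
    have N_outs: "b \<in> outs (fst a)" if "b \<in> N" for b
      unfolding outs_iff using act_node(1)[OF N(1)[OF that]] N(2)[OF that] by (rule conjI)
    have a_outs: "a \<in> outs (fst a)" unfolding outs_iff using an(1) by (rule conjI[OF _ refl])
    have gI: "g b \<in> I - {i}" if "b \<in> N" for b
    proof -
      have "g b \<noteq> i"
      proof
        assume "g b = i"
        then have "P b = P a"
          using act_node(4)[OF N(1)[OF that]] an(4,5) by (simp add: prod_eq_iff g_def)
        then have "b = a" by (rule outs_P_inj[OF N_outs[OF that] a_outs])
        with N(3)[OF that] show False ..
      qed
      then show ?thesis using N(1)[OF that] by (auto simp: I_def)
    qed
    have inj: "inj_on g N"
    proof (rule inj_onI)
      fix b c assume bc: "b \<in> N" "c \<in> N" "g b = g c"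
      have "P b = P c"
        using act_node(4)[OF N(1)[OF bc(1)]] act_node(4)[OF N(1)[OF bc(2)]] bc(3) by (simp add: prod_eq_iff g_def)
      then show "b = c" by (rule outs_P_inj[OF N_outs[OF bc(1)] N_outs[OF bc(2)]])
    qed
    have posN: "0 < X (g b)" "0 < \<tau> b" if "b \<in> N" for b
    proof -
      show "0 < X (g b)" using Xpos gI[OF that] by blast
      show "0 < \<tau> b" using \<tau>_pos act_node(1,2)[OF N(1)[OF that]] by blast
    qed
    have "nexts (flip a) = outs (fst a) - {a}" using nexts_outs[OF flip_A[OF an(1)]] by simp
    moreover have "sum p (outs (fst a)) = 0"
      using kirchhoff[OF fst_V[OF an(1)]] e(4) an by (simp add: sum_outs w_def)
    ultimately have "p a = - sum p (nexts (flip a))"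
      using sum.remove[OF finite_outs, of a "fst a" p] an(1) by (simp add: outs_iff)
    also have "sum p (nexts (flip a)) = sum p N"
      unfolding N_def by (rule sum.mono_neutral_right) (auto simp: finite_nexts q_eq_0_iff)
    \<comment> \<open>With this weight the first Cauchy-Schwarz factor becomes the sum of the lower
      bounds in \<open>branch_ge\<close>, and the second a sum of values of
      \<open>W\<close>.\<close>
    also have "\<dots> = (\<Sum>b\<in>N. sqrt (X (g b) * \<tau> b) * (p b / sqrt (X (g b) * \<tau> b)))"
    proof (rule sum.cong[OF refl])
      fix b assume b: "b \<in> N"
      show "p b = sqrt (X (g b) * \<tau> b) * (p b / sqrt (X (g b) * \<tau> b))"
        using posN[OF b] by simp
    qed
    finally have pa: "p a = - (\<Sum>b\<in>N. sqrt (X (g b) * \<tau> b) * (p b / sqrt (X (g b) * \<tau> b)))" .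
    have "(p a)\<^sup>2 = (\<Sum>b\<in>N. sqrt (X (g b) * \<tau> b) * (p b / sqrt (X (g b) * \<tau> b)))\<^sup>2"
      by (subst pa) (rule power2_minus)
    also have "\<dots> \<le> (\<Sum>b\<in>N. (sqrt (X (g b) * \<tau> b))\<^sup>2) * (\<Sum>b\<in>N. (p b / sqrt (X (g b) * \<tau> b))\<^sup>2)"
      by (rule Cauchy_Schwarz_ineq_sum)
    also have "(\<Sum>b\<in>N. (sqrt (X (g b) * \<tau> b))\<^sup>2) = (\<Sum>b\<in>N. X (g b) * \<tau> b)"
      by (intro sum.cong[OF refl] real_sqrt_pow2 mult_nonneg_nonneg less_imp_le posN)
    also have "(\<Sum>b\<in>N. (p b / sqrt (X (g b) * \<tau> b))\<^sup>2) = (\<Sum>b\<in>N. W (g b))"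
    proof (rule sum.cong[OF refl])
      fix b assume b: "b \<in> N"
      have "(p b)\<^sup>2 = D (g b) * \<tau> b" using D[OF N(1)[OF b]] act_node(3)[OF N(1)[OF b]] by (simp add: q_def)
      then show "(p b / sqrt (X (g b) * \<tau> b))\<^sup>2 = W (g b)"
        using posN[OF b] by (simp add: power_divide W_def)
    qed
    also have "(\<Sum>b\<in>N. X (g b) * \<tau> b) * (\<Sum>b\<in>N. W (g b)) \<le> far a * (Q - W i)"
    proof (rule mult_mono)
      have "(\<Sum>b\<in>N. X (g b) * \<tau> b) \<le> sum B N" by (rule sum_mono) (rule branch_ge[OF N(1)])
      also have "\<dots> \<le> far a"
        unfolding far_def by (rule sum_mono2) (auto simp: N_def finite_nexts nexts_A intro: B_nonneg)
      finally show "(\<Sum>b\<in>N. X (g b) * \<tau> b) \<le> far a" .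
      have "(\<Sum>b\<in>N. W (g b)) = sum W (g ` N)" by (simp add: sum.reindex[OF inj])
      also have "\<dots> \<le> sum W (I - {i})"
        by (rule sum_mono2) (use gI finI Wpos in \<open>auto intro: less_imp_le\<close>)
      also have "\<dots> = Q - W i"
        using a finI by (subst sum_diff1) (auto simp: Q_def I_def)
      finally show "(\<Sum>b\<in>N. W (g b)) \<le> Q - W i" .
      show "0 \<le> (\<Sum>b\<in>N. W (g b))" using gI Wpos by (intro sum_nonneg) (auto intro: less_imp_le)
    qed (rule far_nonneg)
    finally show ?thesis using an(3) by (simp add: q_def)
  qed
  have ineq: "W i * D i + W i * (\<Sum>m\<in>I. E m * D m) \<le> E i * D i * Q" if i: "i \<in> I" for i
  proof -
    obtain a0 where a0: "a0 \<in> act i" using i by (auto simp: I_def)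
    \<comment> \<open>\<open>key\<close> bounds a positive energy by a product with the nonnegative
      \<open>far a0\<close>, so the other factor is positive and may be divided by.\<close>
    have pos: "0 < Q - W i"
    proof -
      have "0 < q a0" using act_node(2)[OF a0] q_nonneg[of a0] by simp
      then have "0 < far a0 * (Q - W i)" using key[OF a0] by simp
      then show ?thesis using far_nonneg[of a0] by (simp add: zero_less_mult_iff)
    qed
    have "1 / (Q - W i) \<le> E i"
      unfolding E_def
    proof (rule cInf_greatest)
      fix y assume "y \<in> (\<lambda>a. far a / q a) ` act i"
      then obtain a where a: "a \<in> act i" "y = far a / q a" by blast
      have "0 < q a" using act_node(2)[OF a(1)] q_nonneg[of a] by simp
      moreover have "q a / (Q - W i) \<le> far a" using key[OF a(1)] pos by (simp add: pos_divide_le_eq)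
      ultimately have "q a / (Q - W i) / q a \<le> y" unfolding a(2) by (intro divide_right_mono) simp_all
      then show "1 / (Q - W i) \<le> y" using \<open>0 < q a\<close> by simp
    qed (use a0 in auto)
    then have "1 \<le> E i * (Q - W i)" using pos by (simp add: field_simps)
    then have "D i * 1 \<le> D i * (E i * (Q - W i))" using Dpos[OF i] by (intro mult_left_mono) auto
    moreover have "W i * X i = D i" using Xpos[OF i] by (simp add: W_def)
    ultimately have le: "W i * X i \<le> D i * (E i * (Q - W i))" by simp
    \<comment> \<open>With the full sum in place of the one without i, the terms W i * E i * D i on
      the two sides cancel.\<close>
    have "X i = D i + ((\<Sum>m\<in>I. E m * D m) - E i * D i)"
      using i finI by (simp add: X_def sum_diff1)
    from le[unfolded this] show ?thesis by (simp add: algebra_simps)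
  qed
  have "e \<in> act (\<Xi> (snd e))" using e by (simp add: act_def w_def prod_eq_iff)
  then have "I \<noteq> {}" by (auto simp: I_def)
  have "0 < (\<Sum>i\<in>I. W i * D i)"
    by (rule sum_pos) (use finI \<open>I \<noteq> {}\<close> Wpos Dpos in auto)
  moreover have "(\<Sum>i\<in>I. W i * D i + W i * (\<Sum>m\<in>I. E m * D m)) \<le> (\<Sum>i\<in>I. E i * D i * Q)"
    by (rule sum_mono) (rule ineq)
  then have "(\<Sum>i\<in>I. W i * D i) + Q * (\<Sum>m\<in>I. E m * D m) \<le> (\<Sum>i\<in>I. E i * D i) * Q"
    by (simp add: sum.distrib Q_def sum_distrib_right)
  ultimately show False by (simp add: mult.commute)
qed

end

section \<open>Point spectrum of the universal cover\<close>

lemma cas_cycle_nth: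
  assumes "pre_digraph.cas (with_proj G) u p u" "set p \<subseteq> parcs G" "p \<noteq> []"
  shows "\<And>i. i < length p \<Longrightarrow> p ! i \<in> parcs G \<and> snd (p ! i) = fst (p ! (Suc i mod length p))"
proof -
  have cas_nth: "snd (p ! i) = (if Suc i < length p then fst (p ! Suc i) else v)"
    if "pre_digraph.cas (with_proj G) u p v" "i < length p" for i u v p
    using that
  proof (induction p arbitrary: u i)
    case (Cons a p)
    have c: "fst a = u" "pre_digraph.cas (with_proj G) (snd a) p v"
      using Cons.prems(1) by (simp_all add: pre_digraph.cas.simps)
    show ?case
    proof (cases i)
      case 0
      show ?thesis
        using c(2) 0 by (cases p) (simp_all add: pre_digraph.cas.simps)
    next
      case (Suc j)
      then show ?thesis using Cons.IH[OF c(2), of j] Cons.prems(2) by simp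
    qed
  qed simp
  have u: "fst (p ! 0) = u" using assms(1,3) by (cases p) (simp_all add: pre_digraph.cas.simps)
  fix i assume i: "i < length p"
  have "p ! i \<in> parcs G" using assms(2) i nth_mem by blast
  moreover have "snd (p ! i) = fst (p ! (Suc i mod length p))"
  proof (cases "Suc i < length p")
    case False
    then have "Suc i = length p" using i by simp
    then show ?thesis using cas_nth[OF assms(1) i] u by simp
  qed (use cas_nth[OF assms(1) i] in simp)
  ultimately show "p ! i \<in> parcs G \<and> snd (p ! i) = fst (p ! (Suc i mod length p))" ..
qed

text \<open>Running around the cycle forever never backtracks, since its length is at least 3. It
  lifts to arbitrarily long non-backtracking walks, whose vertices are distinct in a tree.\<close>

lemma infinite_universal_cover:
  assumes cyc: "has_undirected_cycle G" and cover: "universal_cover T G \<Xi>"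
  shows "infinite (parcs T)"
proof
  assume fin: "finite (parcs T)"
  have tree: "undirected_tree T" and \<Xi>: "\<Xi> ` pverts T = pverts G"
    and bij: "\<And>t. t \<in> pverts T \<Longrightarrow> bij_betw \<Xi> (neighbours T t) (neighbours G (\<Xi> t))"
    using cover by (auto simp: universal_cover_def graph_covering_def)
  interpret T: pair_bidirected_digraph T using tree by (simp add: undirected_tree_def)
  obtain p u where p: "pre_digraph.awalk (with_proj G) u p u" "distinct (tl (pre_digraph.awalk_verts (with_proj G) u p))"
    "3 \<le> length p"
    using cyc unfolding has_undirected_cycle_def pre_digraph.cycle_def by blast
  define k where "k = length p"
  define c where "c i = fst (p ! (i mod k))" for i
  have k: "3 \<le> k" "p \<noteq> []" using p(3) by (auto simp: k_def)
  have cas: "pre_digraph.cas (with_proj G) u p u" "set p \<subseteq> parcs G" "u \<in> pverts G"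
    using p(1) by (simp_all add: pre_digraph.awalk_def)
  note nth = cas_cycle_nth[OF cas(1,2) k(2), folded k_def]
  have arc: "(c i, c (Suc i)) \<in> parcs G" for i
  proof -
    have "i mod k < k" using k by simp
    from nth[OF this] have "p ! (i mod k) \<in> parcs G" "snd (p ! (i mod k)) = c (Suc i)"
      by (simp_all add: c_def mod_Suc_eq)
    then show ?thesis by (metis c_def prod.collapse)
  qed
  have "distinct (map snd p)"
  proof -
    have "pre_digraph.awalk_verts (with_proj G) u p = fst (hd p) # map snd p"
      using pre_digraph.awalk_verts_conv'[OF cas(1)] k(2) by simp
    then show ?thesis using p(2) by simp
  qed
  then have inj: "snd (p ! i) \<noteq> snd (p ! j)" if "i < k" "j < k" "i \<noteq> j" for i j
    using that by (auto simp: distinct_conv_nth k_def)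
  have nb: "c i \<noteq> c (Suc (Suc i))" for i
  proof -
    have 1: "c (Suc j) = snd (p ! (j mod k))" for j
      using nth[of "j mod k"] k by (simp add: c_def mod_Suc_eq)
    \<comment> \<open>Distinctness is known for the ends of the arcs, so c i is written as the end
      of the preceding arc; adding k keeps the index a natural number.\<close>
    have "c i = c (Suc (i + k - 1))" using k by (simp add: c_def)
    also have "\<dots> = snd (p ! ((i + k - 1) mod k))" by (rule 1)
    also have "\<dots> \<noteq> snd (p ! (Suc i mod k))"
    proof (rule inj)
      show "(i + k - 1) mod k \<noteq> Suc i mod k"
      proof
        assume "(i + k - 1) mod k = Suc i mod k"
        then have "k dvd (i + k - 1) - Suc i"
          using k by (subst (asm) mod_eq_dvd_iff_nat) simp_all
        then have "k dvd k - 2" by (simp add: numeral_2_eq_2)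
        then show False using k by (auto dest: dvd_imp_le)
      qed
    qed (use k in auto)
    finally show ?thesis using 1 by simp
  qed
  have u0: "c 0 \<in> pverts G"
    using nth[of 0] k cas by (cases p) (auto simp: c_def pre_digraph.cas.simps)
  \<comment> \<open>The lift grows at the head of the list. The condition on the second entry
    records where the walk came from and excludes backtracking in the next step.\<close>
  have "\<exists>xs. nb_walk (parcs T) xs \<and> length xs = Suc n \<and> \<Xi> (hd xs) = c n \<and> hd xs \<in> pverts T \<and>
      (n > 0 \<longrightarrow> \<Xi> (xs ! 1) = c (n - 1))" for n
  proof (induction n)
    case 0
    obtain t where "t \<in> pverts T" "\<Xi> t = c 0" using u0 \<Xi> by (metis imageE)
    then show ?case by (intro exI[of _ "[t]"]) simp
  next
    case (Suc n)
    then obtain xs where xs: "nb_walk (parcs T) xs" "length xs = Suc n" "\<Xi> (hd xs) = c n" "hd xs \<in> pverts T"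
      "n > 0 \<longrightarrow> \<Xi> (xs ! 1) = c (n - 1)" by blast
    then obtain x ys where xy: "xs = x # ys" by (cases xs) auto
    have "c (Suc n) \<in> neighbours G (\<Xi> x)" using arc[of n] xs(3) xy by (simp add: neighbours_def)
    then obtain t where t: "t \<in> neighbours T x" "\<Xi> t = c (Suc n)"
      using bij[of x] xs(4) xy by (metis bij_betw_imp_surj_on imageE list.sel(1))
    then have tx: "(t, x) \<in> parcs T" using T.arcs_symmetric by (simp add: neighbours_def)
    have "nb_walk (parcs T) (t # xs)"
    proof (cases ys)
      case Nil
      then show ?thesis using tx xy by simp
    next
      case (Cons y zs)
      then have "n > 0" "\<Xi> y = c (n - 1)" using xs(2,5) xy by auto
      then have "t \<noteq> y" using nb[of "n - 1"] t(2) by auto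
      then show ?thesis using tx xy Cons xs(1) by simp
    qed
    moreover have "t \<in> pverts T" using tx T.arc_fst_in_verts by fastforce
    ultimately show ?case using xs t by (intro exI[of _ "t # xs"]) (simp add: xy)
  qed
  \<comment> \<open>Without its first vertex this walk has one more vertex than there are arcs, and
    all these distinct vertices are ends of arcs.\<close>
  then obtain xs where xs: "nb_walk (parcs T) xs" "length xs = Suc (Suc (card (parcs T)))" by blast
  then obtain x ys where xy: "xs = x # ys" by (cases xs) auto
  have "set ys \<subseteq> snd ` parcs T"
  proof -
    have "set ys \<subseteq> snd ` parcs T" if "nb_walk (parcs T) (x # ys)" for x ys
      using that
    proof (induction ys arbitrary: x)
      case (Cons y ys)
      have "(x, y) \<in> parcs T" using nb_walk_Cons_hd[OF Cons.prems] by simp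
      then show ?case using Cons.IH[OF nb_walk_tl[OF Cons.prems]] by force
    qed simp
    then show ?thesis using xs(1) xy by blast
  qed
  then have "card (set ys) \<le> card (parcs T)"
    using fin by (meson card_image_le card_mono finite_imageI le_trans)
  moreover have "distinct ys" using undirected_tree_nb_walk_distinct[OF tree xs(1)] xy by simp
  ultimately show False using xs(2) xy by (simp add: distinct_card)
qed

context pair_graph
begin

lemma graph_solution_of_component:
  assumes edge: "\<forall>a\<in>parcs G.
      F (snd a) = (if a \<in> \<Sigma> then - 1 else 1) *
        (cosz z (len (arc_edge a)) * F (fst a) + sinz z (len (arc_edge a)) * D a) \<and>
      D (flip a) = (if a \<in> \<Sigma> then - 1 else 1) *
        (z * sinz z (len (arc_edge a)) * F (fst a) - cosz z (len (arc_edge a)) * D a)"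
    and Y: "Y \<subseteq> fst ` parcs G" "\<forall>v\<in>Y. (\<Sum>w\<in>neighbours G v. D (v, w)) = \<beta> v * F v"
    and F: "\<forall>v. v \<notin> Y \<longrightarrow> F v = 0" and D: "\<forall>a. a \<notin> parcs G \<longrightarrow> D a = 0"
    and nz: "a0 \<in> parcs G" "(F (fst a0))\<^sup>2 + (D a0)\<^sup>2 \<noteq> 0"
  shows "\<exists>c. c \<noteq> 0 \<and> normal_solution G \<beta> Y \<Sigma> len z (\<lambda>v. c * F v) (\<lambda>a. c * D a)"
proof (rule normalize)
  show "graph_solution G \<beta> Y \<Sigma> len z F D"
    using edge Y F unfolding graph_solution_def edge_sign_def by auto
  show "data_norm G F D \<noteq> 0"
    using nz pair_finite_arcs unfolding data_norm_def by (subst sum_nonneg_eq_0_iff) auto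
  show "F v = 0" if "v \<notin> fst ` parcs G" for v using F Y(1) that by blast
qed (use D pair_finite_arcs in auto)

end

theorem theorem1p14:
  fixes G :: "'v pair_pre_digraph"
    and \<alpha> :: "'v \<Rightarrow> ereal"
    and T :: "'t pair_pre_digraph"
    and \<Xi> :: "'t \<Rightarrow> 'v"
  assumes "pair_graph G"
    and "Digraph_Component.connected (with_proj G)"
    and "has_undirected_cycle G"
    and "\<And>v. v \<in> pverts G \<Longrightarrow> \<alpha> v \<noteq> -\<infinity>"
    and "\<And>v. v \<in> pverts G \<Longrightarrow> \<alpha> v = \<infinity> \<Longrightarrow> out_degree (with_proj G) v = 1"
    and "universal_cover T G \<Xi>"
  shows "residual_in (edge_length_space G)
    {len \<in> topspace (edge_length_space G).
       point_spectrum T (lift_lengths \<Xi> len) (\<alpha> \<circ> \<Xi>) = {}}"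
proof -
  interpret G: pair_graph G by (rule assms(1))
  have tree: "undirected_tree T" and \<Xi>: "\<Xi> ` pverts T = pverts G"
    and bij: "\<And>t. t \<in> pverts T \<Longrightarrow> bij_betw \<Xi> (neighbours T t) (neighbours G (\<Xi> t))"
    using assms(6) by (auto simp: universal_cover_def graph_covering_def)
  have bidir: "pair_bidirected_digraph T" and conn: "Digraph_Component.connected (with_proj T)"
    using tree by (simp_all add: undirected_tree_def)
  interpret T: pair_bidirected_digraph T by (rule bidir)
  let ?A = "parcs T" and ?P = "map_prod \<Xi> \<Xi>"
  let ?\<beta> = "\<lambda>v. real_of_ereal (\<alpha> v)"
  have finG: "finite (neighbours G v)" for v
    by (rule finite_subset[of _ "snd ` parcs G"]) (force simp: neighbours_def, use G.pair_finite_arcs in simp)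
  have nbT: "?A `` {x} = neighbours T x" for x by (auto simp: neighbours_def)
  have finT: "finite (neighbours T v)" for v
  proof (cases "v \<in> pverts T")
    case True
    then show ?thesis using bij finG bij_betw_finite by blast
  next
    case False
    then have "neighbours T v = {}" using T.arc_fst_in_verts by (fastforce simp: neighbours_def)
    then show ?thesis by simp
  qed
  have PA: "?P ` ?A = parcs G"
  proof (intro equalityI subsetI)
    fix a assume "a \<in> ?P ` ?A"
    then obtain x y where xy: "(x, y) \<in> ?A" "a = (\<Xi> x, \<Xi> y)" by auto
    then have "x \<in> pverts T" using T.arc_fst_in_verts by fastforce
    from bij[OF this] have "\<Xi> y \<in> neighbours G (\<Xi> x)"
      using xy(1) by (auto simp: bij_betw_def neighbours_def)
    then show "a \<in> parcs G" using xy(2) by (simp add: neighbours_def)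
  next
    fix a assume a: "a \<in> parcs G"
    then have "fst a \<in> pverts G" by (rule G.arc_fst_in_verts)
    then obtain x where x: "x \<in> pverts T" "\<Xi> x = fst a" using \<Xi> by (metis imageE)
    have "snd a \<in> neighbours G (\<Xi> x)" using a x by (simp add: neighbours_def)
    then obtain y where "y \<in> neighbours T x" "\<Xi> y = snd a"
      using bij[OF x(1)] by (metis bij_betw_imp_surj_on imageE)
    then have "(x, y) \<in> ?A" "a = ?P (x, y)" using x by (simp_all add: neighbours_def prod_eq_iff)
    then show "a \<in> ?P ` ?A" by (rule rev_image_eqI)
  qed
  have lift: "lift_lengths \<Xi> len (arc_edge a) = len (arc_edge (?P a))" for len :: "'v set \<Rightarrow> real" and a
    by (cases a) (simp add: lift_lengths_def arc_edge_def)
  have walkT: "nb_walk ?A xs \<Longrightarrow> distinct xs" for xs by (rule undirected_tree_nb_walk_distinct[OF tree])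
  have connT: "(x, y) \<in> ?A\<^sup>*" if "x \<in> pverts T" "y \<in> pverts T" for x y
  proof -
    have "strongly_connected (with_proj T)"
      by (rule T.symmetric_connected_imp_strongly_connected[OF T.sym_arcs conn])
    then have "x \<rightarrow>\<^sup>*\<^bsub>with_proj T\<^esub> y" using that by (simp add: strongly_connected_def)
    then show ?thesis by (auto dest: reachable_rtranclI)
  qed
  show ?thesis
  proof (rule G.residual_good_lengths[where \<beta> = ?\<beta>])
    fix len
    assume "len \<in> topspace (edge_length_space G) -
      {len \<in> topspace (edge_length_space G). point_spectrum T (lift_lengths \<Xi> len) (\<alpha> \<circ> \<Xi>) = {}}"
    then obtain z where top: "len \<in> topspace (edge_length_space G)"
      and z: "z \<in> point_spectrum T (lift_lengths \<Xi> len) (\<alpha> \<circ> \<Xi>)" by blast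
    have len: "0 < len (arc_edge a)" if "a \<in> parcs G" for a
      using top that by (auto simp: topspace_edge_length_space edges_def)
    \<comment> \<open>The tree has only the finitely many edge lengths of \<open>G\<close>; their
      extremes are the uniform bounds required by \<open>ex_real_eigenfunction\<close>.\<close>
    define l where "l = (\<lambda>a. len (arc_edge a)) ` parcs G"
    have l: "finite l" using G.pair_finite_arcs by (simp add: l_def)
    have infA: "infinite ?A" by (rule infinite_universal_cover[OF assms(3,6)])
    then have "l \<noteq> {}" using PA by (auto simp: l_def)
    have "0 < Min l" using l \<open>l \<noteq> {}\<close> len by (auto simp: l_def)
    moreover have "Min l \<le> lift_lengths \<Xi> len (arc_edge a) \<and> lift_lengths \<Xi> len (arc_edge a) \<le> Max l"
      if "a \<in> ?A" for a
    proof -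
      have "?P a \<in> parcs G" using PA that by blast
      then have "len (arc_edge (?P a)) \<in> l" by (simp add: l_def)
      then show ?thesis using l by (simp add: lift)
    qed
    ultimately obtain f p where
      edge: "\<And>a. a \<in> ?A \<Longrightarrow> f (snd a) = cosz (Re z) (len (arc_edge (?P a))) * f (fst a) + sinz (Re z) (len (arc_edge (?P a))) * p a"
        "\<And>a. a \<in> ?A \<Longrightarrow> p (flip a) = Re z * sinz (Re z) (len (arc_edge (?P a))) * f (fst a) - cosz (Re z) (len (arc_edge (?P a))) * p a"
      and vertex: "\<And>v. v \<in> pverts T \<Longrightarrow> if (\<alpha> \<circ> \<Xi>) v = \<infinity> then f v = 0
        else (\<Sum>w\<in>neighbours T v. p (v, w)) = real_of_ereal ((\<alpha> \<circ> \<Xi>) v) * f v"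
      and summable: "(\<lambda>a. (f (fst a))\<^sup>2 + (p a)\<^sup>2) summable_on ?A"
      and nz: "\<exists>a\<in>?A. (f (fst a))\<^sup>2 + (p a)\<^sup>2 \<noteq> 0"
      using ex_real_eigenfunction[OF bidir finT _ _ z, of "Min l" "Max l"] unfolding lift by blast
    interpret tree_solution ?A "pverts T" "neighbours G" \<Xi> "\<lambda>a. cosz (Re z) (len (arc_edge a))"
      "\<lambda>a. sinz (Re z) (len (arc_edge a))" "Re z" ?\<beta> "{v. \<alpha> v = \<infinity>}" f p
    proof
      show "sym ?A" using T.arcs_symmetric by (auto intro: symI)
      show "finite (?A `` {x})" for x by (simp add: nbT finT)
      show "nb_walk ?A xs \<Longrightarrow> distinct xs" for xs by (rule walkT)
      show "?A \<subseteq> pverts T \<times> pverts T" using T.arc_fst_in_verts T.arc_snd_in_verts by fastforce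
      show "x \<in> pverts T \<Longrightarrow> bij_betw \<Xi> (?A `` {x}) (neighbours G (\<Xi> x))" for x
        unfolding nbT by (rule bij)
      show "finite (?P ` ?A)" unfolding PA by (rule G.pair_finite_arcs)
      show "\<Xi> x \<noteq> \<Xi> y" if "(x, y) \<in> ?A" for x y
      proof -
        have "?P (x, y) \<in> parcs G" using that PA by blast
        then show ?thesis using G.pair_no_loops[of "?P (x, y)"] by simp
      qed
      show "(x, y) \<in> ?A\<^sup>*" if "x \<in> pverts T" "y \<in> pverts T" for x y by (rule connT[OF that])
      show "infinite ?A" by (rule infA)
      show "(cosz (Re z) (len (arc_edge (?P a))))\<^sup>2 + Re z * (sinz (Re z) (len (arc_edge (?P a))))\<^sup>2 = 1" for a
        by (rule cosz_sinz_pythagoras)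
      show "(\<Sum>y\<in>?A `` {x}. p (x, y)) = ?\<beta> (\<Xi> x) * f x" if "x \<in> pverts T" "\<Xi> x \<notin> {v. \<alpha> v = \<infinity>}" for x
        using vertex[OF that(1)] that(2) by (simp add: nbT)
      show "f x = 0" if "x \<in> pverts T" "\<Xi> x \<in> {v. \<alpha> v = \<infinity>}" for x
        using vertex[OF that(1)] that(2) by simp
      show "card (?A `` {x}) = 1" if "x \<in> pverts T" "\<Xi> x \<in> {v. \<alpha> v = \<infinity>}" for x
      proof -
        have "\<Xi> x \<in> pverts G" using that(1) \<Xi> by blast
        then have "out_degree (with_proj G) (\<Xi> x) = 1" using assms(5) that(2) by blast
        moreover have "out_arcs (with_proj G) (\<Xi> x) = Pair (\<Xi> x) ` neighbours G (\<Xi> x)"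
          by (auto simp: out_arcs_def neighbours_def)
        ultimately have "card (neighbours G (\<Xi> x)) = 1"
          by (simp add: out_degree_def card_image inj_on_def)
        then show ?thesis using bij_betw_same_card[OF bij[OF that(1)]] by (simp add: nbT)
      qed
    qed (use edge summable in auto)
    obtain a0 where "a0 \<in> ?A" "q a0 \<noteq> 0" using nz unfolding q_def by blast
    from ex_node[OF this] obtain e where e: "e \<in> ?A" "q e \<noteq> 0" "f (fst e) = 0" "\<Xi> (fst e) \<notin> {v. \<alpha> v = \<infinity>}" by blast
    from ex_component_avoiding[OF this] obtain b where b: "b \<in> ?A" "q b \<noteq> 0"
      and avoid: "\<And>d. (b, d) \<in> step\<^sup>* \<Longrightarrow> ?P d \<noteq> ?P e" by blast
    \<comment> \<open>The component of \<open>e\<close> gives the solution with a nonzero slope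
      along P e, the component of \<open>b\<close> the one that vanishes on this edge.\<close>
    from component_projection[OF e(1,2), unfolded PA] obtain Y \<Sigma> F D where
      1: "\<forall>a\<in>parcs G. F (snd a) = (if a \<in> \<Sigma> then - 1 else 1) *
          (cosz (Re z) (len (arc_edge a)) * F (fst a) + sinz (Re z) (len (arc_edge a)) * D a) \<and>
        D (flip a) = (if a \<in> \<Sigma> then - 1 else 1) *
          (Re z * sinz (Re z) (len (arc_edge a)) * F (fst a) - cosz (Re z) (len (arc_edge a)) * D a)"
        "Y \<subseteq> fst ` parcs G - {v. \<alpha> v = \<infinity>}" "\<Sigma> \<subseteq> parcs G"
        "\<forall>v\<in>Y. (\<Sum>w\<in>neighbours G v. D (v, w)) = ?\<beta> v * F v"
        "\<forall>v. v \<notin> Y \<longrightarrow> F v = 0"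
        "\<forall>a. a \<notin> ?P ` (step\<^sup>* `` {e}) \<longrightarrow> D a = 0"
        "\<forall>a\<in>?P ` (step\<^sup>* `` {e}). (F (fst a))\<^sup>2 + (D a)\<^sup>2 \<noteq> 0"
        "\<forall>b\<in>step\<^sup>* `` {e}. f (fst b) = 0 \<longrightarrow> \<Xi> (fst b) \<notin> Y"
      by (elim exE conjE) (rule that)
    from component_projection[OF b, unfolded PA] obtain Y' \<Sigma>' F' D' where
      2: "\<forall>a\<in>parcs G. F' (snd a) = (if a \<in> \<Sigma>' then - 1 else 1) *
          (cosz (Re z) (len (arc_edge a)) * F' (fst a) + sinz (Re z) (len (arc_edge a)) * D' a) \<and>
        D' (flip a) = (if a \<in> \<Sigma>' then - 1 else 1) *
          (Re z * sinz (Re z) (len (arc_edge a)) * F' (fst a) - cosz (Re z) (len (arc_edge a)) * D' a)"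
        "Y' \<subseteq> fst ` parcs G - {v. \<alpha> v = \<infinity>}" "\<Sigma>' \<subseteq> parcs G"
        "\<forall>v\<in>Y'. (\<Sum>w\<in>neighbours G v. D' (v, w)) = ?\<beta> v * F' v"
        "\<forall>v. v \<notin> Y' \<longrightarrow> F' v = 0"
        "\<forall>a. a \<notin> ?P ` (step\<^sup>* `` {b}) \<longrightarrow> D' a = 0"
        "\<forall>a\<in>parcs G - ?P ` (step\<^sup>* `` {b}). F' (fst a) = 0"
        "\<forall>a\<in>?P ` (step\<^sup>* `` {b}). (F' (fst a))\<^sup>2 + (D' a)\<^sup>2 \<noteq> 0"
      by (elim exE conjE) (rule that)
    define a where "a = ?P e"
    have a: "a \<in> parcs G" "flip a \<in> parcs G" 
    proof -
      show "a \<in> parcs G" unfolding PA[symmetric] a_def using e(1) by (rule imageI)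
      then show "flip a \<in> parcs G" by (rule G.flip_in)
    qed
    have KG: "?P ` (step\<^sup>* `` {d}) \<subseteq> parcs G" if "d \<in> ?A" for d
      unfolding PA[symmetric] by (rule image_mono) (use steps_A that in blast)
    have "a \<in> ?P ` (step\<^sup>* `` {e})" unfolding a_def by (rule imageI) simp
    then have Da: "(F (fst a))\<^sup>2 + (D a)\<^sup>2 \<noteq> 0" using 1(7) by blast
    have "\<Xi> (fst e) \<notin> Y" using 1(8) e(3) by blast
    then have Fa: "F (fst a) = 0" using 1(5) by (simp add: a_def)
    have D0: "\<forall>x. x \<notin> parcs G \<longrightarrow> D x = 0"
    proof (intro allI impI)
      fix x assume "x \<notin> parcs G"
      then have "x \<notin> ?P ` (step\<^sup>* `` {e})" using KG[OF e(1)] by (rule contra_subsetD[rotated])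
      then show "D x = 0" by (rule 1(6)[rule_format])
    qed
    have "\<exists>c. c \<noteq> 0 \<and> normal_solution G ?\<beta> Y \<Sigma> len (Re z) (\<lambda>v. c * F v) (\<lambda>a. c * D a)"
      by (rule G.graph_solution_of_component[OF 1(1) subset_trans[OF 1(2) Diff_subset] 1(4,5) D0 a(1) Da])
    then obtain c where c: "c \<noteq> 0" "normal_solution G ?\<beta> Y \<Sigma> len (Re z) (\<lambda>v. c * F v) (\<lambda>a. c * D a)" by blast
    have "?P b \<in> ?P ` (step\<^sup>* `` {b})" by (rule imageI) simp
    note Pb = subsetD[OF KG[OF b(1)] this] bspec[OF 2(8) this]
    have D'0: "\<forall>x. x \<notin> parcs G \<longrightarrow> D' x = 0"
    proof (intro allI impI)
      fix x assume "x \<notin> parcs G"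
      then have "x \<notin> ?P ` (step\<^sup>* `` {b})" using KG[OF b(1)] by (rule contra_subsetD[rotated])
      then show "D' x = 0" by (rule 2(6)[rule_format])
    qed
    have "\<exists>c. c \<noteq> 0 \<and> normal_solution G ?\<beta> Y' \<Sigma>' len (Re z) (\<lambda>v. c * F' v) (\<lambda>a. c * D' a)"
      by (rule G.graph_solution_of_component[OF 2(1) subset_trans[OF 2(2) Diff_subset] 2(4,5) D'0 Pb])
    then obtain c' where c': "normal_solution G ?\<beta> Y' \<Sigma>' len (Re z) (\<lambda>v. c' * F' v) (\<lambda>a. c' * D' a)" by blast
    have off: "a \<notin> ?P ` (step\<^sup>* `` {b})"
    proof
      assume "a \<in> ?P ` (step\<^sup>* `` {b})"
      then obtain d where "a = ?P d" "d \<in> step\<^sup>* `` {b}" by (rule imageE)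
      then show False using avoid[of d] by (simp add: a_def)
    qed
    \<comment> \<open>A component is closed under reversal, so it avoids the reversed base arc as
      well.\<close>
    have off': "flip a \<notin> ?P ` (step\<^sup>* `` {b})"
    proof
      assume "flip a \<in> ?P ` (step\<^sup>* `` {b})"
      moreover have "flip d \<in> step\<^sup>* `` {b}" if "d \<in> step\<^sup>* `` {b}" for d
      proof -
        have bd: "(b, d) \<in> step\<^sup>*" using that by simp
        with step_flip[OF steps_A[OF bd b(1)]] have "(b, flip d) \<in> step\<^sup>*"
          by (rule rtrancl.rtrancl_into_rtrancl[rotated])
        then show ?thesis by simp
      qed
      ultimately have "flip (flip a) \<in> ?P ` (step\<^sup>* `` {b})" by (rule flip_image_P)
      then show False using off by simp
    qed
    have F'0: "F' (fst a) = 0" "F' (snd a) = 0" "D' a = 0" "D' (flip a) = 0"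
      using 2(6)[rule_format, OF off] 2(6)[rule_format, OF off'] bspec[OF 2(7) DiffI[OF a(1) off]] bspec[OF 2(7) DiffI[OF a(2) off']] by simp_all
    define d where "d = \<bar>c * D a\<bar>"
    have "0 < d" using Da Fa c(1) by (simp add: d_def)
    obtain n1 :: nat where n1: "1 / d < real n1" using reals_Archimedean2 by blast
    obtain n2 :: nat where n2: "\<bar>Re z\<bar> < real n2" using reals_Archimedean2 by blast
    \<comment> \<open>Large enough for both closing bounds, |z| <= n and 1 / (n + 1) <= d. The slope
      d is positive because the value at the start of the arc is 0 while its data are
      nonzero.\<close>
    define n where "n = max n1 n2"
    have zn: "Re z \<in> {- real n..real n}" using n2 by (auto simp: n_def)
    have "1 / d < real n + 1" using n1 by (simp add: n_def)
    then have "1 / (real n + 1) \<le> d" using \<open>0 < d\<close> by (simp add: pos_divide_less_eq pos_divide_le_eq mult.commute)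
    then have Dn: "1 / (real n + 1) \<le> \<bar>c * D a\<bar>" by (simp only: d_def)
    have "len \<in> bad_lengths G ?\<beta> Y \<Sigma> Y' \<Sigma>' a n"
      unfolding bad_lengths_def using top zn c(2) Dn c' Fa F'0
      by (intro CollectI conjI exI[of _ "Re z"] exI[of _ "\<lambda>v. c * F v"] exI[of _ "\<lambda>a. c * D a"]
          exI[of _ "\<lambda>v. c' * F' v"] exI[of _ "\<lambda>a. c' * D' a"]) simp_all
    moreover have "fst ` parcs G \<subseteq> pverts G" using G.arc_fst_in_verts by blast
    then have "Y \<subseteq> pverts G" "Y' \<subseteq> pverts G" using 1(2) 2(2) by auto
    ultimately show "\<exists>Y\<subseteq>pverts G. \<exists>\<Sigma>\<subseteq>parcs G. \<exists>Y'\<subseteq>pverts G. \<exists>\<Sigma>'\<subseteq>parcs G. \<exists>e\<in>parcs G. \<exists>n.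
        len \<in> bad_lengths G ?\<beta> Y \<Sigma> Y' \<Sigma>' e n"
      using 1(3) 2(3) a(1) by blast
  qed blast
qed

end
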